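(* Consider the setting of the context, with a general (possibly continuous) state space $\mathcal I$ and exact scores $\widehat Q_x(I)=Q(x,\xi_I)$. Fix $w>0$, let $P_x$ be the Markov kernel induced by the uniform proposal distribution on $\mathcal I$ and the Metropolis–Hastings acceptance, and run the projected stochastic subgradient method of the context with step sizes $\alpha_n=\alpha_0/\sqrt n$ for some $\alpha_0>0$. Assume that $P_x$ satisfies the Lipschitz-kernel condition $\sup_{I\in\mathcal I}\|P_x(I,\cdot)-P_y(I,\cdot)\|_{\mathrm{TV}}\le L_P\|x-y\|$ for all $x,y\in\mathcal X$ (for which $L_P=2L_Q'/w$ may be taken) and the uniform-mixing condition $\sup_{I,J\in\mathcal I}\|P_x(I,\cdot)-P_x(J,\cdot)\|_{\mathrm{TV}}\le\bar\eta$ for all $x\in\mathcal X$, with $\bar\eta\in[0,1)$. Then, with $C_*=(1+\bar\eta)/(1-\bar\eta)$, $$\mathbb E\big[F_w^\nu(\bar x_n)\big]-\min_{x\in\mathcal X}F_w^\nu(x)=\begin{cases}O\Big[\big(C_*+C_*^2/w\big)\dfrac{\log n}{\sqrt n}\Big]&\text{for the step-size average }\bar x_n=\dfrac{\sum_{k=1}^n\alpha_kx_k}{\sum_{k=1}^n\alpha_k},\\[1em]O\Big[\big(C_*+C_*^2/w\big)\dfrac1{\sqrt n}\Big]&\text{for the linear average }\bar x_n=\dfrac{\sum_{k=1}^nkx_k}{\sum_{k=1}^nk},\end{cases}$$ as $n\to\infty$, with hidden constants depending only on $D,L_f,L_Q'$ and $\alpha_0$.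
   Context: $\|\cdot\|$ is the Euclidean norm; $\|\mu-\lambda\|_{\mathrm{TV}}=\sup_B|\mu(B)-\lambda(B)|$. $\mathcal X\subset\mathbb R^{d_x}$ is nonempty, compact and convex with $\|x-x'\|_1\le D$ for all $x,x'\in\mathcal X$; $f$ is convex and $L_f$-Lipschitz on an open neighborhood of $\mathcal X$. $\Xi\subset\mathbb R^{d_\xi}$ is an uncertainty set and, for matrices $G,E,U$ and vectors $b,h$, $Q(x,\xi):=\min_y\{b^\top y:Gy+Ex+U\xi-h\ge0\}$, assumed finite for all $(x,\xi)\in\mathcal X\times\Xi$. $\mathcal I$ is a state space with its Borel $\sigma$-algebra, $I\mapsto\xi_I\in\Xi$ is measurable, $\sup_{I\in\mathcal I}Q(x,\xi_I)=\sup_{\xi\in\Xi}Q(x,\xi)$ for all $x$, and $I\mapsto Q(x,\xi_I)$ is bounded and measurable. $\nu$ is the uniform probability measure on $\mathcal I$ (a reference probability measure of full support), and $$F_w^\nu(x):=f(x)+w\log\int_{\mathcal I}\exp\{Q(x,\xi_I)/w\}\,\nu(dI).$$ By LP duality $Q(x,\xi_I)=\max\{\pi^\top(h-Ex-U\xi_I):\pi\ge0,\ G^\top\pi=b\}$; $\pi^\star(x,I)$ denotes a maximizer (a measurable selection minimizing $\|E^\top\pi\|_1$ among maximizers). $L_Q'>0$ is a constant such that each $Q(\cdot,\xi_I)$ is $L_Q'$-Lipschitz on $\mathcal X$ and $\|E^\top\pi^\star(x,I)\|\le L_Q'$ for all $x,I$. $g_f(x)\in\partial f(x)$ is a measurable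 subgradient selection and $Z_x(I):=g_f(x)-E^\top\pi^\star(x,I)$. Kernel: from state $I$, propose $J\sim\nu$ and move to $J$ with probability $A_x(I,J)=\min\{1,\exp((Q(x,\xi_J)-Q(x,\xi_I))/w)\}$, otherwise stay at $I$; $P_x$ denotes the resulting Markov kernel. Method: start from $x_0\in\mathcal X$, $I_0\sim\nu$. For $n=0,1,\dots$: conditionally on the past $\sigma((x_t,I_t):t\le n)$ draw $I_{n+1}\sim P_{x_n}(I_n,\cdot)$ and set $x_{n+1}=\Pi_{\mathcal X}(x_n-\alpha_{n+1}Z_{x_n}(I_{n+1}))$, with $\Pi_{\mathcal X}$ the Euclidean projection. *)

theory Defs
  imports "HOL-Probability.Probability"
begin

definition norm1 :: "real ^ 'n \<Rightarrow> real" where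
  "norm1 x = (\<Sum>i\<in>UNIV. \<bar>x $ i\<bar>)"

text \<open>Subdifferential of a convex function whose domain is \<open>N\<close>. If \<open>x\<close> is an interior point of \<open>N\<close>,
  shrinking \<open>N\<close> to a smaller convex neighbourhood of \<open>x\<close> does not change the set.\<close>

definition subdifferential :: "'a::real_inner set \<Rightarrow> ('a \<Rightarrow> real) \<Rightarrow> 'a \<Rightarrow> 'a set" where
  "subdifferential N f x = {g. \<forall>y\<in>N. f x + g \<bullet> (y - x) \<le> f y}"

definition tv_dist :: "'i measure \<Rightarrow> 'i measure \<Rightarrow> real" where
  "tv_dist \<mu> \<kappa> = (SUP B\<in>sets \<mu>. \<bar>measure \<mu> B - measure \<kappa> B\<bar>)"

text \<open>The order on \<open>real ^ 'c\<close> is the componentwise one.\<close>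

definition recourse_feasible ::
  "real ^ 'y ^ 'c \<Rightarrow> real ^ 'n ^ 'c \<Rightarrow> real ^ 'k ^ 'c \<Rightarrow> real ^ 'c \<Rightarrow> real ^ 'n \<Rightarrow> real ^ 'k \<Rightarrow> (real ^ 'y) set"
  where "recourse_feasible G E U h x \<zeta> = {y. 0 \<le> G *v y + E *v x + U *v \<zeta> - h}"

text \<open>For a feasible linear program that is bounded below, the infimum is a minimum.\<close>

definition recourse_cost ::
  "real ^ 'y ^ 'c \<Rightarrow> real ^ 'n ^ 'c \<Rightarrow> real ^ 'k ^ 'c \<Rightarrow> real ^ 'y \<Rightarrow> real ^ 'c
    \<Rightarrow> real ^ 'n \<Rightarrow> real ^ 'k \<Rightarrow> real"
  where "recourse_cost G E U b h x \<zeta> = (INF y\<in>recourse_feasible G E U h x \<zeta>. b \<bullet> y)"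

definition recourse_finite ::
  "real ^ 'y ^ 'c \<Rightarrow> real ^ 'n ^ 'c \<Rightarrow> real ^ 'k ^ 'c \<Rightarrow> real ^ 'y \<Rightarrow> real ^ 'c
    \<Rightarrow> real ^ 'n \<Rightarrow> real ^ 'k \<Rightarrow> bool"
  where "recourse_finite G E U b h x \<zeta> \<longleftrightarrow>
    recourse_feasible G E U h x \<zeta> \<noteq> {} \<and>
    bdd_below ((\<lambda>y. b \<bullet> y) ` recourse_feasible G E U h x \<zeta>)"

definition dual_feasible :: "real ^ 'y ^ 'c \<Rightarrow> real ^ 'y \<Rightarrow> (real ^ 'c) set" where
  "dual_feasible G b = {p. 0 \<le> p \<and> transpose G *v p = b}"

definition dual_maximizer ::
  "real ^ 'y ^ 'c \<Rightarrow> real ^ 'n ^ 'c \<Rightarrow> real ^ 'k ^ 'c \<Rightarrow> real ^ 'y \<Rightarrow> real ^ 'c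
    \<Rightarrow> real ^ 'n \<Rightarrow> real ^ 'k \<Rightarrow> real ^ 'c \<Rightarrow> bool"
  where "dual_maximizer G E U b h x \<zeta> =
    is_arg_max (\<lambda>p. p \<bullet> (h - E *v x - U *v \<zeta>)) (\<lambda>p. p \<in> dual_feasible G b)"

definition smoothed_objective ::
  "'i measure \<Rightarrow> real \<Rightarrow> ('x \<Rightarrow> real) \<Rightarrow> ('x \<Rightarrow> 'i \<Rightarrow> real) \<Rightarrow> 'x \<Rightarrow> real"
  where "smoothed_objective \<nu> w f q x = f x + w * ln (\<integral>I. exp (q x I / w) \<partial>\<nu>)"

definition mh_accept :: "real \<Rightarrow> ('x \<Rightarrow> 'i \<Rightarrow> real) \<Rightarrow> 'x \<Rightarrow> 'i \<Rightarrow> 'i \<Rightarrow> real" where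
  "mh_accept w q x I J = min 1 (exp ((q x J - q x I) / w))"

definition mh_kernel ::
  "'i measure \<Rightarrow> real \<Rightarrow> ('x \<Rightarrow> 'i \<Rightarrow> real) \<Rightarrow> 'x \<Rightarrow> 'i \<Rightarrow> 'i measure"
  where "mh_kernel \<nu> w q x I =
    \<nu> \<bind> (\<lambda>J. measure_pmf (bernoulli_pmf (mh_accept w q x I J))
      \<bind> (\<lambda>accepted. return \<nu> (if accepted then J else I)))"

text \<open>The \<open>\<sigma>\<close>-algebra generated by \<open>(xs t, Is t)\<close>, \<open>t \<le> n\<close>, as a (null) measure on \<open>space M\<close>,
  which is the form that \<^const>\<open>real_cond_exp\<close> takes.\<close>

definition past_algebra ::
  "'o measure \<Rightarrow> 'i measure \<Rightarrow> (nat \<Rightarrow> 'o \<Rightarrow> 'x::topological_space) \<Rightarrow> (nat \<Rightarrow> 'o \<Rightarrow> 'i)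
    \<Rightarrow> nat \<Rightarrow> 'o measure"
  where "past_algebra M N xs Is n = sigma (space M)
    {(\<lambda>\<omega>. (xs t \<omega>, Is t \<omega>)) -` A \<inter> space M | t A. t \<le> n \<and> A \<in> sets (borel \<Otimes>\<^sub>M N)}"

definition weighted_average :: "(nat \<Rightarrow> real) \<Rightarrow> (nat \<Rightarrow> 'a::real_vector) \<Rightarrow> nat \<Rightarrow> 'a" where
  "weighted_average c x n = (\<Sum>k=1..n. c k *\<^sub>R x k) /\<^sub>R (\<Sum>k=1..n. c k)"

text \<open>The hidden constant of the rates, as a function of \<open>D\<close>, \<open>L\<^sub>f\<close>, \<open>L\<^sub>Q'\<close> and \<open>\<alpha>\<^sub>0\<close> alone. It is a
  closed term because an existential quantifier inside a theorem is below the type variables, so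
  that the witness could depend on the dimensions and on the state space. The summands come
  from the telescoped squared distances, from the boundary terms of the Poisson equation of the
  chain, and from the squared steps together with the drift of the kernel; the factor 1000 is
  not sharp.\<close>

definition rate_const :: "real \<Rightarrow> real \<Rightarrow> real \<Rightarrow> real \<Rightarrow> real" where
  "rate_const D Lf LQ \<alpha>0 =
    (let L = Lf + LQ in 1000 * (D\<^sup>2 / \<alpha>0 + L * D + L\<^sup>2 * (1 + L * D) * \<alpha>0))"

end

theory Submission
  imports Defs
begin

text \<open>Fix a comparison point \<open>y\<close>. By LP duality \<open>Z\<^sub>x(I)\<close> is a subgradient of \<open>f + q(\<cdot>, I)\<close> at \<open>x\<close>, so
  \<open>\<psi>\<^sub>x(I) = (f x + q x I) - (f y + q y I)\<close> is at most \<open>Z\<^sub>x(I) \<bullet> (x - y)\<close>, and by Jensen's inequality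
  \<open>F x - F y\<close> is at most the mean \<open>m(x)\<close> of \<open>\<psi>\<^sub>x\<close> under the Gibbs measure, which is stationary for
  the kernel \<open>P\<^sub>x\<close>. The bias \<open>\<psi>\<^sub>x - m(x)\<close> along the chain is written as \<open>u\<^sub>x - P\<^sub>x u\<^sub>x\<close> with the
  solution of the Poisson equation. Uniform mixing bounds \<open>u\<^sub>x\<close>, and the Lipschitz continuity of
  \<open>x \<mapsto> P\<^sub>x\<close> and \<open>x \<mapsto> \<psi>\<^sub>x\<close> makes \<open>P\<^sub>x u\<^sub>x\<close> Lipschitz in \<open>x\<close>, so that in expectation the bias
  telescopes up to an error proportional to the step size.\<close>

text \<open>The obstacle is bias: the next state comes from one Metropolis step out of the current
  state, not from the Gibbs measure of the current iterate, so \<open>Z\<close> is no unbiased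
  subgradient of the smoothed objective. What rescues the argument is that an iterate moves by at
  most the step size times \<open>Lf + LQ\<close>, so the chain follows a slowly moving target. The
  constant \<open>C + C\<^sup>2 / w\<close> has two sources. Over the states, \<psi> oscillates by
  at most \<open>2 * LQ * D\<close>, so the Poisson solution is of size
  \<open>2 * LQ * D / (1 - \<eta>)\<close>: one factor \<open>C\<close>. Comparing the solutions at
  two iterates costs another \<open>1 / (1 - \<eta>)\<close>, times the Lipschitz constant
  \<open>2 * LQ / w\<close> of the kernel: this is \<open>C\<^sup>2 / w\<close>. The telescoped
  squared distances carry neither factor and are absorbed because \<open>C + C\<^sup>2 / w\<close>
  is at least 1. The logarithm comes only from the weights: the step-size average sums products of
  consecutive step sizes, a harmonic sum, while the linear average does not.\<close>

section \<open>Linear programming duality\<close>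

text \<open>\<open>(b, m)\<close> lies in the closed cone generated by the columns of the dual constraints and
  \<open>(0, -1)\<close>; a separating hyperplane would be a primal point of value below \<open>m\<close> or a primal
  direction of unbounded descent.\<close>

lemma lp_dual_bound:
  fixes G :: "real ^ 'y ^ 'c" and c :: "real ^ 'c" and b y0 :: "real ^ 'y"
  assumes y0: "c \<le> G *v y0" and m: "\<And>y. c \<le> G *v y \<Longrightarrow> m \<le> b \<bullet> y"
  shows "\<exists>p. 0 \<le> p \<and> transpose G *v p = b \<and> m \<le> p \<bullet> c"
proof -
  define gen where "gen i = (row i G, c $ i)" for i
  \<comment> \<open>Finitely many generators make \<open>K\<close> closed, as the separation
    requires. \<open>T\<close> describes the cone explicitly by a nonnegative \<open>p\<close> and a
    slack \<open>s\<close>, so that \<open>(b, m) \<in> T\<close> is the claim.\<close>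
  define K where "K = convex_cone hull (insert (0, -1) (range gen))"
  define T where "T = {(transpose G *v p, p \<bullet> c - s) | p s. 0 \<le> p \<and> 0 \<le> (s::real)}"
  have "K \<subseteq> T"
    unfolding K_def
  proof (rule hull_minimal)
    have "(0, -1) \<in> T"
      unfolding T_def mem_Collect_eq by (rule exI[of _ 0], rule exI[of _ 1]) auto
    moreover have "gen i \<in> T" for i
    proof -
      have "0 \<le> (axis i 1 :: real ^ 'c)" by (simp add: less_eq_vec_def axis_def)
      moreover have "gen i = (transpose G *v axis i 1, axis i 1 \<bullet> c - 0)"
        unfolding gen_def by (simp add: matrix_vector_mult_basis inner_axis' del: transpose_matrix_vector)
      ultimately show ?thesis unfolding T_def by blast
    qed
    ultimately show "insert (0, -1) (range gen) \<subseteq> T" by auto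
    have "x + y \<in> T" if "x \<in> T" "y \<in> T" for x y
    proof -
      obtain p s p' s' where "x = (transpose G *v p, p \<bullet> c - s)" "0 \<le> p" "0 \<le> s"
        "y = (transpose G *v p', p' \<bullet> c - s')" "0 \<le> p'" "0 \<le> s'"
        using \<open>x \<in> T\<close> \<open>y \<in> T\<close> unfolding T_def by blast
      then show ?thesis
        unfolding T_def mem_Collect_eq
        by (intro exI[of _ "p + p'"] exI[of _ "s + s'"])
          (simp add: matrix_vector_right_distrib inner_add_left del: transpose_matrix_vector)
    qed
    moreover have "r *\<^sub>R x \<in> T" if "x \<in> T" "0 \<le> r" for x r
    proof -
      obtain p s where "x = (transpose G *v p, p \<bullet> c - s)" "0 \<le> p" "0 \<le> s"
        using \<open>x \<in> T\<close> unfolding T_def by blast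
      then show ?thesis
        unfolding T_def mem_Collect_eq using \<open>0 \<le> r\<close>
        by (intro exI[of _ "r *\<^sub>R p"] exI[of _ "r * s"])
          (simp add: matrix_vector_mult_scaleR less_eq_vec_def right_diff_distrib del: transpose_matrix_vector)
    qed
    moreover have "0 \<in> T"
      unfolding T_def mem_Collect_eq by (rule exI[of _ 0], rule exI[of _ 0]) (auto simp: zero_prod_def)
    ultimately show "convex_cone T" by (simp add: convex_cone_iff)
  qed
  have "(b, m) \<in> K"
  proof (rule ccontr)
    assume "(b, m) \<notin> K"
    moreover have "convex K" "closed K" and cone: "convex_cone K"
      unfolding K_def
      by (simp_all add: convex_convex_cone_hull closed_convex_cone_hull convex_cone_convex_cone_hull)
    ultimately obtain a \<beta> where a: "a \<bullet> (b, m) < \<beta>" "\<And>z. z \<in> K \<Longrightarrow> \<beta> < a \<bullet> z"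
      using separating_hyperplane_closed_point[of K "(b, m)"] by blast
    obtain u t where ut: "a = (u, t)" by (cases a)
    have "0 \<in> K" unfolding K_def by (rule convex_cone_hull_contains_0)
    from a(2)[OF this] have "\<beta> < 0" by simp
    \<comment> \<open>A point of \<open>K\<close> with negative value could be rescaled inside the
      cone to the value \<beta> itself, against strict separation; so the bound \<beta> improves to
      0.\<close>
    have nonneg: "0 \<le> a \<bullet> z" if "z \<in> K" for z
    proof (rule ccontr)
      assume neg: "\<not> 0 \<le> a \<bullet> z"
      then have "(\<beta> / (a \<bullet> z)) *\<^sub>R z \<in> K"
        using cone \<open>\<beta> < 0\<close> \<open>z \<in> K\<close> by (simp add: convex_cone_scaleR divide_nonpos_neg)
      from a(2)[OF this] show False using neg by simp
    qed
    have "(0, -1) \<in> K" and "gen i \<in> K" for i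
      unfolding K_def by (simp_all add: hull_inc)
    then have t: "t \<le> 0" and row: "0 \<le> u \<bullet> row i G + t * c $ i" for i
      using nonneg[of "(0, -1)"] nonneg[of "gen i" for i] by (simp_all add: ut gen_def)
    have ubt: "u \<bullet> b + t * m < 0" using a(1) \<open>\<beta> < 0\<close> by (auto simp: ut)
    have rowmul: "(G *v y) $ i = y \<bullet> row i G" for y i
      by (simp add: matrix_vector_mul_component row_def inner_commute)
    show False
    proof (cases "t = 0")
      case True
      \<comment> \<open>Here \<open>u\<close> preserves feasibility and decreases the cost; this
        \<open>r\<close> brings the cost of \<open>y0 + r *\<^sub>R u\<close> down to
        \<open>m - 1\<close>.\<close>
      define r where "r = (b \<bullet> y0 - m + 1) / (- (b \<bullet> u))"
      have bu: "b \<bullet> u < 0" using ubt True by (simp add: inner_commute)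
      have "0 \<le> r" unfolding r_def using m[OF y0] bu by (intro divide_nonneg_pos) auto
      then have "c \<le> G *v (y0 + r *\<^sub>R u)"
        using y0 row True unfolding less_eq_vec_def rowmul
        by (simp add: inner_add_left add_increasing2)
      from m[OF this] have "m \<le> b \<bullet> y0 + r * (b \<bullet> u)" by (simp add: inner_add_right)
      then show False using bu by (simp add: r_def)
    next
      case False
      then have "t < 0" using t by simp
      \<comment> \<open>Normalizing by \<open>t < 0\<close> yields a feasible point,
        \<open>- u / t\<close>, whose cost is below \<open>m\<close>.\<close>
      have "c $ i \<le> - (u \<bullet> row i G / t)" for i
        using row[of i] \<open>t < 0\<close> by (simp add: field_simps)
      then have "c \<le> G *v ((- 1 / t) *\<^sub>R u)"
        unfolding less_eq_vec_def rowmul by simp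
      from m[OF this] show False using \<open>t < 0\<close> ubt by (simp add: neg_le_divide_eq field_simps inner_commute)
    qed
  qed
  then have "(b, m) \<in> T" using \<open>K \<subseteq> T\<close> by blast
  then obtain p s where "(b, m) = (transpose G *v p, p \<bullet> c - s)" "0 \<le> p" "0 \<le> s"
    unfolding T_def by blast
  then show ?thesis by (intro exI[of _ p]) simp
qed

text \<open>The dual feasible set does not involve \<open>x\<close>, so the maximizer
  \<open>p\<close> at \<open>x\<close> remains feasible at \<open>y\<close>. Strong duality at
  \<open>x\<close> and weak duality at \<open>y\<close> then suffice, since the dual value of the
  fixed \<open>p\<close> is affine in the decision.\<close>

lemma recourse_cost_dual_subgradient:
  assumes fin: "recourse_finite G E U b h x \<zeta>" "recourse_finite G E U b h y \<zeta>"
    and p: "dual_maximizer G E U b h x \<zeta> p"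
  shows "recourse_cost G E U b h x \<zeta> - (transpose E *v p) \<bullet> (y - x) \<le> recourse_cost G E U b h y \<zeta>"
proof -
  define c where "c z = h - E *v z - U *v \<zeta>" for z
  have feas: "recourse_feasible G E U h z \<zeta> = {y. c z \<le> G *v y}" for z
    unfolding recourse_feasible_def c_def by (auto simp: less_eq_vec_def algebra_simps)
  have p0: "0 \<le> p" "transpose G *v p = b"
    and pmax: "\<And>p'. p' \<in> dual_feasible G b \<Longrightarrow> p' \<bullet> c x \<le> p \<bullet> c x"
    using p unfolding dual_maximizer_def is_arg_max_def dual_feasible_def c_def by force+
  have weak: "p \<bullet> c y \<le> b \<bullet> v" if "c y \<le> G *v v" for v
  proof -
    have "p \<bullet> c y \<le> p \<bullet> (G *v v)"
      using that p0(1) unfolding inner_vec_def less_eq_vec_def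
      by (auto intro!: sum_mono mult_left_mono)
    also have "\<dots> = b \<bullet> v"
      unfolding p0(2)[symmetric] by (simp add: dot_lmul_matrix)
    finally show ?thesis .
  qed
  obtain y0 where "c x \<le> G *v y0" using fin(1) unfolding recourse_finite_def feas by auto
  moreover have "recourse_cost G E U b h x \<zeta> \<le> b \<bullet> v" if "c x \<le> G *v v" for v
    unfolding recourse_cost_def
    using fin(1) that by (intro cINF_lower) (auto simp: feas recourse_finite_def)
  ultimately obtain p' where "p' \<in> dual_feasible G b" "recourse_cost G E U b h x \<zeta> \<le> p' \<bullet> c x"
    using lp_dual_bound[of "c x" G y0 "recourse_cost G E U b h x \<zeta>" b] unfolding dual_feasible_def by blast
  then have "recourse_cost G E U b h x \<zeta> \<le> p \<bullet> c x" using pmax by force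
  moreover have "p \<bullet> c y \<le> recourse_cost G E U b h y \<zeta>"
    unfolding recourse_cost_def
    using fin(2) weak by (intro cINF_greatest) (auto simp: feas recourse_finite_def)
  moreover have "p \<bullet> c y = p \<bullet> c x - (transpose E *v p) \<bullet> (y - x)"
  proof -
    have "c y = c x - E *v (y - x)" by (simp add: c_def matrix_vector_mult_diff_distrib)
    then show ?thesis by (simp add: matrix_vector_mult_diff_distrib inner_diff_right dot_lmul_matrix)
  qed
  ultimately show ?thesis by linarith
qed

section \<open>Total variation and integrals\<close>

lemma abs_measure_diff_le_1:
  assumes "prob_space \<mu>" "prob_space \<kappa>"
  shows "\<bar>measure \<mu> B - measure \<kappa> B\<bar> \<le> 1"
  using prob_space.prob_le_1[OF assms(1), of B] prob_space.prob_le_1[OF assms(2), of B]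
    measure_nonneg[of \<mu> B] measure_nonneg[of \<kappa> B] by linarith

lemma tv_dist_le:
  assumes "\<And>B. B \<in> sets \<mu> \<Longrightarrow> \<bar>measure \<mu> B - measure \<kappa> B\<bar> \<le> a"
  shows "tv_dist \<mu> \<kappa> \<le> a"
  unfolding tv_dist_def by (rule cSUP_least) (use assms in auto)

lemma tv_dist_le_1:
  assumes "prob_space \<mu>" "prob_space \<kappa>"
  shows "tv_dist \<mu> \<kappa> \<le> 1"
  by (rule tv_dist_le) (rule abs_measure_diff_le_1[OF assms])

lemma tv_dist_upper:
  assumes "prob_space \<mu>" "prob_space \<kappa>" "B \<in> sets \<mu>"
  shows "\<bar>measure \<mu> B - measure \<kappa> B\<bar> \<le> tv_dist \<mu> \<kappa>"
  unfolding tv_dist_def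
  by (rule cSUP_upper[OF assms(3) bdd_aboveI2[of _ _ 1]]) (rule abs_measure_diff_le_1[OF assms(1,2)])

text \<open>Discrete layer-cake formula: the floor of \<open>m * t\<close> counts the levels
  \<open>j / m\<close> at or below \<open>t\<close>. It turns a function with values in the unit
  interval into a sum of indicators of superlevel sets.\<close>

lemma level_sum:
  fixes t :: real
  assumes "0 \<le> t" "t \<le> 1"
  shows "real (nat \<lfloor>real m * t\<rfloor>) = (\<Sum>j=1..m. indicat_real {real j / real m..} t)"
proof (cases "m = 0")
  case False
  define z where "z = nat \<lfloor>real m * t\<rfloor>"
  have "z \<le> m"
    unfolding z_def using floor_mono[of "real m * t" "real m"] assms
    by (simp add: nat_le_iff mult_left_le)
  have "(\<Sum>j=1..m. indicat_real {real j / real m..} t) = (\<Sum>j=1..m. if j \<le> z then 1 else 0)"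
    using False assms
    by (intro sum.cong) (auto simp: indicator_def z_def le_nat_iff le_floor_iff field_simps)
  also have "\<dots> = real (card {1..z})"
  proof -
    have "{1..m} \<inter> {j. j \<le> z} = {1..z}" using \<open>z \<le> m\<close> by auto
    then show ?thesis by (simp add: sum.If_cases)
  qed
  finally show ?thesis unfolding z_def by simp
qed auto

text \<open>Both integrals are replaced by averages of the measures of \<open>m\<close> superlevel sets, up to an
  error \<open>1 / m\<close>.\<close>

lemma integral_diff_le_tv_dist_unit:
  fixes k :: "'i \<Rightarrow> real"
  assumes \<mu>: "prob_space \<mu>" and \<kappa>: "prob_space \<kappa>" and sets: "sets \<kappa> = sets \<mu>"
    and k[measurable]: "k \<in> borel_measurable \<mu>"
    and bnd: "\<And>x. x \<in> space \<mu> \<Longrightarrow> 0 \<le> k x \<and> k x \<le> 1"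
  shows "(\<integral>x. k x \<partial>\<mu>) - (\<integral>x. k x \<partial>\<kappa>) \<le> tv_dist \<mu> \<kappa>"
proof -
  interpret \<mu>: prob_space \<mu> by fact
  interpret \<kappa>: prob_space \<kappa> by fact
  note [measurable_cong] = sets
  have sp: "space \<kappa> = space \<mu>" using sets by (rule sets_eq_imp_space_eq)
  have app: "(\<integral>x. k x \<partial>\<mu>) - (\<integral>x. k x \<partial>\<kappa>) \<le> tv_dist \<mu> \<kappa> + 1 / real (Suc n)" for n
  proof -
    define m where "m = Suc n"
    have m: "0 < real m" unfolding m_def by simp
    define A where "A j = {x \<in> space \<mu>. real j / real m \<le> k x}" for j
    have A[measurable]: "A j \<in> sets \<mu>" for j unfolding A_def by measurable
    define s where "s x = (\<Sum>j=1..m. indicat_real (A j) x) / real m" for x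
    have s: "s x \<le> k x \<and> k x \<le> s x + 1 / real m" if "x \<in> space \<mu>" for x
    proof -
      have "s x = real (nat \<lfloor>real m * k x\<rfloor>) / real m"
        using bnd[OF that] that unfolding s_def level_sum[OF conjunct1[OF bnd[OF that]] conjunct2[OF bnd[OF that]]]
        by (intro arg_cong2[where f="(/)"] sum.cong) (auto simp: A_def indicator_def)
      then have s: "s x = of_int \<lfloor>real m * k x\<rfloor> / real m" using bnd[OF that] by simp
      show ?thesis
        unfolding s using m of_int_floor_le[of "real m * k x"] floor_correct[of "real m * k x"]
        by (simp add: field_simps)
    qed
    have s_meas: "s \<in> borel_measurable \<mu>" unfolding s_def by measurable
    have int: "integrable \<mu> k" "integrable \<kappa> k"
      by (rule \<mu>.integrable_const_bound[of _ 1], use bnd in auto)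
        (rule \<kappa>.integrable_const_bound[of _ 1], use bnd sp in auto)
    have int_A: "integrable \<mu> (indicat_real (A j))" "integrable \<kappa> (indicat_real (A j))" for j
      by (auto simp: \<mu>.emeasure_eq_measure \<kappa>.emeasure_eq_measure)
    have int_s: "integrable \<mu> s" "integrable \<kappa> s" 
      unfolding s_def using int_A by auto
    have eq: "(\<integral>x. s x \<partial>\<mu>) = (\<Sum>j=1..m. measure \<mu> (A j)) / real m"
      "(\<integral>x. s x \<partial>\<kappa>) = (\<Sum>j=1..m. measure \<kappa> (A j)) / real m"
      unfolding s_def using int_A by auto
    have "(\<integral>x. k x \<partial>\<mu>) \<le> (\<integral>x. s x + 1 / real m \<partial>\<mu>)"
      using s int int_s by (intro integral_mono) auto
    also have "\<dots> = (\<integral>x. s x \<partial>\<mu>) + 1 / real m"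
      using int_s by (simp add: \<mu>.prob_space)
    moreover have "(\<integral>x. s x \<partial>\<kappa>) \<le> (\<integral>x. k x \<partial>\<kappa>)"
      using s int int_s sp by (intro integral_mono) auto
    moreover have "(\<integral>x. s x \<partial>\<mu>) - (\<integral>x. s x \<partial>\<kappa>) \<le> tv_dist \<mu> \<kappa>"
    proof -
      have "(\<integral>x. s x \<partial>\<mu>) - (\<integral>x. s x \<partial>\<kappa>) = (\<Sum>j=1..m. measure \<mu> (A j) - measure \<kappa> (A j)) / real m"
        unfolding eq by (simp add: sum_subtractf diff_divide_distrib)
      also have "\<dots> \<le> (\<Sum>j=1..m. tv_dist \<mu> \<kappa>) / real m"
        by (intro divide_right_mono sum_mono order.trans[OF abs_ge_self tv_dist_upper] \<mu> \<kappa> A) auto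
      also have "\<dots> = tv_dist \<mu> \<kappa>" using m by simp
      finally show ?thesis .
    qed
    ultimately show ?thesis unfolding m_def by linarith
  qed
  have "(\<lambda>n. tv_dist \<mu> \<kappa> + 1 / real (Suc n)) \<longlonglongrightarrow> tv_dist \<mu> \<kappa> + 0"
    by (intro tendsto_intros LIMSEQ_Suc lim_1_over_n)
  from LIMSEQ_le_const[OF this] app show ?thesis by auto
qed

lemma tv_dist_commute: "sets \<mu> = sets \<kappa> \<Longrightarrow> tv_dist \<mu> \<kappa> = tv_dist \<kappa> \<mu>"
  unfolding tv_dist_def by (simp add: abs_minus_commute)

text \<open>Both measures have mass one, so subtracting the infimum leaves the difference of the
  integrals unchanged, and dividing by \<open>R\<close> maps into the unit interval. This gives the
  oscillation instead of twice the sup norm; \<open>R = 0\<close> is separate because of the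
  division.\<close>

lemma integral_diff_le_tv_dist:
  fixes k :: "'i \<Rightarrow> real"
  assumes \<mu>: "prob_space \<mu>" and \<kappa>: "prob_space \<kappa>" and sets: "sets \<kappa> = sets \<mu>"
    and k[measurable]: "k \<in> borel_measurable \<mu>"
    and osc: "\<And>x y. x \<in> space \<mu> \<Longrightarrow> y \<in> space \<mu> \<Longrightarrow> \<bar>k x - k y\<bar> \<le> R"
  shows "\<bar>(\<integral>x. k x \<partial>\<mu>) - (\<integral>x. k x \<partial>\<kappa>)\<bar> \<le> R * tv_dist \<mu> \<kappa>"
proof -
  interpret \<mu>: prob_space \<mu> by fact
  interpret \<kappa>: prob_space \<kappa> by fact
  note [measurable_cong] = sets
  have sp: "space \<kappa> = space \<mu>" using sets by (rule sets_eq_imp_space_eq)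
  obtain x0 where x0: "x0 \<in> space \<mu>" using \<mu>.not_empty by auto
  have R: "0 \<le> R" using osc[OF x0 x0] by simp
  define a where "a = (INF x\<in>space \<mu>. k x)"
  have bb: "bdd_below (k ` space \<mu>)"
    by (rule bdd_belowI2[of _ "k x0 - R"]) (use osc[OF x0] in \<open>force simp: abs_le_iff\<close>)
  have a1: "a \<le> k x" if "x \<in> space \<mu>" for x
    unfolding a_def by (rule cINF_lower[OF bb that])
  have a2: "k x - R \<le> a" if "x \<in> space \<mu>" for x
    unfolding a_def by (rule cINF_greatest) (use x0 osc[OF that] in \<open>force simp: abs_le_iff\<close>)+
  have int: "integrable \<mu> k" "integrable \<kappa> k"
    by (rule \<mu>.integrable_const_bound[of _ "\<bar>a\<bar> + R"], use a1 a2 in \<open>force\<close>, simp)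
      (rule \<kappa>.integrable_const_bound[of _ "\<bar>a\<bar> + R"], use a1 a2 sp in \<open>force\<close>, simp)
  show ?thesis
  proof (cases "R = 0")
    case True
    then have "k x = a" if "x \<in> space \<mu>" for x using a1[OF that] a2[OF that] by simp
    then have "(\<integral>x. k x \<partial>\<mu>) = (\<integral>x. a \<partial>\<mu>)" "(\<integral>x. k x \<partial>\<kappa>) = (\<integral>x. a \<partial>\<kappa>)"
      using sp by (intro Bochner_Integration.integral_cong; simp)+
    then show ?thesis using True by (simp add: \<mu>.prob_space \<kappa>.prob_space)
  next
    case False
    then have R: "0 < R" using R by simp
    define l where "l x = (k x - a) / R" for x
    have l: "0 \<le> l x \<and> l x \<le> 1" if "x \<in> space \<mu>" for x
      using a1[OF that] a2[OF that] R by (auto simp: l_def field_simps)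
    have [measurable]: "l \<in> borel_measurable \<mu>" unfolding l_def by measurable
    have "\<bar>(\<integral>x. l x \<partial>\<mu>) - (\<integral>x. l x \<partial>\<kappa>)\<bar> \<le> tv_dist \<mu> \<kappa>"
      using integral_diff_le_tv_dist_unit[OF \<mu> \<kappa> sets, of l] integral_diff_le_tv_dist_unit[OF \<kappa> \<mu> sets[symmetric], of l]
        l sp tv_dist_commute[OF sets] by (auto simp: abs_le_iff)
    moreover have "(\<integral>x. l x \<partial>\<mu>) = ((\<integral>x. k x \<partial>\<mu>) - a) / R" "(\<integral>x. l x \<partial>\<kappa>) = ((\<integral>x. k x \<partial>\<kappa>) - a) / R"
      using int by (simp_all add: l_def \<mu>.prob_space \<kappa>.prob_space)
    ultimately have "\<bar>((\<integral>x. k x \<partial>\<mu>) - (\<integral>x. k x \<partial>\<kappa>)) / R\<bar> \<le> tv_dist \<mu> \<kappa>"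
      by (simp add: diff_divide_distrib)
    then show ?thesis using R by (simp add: field_simps)
  qed
qed

section \<open>The Poisson equation of a mixing family of kernels\<close>

text \<open>Pushing \<open>L x\<close> forward along \<open>y \<mapsto> (x, y)\<close> moves the
  dependence on \<open>x\<close> from the integrand into the measure, and integrating a fixed
  function is measurable on the subprobability algebra.\<close>

lemma integral_measurable_kernel:
  fixes f :: "'a \<Rightarrow> 'b \<Rightarrow> real"
  assumes f[measurable]: "case_prod f \<in> borel_measurable (M \<Otimes>\<^sub>M N)"
    and L[measurable]: "L \<in> M \<rightarrow>\<^sub>M subprob_algebra N"
  shows "(\<lambda>x. \<integral>y. f x y \<partial>L x) \<in> borel_measurable M"
proof -
  note measurable_distr2[measurable] integral_measurable_subprob_algebra[measurable]
  have "(\<lambda>x. integral\<^sup>L (distr (L x) (M \<Otimes>\<^sub>M N) (\<lambda>y. (x, y))) (case_prod f)) \<in> borel_measurable M"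
    by measurable
  moreover have "integral\<^sup>L (distr (L x) (M \<Otimes>\<^sub>M N) (\<lambda>y. (x, y))) (case_prod f) = (\<integral>y. f x y \<partial>L x)"
    if "x \<in> space M" for x
    using that sets_kernel[OF L that] by (subst integral_distr) (auto cong: measurable_cong_sets)
  ultimately show ?thesis by (simp cong: measurable_cong)
qed

text \<open>\<eta> bounds the Dobrushin coefficient of every kernel \<open>K x\<close>;
  \<open>p\<close> is the Lipschitz modulus of \<open>x \<mapsto> K x I\<close> in total variation,
  uniformly in the state.\<close>

locale mixing_kernels =
  fixes A :: "'x::metric_space measure" and N :: "'i measure" and K :: "'x \<Rightarrow> 'i \<Rightarrow> 'i measure"
    and \<eta> p :: real
  assumes kernel: "case_prod K \<in> A \<Otimes>\<^sub>M N \<rightarrow>\<^sub>M prob_algebra N"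
    and mixing: "\<And>x I J. x \<in> space A \<Longrightarrow> I \<in> space N \<Longrightarrow> J \<in> space N \<Longrightarrow> tv_dist (K x I) (K x J) \<le> \<eta>"
    and drift: "\<And>x y I. x \<in> space A \<Longrightarrow> y \<in> space A \<Longrightarrow> I \<in> space N \<Longrightarrow> tv_dist (K x I) (K y I) \<le> p * dist x y"
    and \<eta>: "0 \<le> \<eta>" "\<eta> < 1" and p: "0 \<le> p"
    and N_ne: "space N \<noteq> {}"
begin

definition step :: "('x \<Rightarrow> 'i \<Rightarrow> real) \<Rightarrow> 'x \<Rightarrow> 'i \<Rightarrow> real" where
  "step k x I = (\<integral>J. k x J \<partial>K x I)"

lemma K_sub: "(\<lambda>z. K (fst z) (snd z)) \<in> A \<Otimes>\<^sub>M N \<rightarrow>\<^sub>M subprob_algebra N"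
  using measurable_prob_algebraD[OF kernel] by (simp add: case_prod_beta')

lemma
  assumes "x \<in> space A" "I \<in> space N"
  shows prob_K: "prob_space (K x I)" and sets_K: "sets (K x I) = sets N"
    and space_K: "space (K x I) = space N"
proof -
  have "case_prod K (x, I) \<in> space (prob_algebra N)"
    by (rule measurable_space[OF kernel]) (use assms in \<open>simp add: space_pair_measure\<close>)
  then show "prob_space (K x I)" and *: "sets (K x I) = sets N"
    by (auto simp: space_prob_algebra)
  from sets_eq_imp_space_eq[OF *] show "space (K x I) = space N" .
qed

lemma section_measurable:
  assumes "case_prod k \<in> borel_measurable (A \<Otimes>\<^sub>M N)" "x \<in> space A"
  shows "k x \<in> borel_measurable N"
  using measurable_compose[OF measurable_Pair1'[OF assms(2)] assms(1)] by simp

lemma step_measurable: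
  assumes [measurable]: "case_prod k \<in> borel_measurable (A \<Otimes>\<^sub>M N)"
  shows "case_prod (step k) \<in> borel_measurable (A \<Otimes>\<^sub>M N)"
proof -
  have "(\<lambda>z. \<integral>J. k (fst z) J \<partial>K (fst z) (snd z)) \<in> borel_measurable (A \<Otimes>\<^sub>M N)"
    by (rule integral_measurable_kernel[OF _ K_sub]) measurable
  then show ?thesis by (simp add: step_def case_prod_beta')
qed

lemma integrable_K:
  assumes "x \<in> space A" "I \<in> space N" "k \<in> borel_measurable N" "\<And>J. J \<in> space N \<Longrightarrow> \<bar>k J\<bar> \<le> (B::real)"
  shows "integrable (K x I) k"
proof -
  interpret prob_space "K x I" using prob_K assms by auto
  show ?thesis
    by (rule integrable_const_bound[of _ B])
      (use assms space_K sets_K in \<open>auto cong: measurable_cong_sets\<close>)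
qed

text \<open>Dobrushin contraction: the two values integrate the same function, of oscillation
  \<open>R\<close>, against laws at total variation distance at most \<eta>.\<close>

lemma step_osc:
  assumes x: "x \<in> space A" and k: "k x \<in> borel_measurable N"
    and osc: "\<And>I J. I \<in> space N \<Longrightarrow> J \<in> space N \<Longrightarrow> \<bar>k x I - k x J\<bar> \<le> R"
    and I: "I \<in> space N" "J \<in> space N"
  shows "\<bar>step k x I - step k x J\<bar> \<le> \<eta> * R"
proof -
  have "0 \<le> R" using osc[OF I(1) I(1)] by simp
  have "\<bar>step k x I - step k x J\<bar> \<le> R * tv_dist (K x I) (K x J)"
    unfolding step_def
    by (rule integral_diff_le_tv_dist)
      (use x I k osc prob_K sets_K space_K in \<open>auto cong: measurable_cong_sets\<close>)
  also have "\<dots> \<le> R * \<eta>" using mixing[OF x I] \<open>0 \<le> R\<close> by (rule mult_left_mono)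
  finally show ?thesis by (simp add: mult.commute)
qed

lemma step_drift:
  assumes x: "x \<in> space A" "y \<in> space A" and k: "k \<in> borel_measurable N"
    and osc: "\<And>I J. I \<in> space N \<Longrightarrow> J \<in> space N \<Longrightarrow> \<bar>k I - k J\<bar> \<le> R"
    and I: "I \<in> space N"
  shows "\<bar>(\<integral>J. k J \<partial>K x I) - (\<integral>J. k J \<partial>K y I)\<bar> \<le> p * R * dist x y"
proof -
  have "0 \<le> R" using osc[OF I I] by simp
  have "\<bar>(\<integral>J. k J \<partial>K x I) - (\<integral>J. k J \<partial>K y I)\<bar> \<le> R * tv_dist (K x I) (K y I)"
    by (rule integral_diff_le_tv_dist)
      (use x I k osc prob_K sets_K space_K in \<open>auto cong: measurable_cong_sets\<close>)
  also have "\<dots> \<le> R * (p * dist x y)" using drift[OF x I] \<open>0 \<le> R\<close> by (rule mult_left_mono)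
  finally show ?thesis by (simp add: mult_ac)
qed

text \<open>Applying \<open>contr\<close> to the exact oscillation \<open>s\<close> gives
  \<open>s \<le> r + \<eta> * s\<close>, which is then solved for \<open>s\<close>. The a priori
  bound \<open>s0\<close> makes the supremum finite and leaves no trace in the result.\<close>

lemma osc_le_of_contraction:
  fixes d :: "'i \<Rightarrow> real"
  assumes bnd: "\<And>I J. I \<in> space N \<Longrightarrow> J \<in> space N \<Longrightarrow> \<bar>d I - d J\<bar> \<le> s0"
    and contr: "\<And>s I J. (\<And>I J. I \<in> space N \<Longrightarrow> J \<in> space N \<Longrightarrow> \<bar>d I - d J\<bar> \<le> s)
      \<Longrightarrow> I \<in> space N \<Longrightarrow> J \<in> space N \<Longrightarrow> \<bar>d I - d J\<bar> \<le> r + \<eta> * s"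
    and I: "I \<in> space N" "J \<in> space N"
  shows "\<bar>d I - d J\<bar> \<le> r / (1 - \<eta>)"
proof -
  define s where "s = (SUP (I, J)\<in>space N \<times> space N. \<bar>d I - d J\<bar>)"
  have bdd: "bdd_above ((\<lambda>(I, J). \<bar>d I - d J\<bar>) ` (space N \<times> space N))"
    by (rule bdd_aboveI2[of _ _ s0]) (use bnd in auto)
  have le: "\<bar>d I - d J\<bar> \<le> s" if "I \<in> space N" "J \<in> space N" for I J
    unfolding s_def using cSUP_upper[OF _ bdd, of "(I, J)"] that by auto
  have "s \<le> r + \<eta> * s"
    by (subst s_def, rule cSUP_least) (use N_ne contr[OF le] in auto)
  then have "s \<le> r / (1 - \<eta>)" using \<eta> by (simp add: field_simps)
  with le[OF I] show ?thesis by linarith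
qed

text \<open>\<open>u\<close> is the series of \<open>P\<^sup>n \<psi>\<close>, pinned to \<open>0\<close> at a reference state \<open>I0\<close> so that its sup norm is
  bounded by its oscillation. For \<open>x \<noteq> y\<close> the difference \<open>d = u\<^sub>x - u\<^sub>y\<close> solves
  \<open>d - P\<^sub>x d = (\<psi>\<^sub>x - \<psi>\<^sub>y) + (P\<^sub>x - P\<^sub>y) u\<^sub>y\<close> up to a constant, which bounds its oscillation.\<close>

lemma poisson_solution:
  assumes \<psi>: "case_prod \<psi> \<in> borel_measurable (A \<Otimes>\<^sub>M N)"
    and osc: "\<And>x I J. x \<in> space A \<Longrightarrow> I \<in> space N \<Longrightarrow> J \<in> space N \<Longrightarrow> \<bar>\<psi> x I - \<psi> x J\<bar> \<le> R"
    and lip: "\<And>x y I J. x \<in> space A \<Longrightarrow> y \<in> space A \<Longrightarrow> I \<in> space N \<Longrightarrow> J \<in> space N \<Longrightarrow>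
      \<bar>(\<psi> x I - \<psi> y I) - (\<psi> x J - \<psi> y J)\<bar> \<le> \<rho> * dist x y"
  obtains u m where "case_prod u \<in> borel_measurable (A \<Otimes>\<^sub>M N)"
    and "\<And>x I. x \<in> space A \<Longrightarrow> I \<in> space N \<Longrightarrow> u x I - step u x I = \<psi> x I - m x"
    and "\<And>x I. x \<in> space A \<Longrightarrow> I \<in> space N \<Longrightarrow> \<bar>u x I\<bar> \<le> R / (1 - \<eta>)"
    and "\<And>x I. x \<in> space A \<Longrightarrow> I \<in> space N \<Longrightarrow> \<bar>step u x I\<bar> \<le> R / (1 - \<eta>)"
    and "\<And>x y I. x \<in> space A \<Longrightarrow> y \<in> space A \<Longrightarrow> I \<in> space N \<Longrightarrow>
      \<bar>step u x I - step u y I\<bar> \<le> ((\<rho> + 2 * p * (R / (1 - \<eta>))) / (1 - \<eta>) + p * (R / (1 - \<eta>))) * dist x y"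
proof -
  obtain I0 where I0: "I0 \<in> space N" using N_ne by auto
  define T where "T n = (step ^^ n) \<psi>" for n
  have T0: "T 0 = \<psi>" and TS: "T (Suc n) = step (T n)" for n by (simp_all add: T_def)
  have T_meas[measurable]: "case_prod (T n) \<in> borel_measurable (A \<Otimes>\<^sub>M N)" for n
    by (induction n) (simp_all add: T0 TS \<psi> step_measurable)
  note T_sec = section_measurable[OF T_meas]
  have T_osc: "\<bar>T n x I - T n x J\<bar> \<le> \<eta> ^ n * R"
    if "x \<in> space A" "I \<in> space N" "J \<in> space N" for n x I J
    using that
  proof (induction n arbitrary: I J)
    case 0
    then show ?case using osc by (simp add: T0)
  next
    case (Suc n)
    from step_osc[where k="T n" and x=x and R="\<eta> ^ n * R" and I=I and J=J] Suc T_sec[of x n]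
    show ?case by (simp add: TS mult.assoc)
  qed
  \<comment> \<open>The iterates tend to a constant that is usually not 0, so their own series would
    diverge; differences from the reference state decay like \<open>\<eta> ^ n\<close>.\<close>
  define c where "c n x I = T n x I - T n x I0" for n x I
  define u where "u x I = (\<Sum>n. c n x I)" for x I
  have geo: "summable (\<lambda>n. \<eta> ^ n * R)" "(\<Sum>n. \<eta> ^ n * R) = R / (1 - \<eta>)"
    using \<eta> by (simp_all add: suminf_mult2[symmetric] suminf_geometric summable_mult2)
  have c_le: "\<bar>c n x I\<bar> \<le> \<eta> ^ n * R" if "x \<in> space A" "I \<in> space N" for n x I
    unfolding c_def by (rule T_osc[OF that I0])
  have c_sums: "summable (\<lambda>n. c n x I)" "summable (\<lambda>n. \<bar>c n x I\<bar>)" if "x \<in> space A" "I \<in> space N" for x I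
    by (rule summable_comparison_test[OF _ geo(1)], use c_le[OF that] in auto)+
  have u_bnd: "\<bar>u x I\<bar> \<le> R / (1 - \<eta>)" if "x \<in> space A" "I \<in> space N" for x I
  proof -
    have "\<bar>u x I\<bar> \<le> (\<Sum>n. \<bar>c n x I\<bar>)" unfolding u_def by (rule summable_rabs[OF c_sums(2)[OF that]])
    also have "\<dots> \<le> R / (1 - \<eta>)"
      unfolding geo(2)[symmetric] by (rule suminf_le[OF _ c_sums(2)[OF that] geo(1)]) (rule c_le[OF that])
    finally show ?thesis .
  qed
  have [measurable]: "(\<lambda>z. T n (fst z) I0) \<in> borel_measurable (A \<Otimes>\<^sub>M N)" for n
  proof -
    have "(\<lambda>z. (fst z, I0)) \<in> A \<Otimes>\<^sub>M N \<rightarrow>\<^sub>M A \<Otimes>\<^sub>M N" using I0 by measurable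
    from measurable_compose[OF this T_meas] show ?thesis by simp
  qed
  have u_meas: "case_prod u \<in> borel_measurable (A \<Otimes>\<^sub>M N)"
    unfolding u_def c_def case_prod_beta' by measurable
  note u_sec = section_measurable[OF u_meas]
  \<comment> \<open>The equation at \<open>I0\<close>, where \<open>u\<close> vanishes, forces this
    value. In the Metropolis setting it is identified with the Gibbs mean by integrating the
    equation.\<close>
  define m where "m x = \<psi> x I0 + step u x I0" for x
  have step_u: "step u x I = (\<Sum>n. T (Suc n) x I - T n x I0)" "summable (\<lambda>n. T (Suc n) x I - T n x I0)"
    if x: "x \<in> space A" and I: "I \<in> space N" for x I
  proof -
    interpret prob_space "K x I" using prob_K x I by auto
    have sec: "c n x \<in> borel_measurable N" for n unfolding c_def using T_sec[OF x] by measurable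
    have int: "integrable (K x I) (c n x)" for n
      by (rule integrable_K[OF x I sec c_le[OF x]])
    have int_T: "integrable (K x I) (T n x)" for n
      using Bochner_Integration.integrable_add[OF int[of n], of "\<lambda>_. T n x I0"] by (simp add: c_def)
    have norm_le: "(\<integral>J. norm (c n x J) \<partial>K x I) \<le> \<eta> ^ n * R" for n
    proof -
      have "(\<integral>J. norm (c n x J) \<partial>K x I) \<le> (\<integral>J. \<eta> ^ n * R \<partial>K x I)"
        using c_le[OF x] space_K[OF x I] by (intro integral_mono int integrable_norm) auto
      then show ?thesis by (simp add: prob_space)
    qed
    \<comment> \<open>Geometric decay of the integrated norms justifies exchanging the series with
      the kernel integral.\<close>
    have sumn: "summable (\<lambda>n. \<integral>J. norm (c n x J) \<partial>K x I)"
      by (rule summable_comparison_test[OF _ geo(1)]) (use norm_le in \<open>auto simp: integral_nonneg_AE\<close>)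
    have ae: "AE J in K x I. summable (\<lambda>n. norm (c n x J))"
      using c_sums(2)[OF x] space_K[OF x I] by auto
    have eq: "(\<integral>J. c n x J \<partial>K x I) = T (Suc n) x I - T n x I0" for n
      using int_T by (simp add: c_def TS step_def prob_space)
    show "step u x I = (\<Sum>n. T (Suc n) x I - T n x I0)"
      unfolding step_def u_def eq[symmetric] by (rule integral_suminf[OF int ae sumn])
    show "summable (\<lambda>n. T (Suc n) x I - T n x I0)"
      unfolding eq[symmetric] by (rule summable_integral[OF int ae sumn])
  qed
  have poisson: "u x I - step u x I = \<psi> x I - m x" if x: "x \<in> space A" and I: "I \<in> space N" for x I
  proof -
    \<comment> \<open>The next term is a difference of the terms of \<open>step u\<close> at
      \<open>I\<close> and at \<open>I0\<close>. Hence removing the head of the series for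
      \<open>u\<close> amounts to applying the kernel, up to a constant.\<close>
    have "c (Suc n) x I = (T (Suc n) x I - T n x I0) - (T (Suc n) x I0 - T n x I0)" for n
      by (simp add: c_def)
    then have "(\<Sum>n. c (Suc n) x I) = step u x I - step u x I0"
      using suminf_diff[OF step_u(2)[OF x I] step_u(2)[OF x I0]] step_u(1)[OF x I] step_u(1)[OF x I0] by simp
    moreover have "u x I = c 0 x I + (\<Sum>n. c (Suc n) x I)"
      unfolding u_def using suminf_split_head[OF c_sums(1)[OF x I]] by simp
    ultimately show ?thesis by (simp add: m_def c_def T0)
  qed
  \<comment> \<open>The sup bound alone would give twice this; the contraction argument on the
    Poisson equation saves the factor 2.\<close>
  have u_osc: "\<bar>u x I - u x J\<bar> \<le> R / (1 - \<eta>)" if x: "x \<in> space A" and IJ: "I \<in> space N" "J \<in> space N" for x I J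
  proof (rule osc_le_of_contraction[OF _ _ IJ])
    fix I J assume "I \<in> space N" "J \<in> space N"
    then show "\<bar>u x I - u x J\<bar> \<le> 2 * (R / (1 - \<eta>))" using u_bnd[OF x, of I] u_bnd[OF x, of J] by linarith
  next
    fix s I J assume s: "\<And>I J. I \<in> space N \<Longrightarrow> J \<in> space N \<Longrightarrow> \<bar>u x I - u x J\<bar> \<le> s" and IJ: "I \<in> space N" "J \<in> space N"
    have "\<bar>step u x I - step u x J\<bar> \<le> \<eta> * s" by (rule step_osc[where k=u, OF x u_sec[OF x] s IJ])
    with osc[OF x IJ] poisson[OF x IJ(1)] poisson[OF x IJ(2)]
    show "\<bar>u x I - u x J\<bar> \<le> R + \<eta> * s" by linarith
  qed
  \<comment> \<open>Splits \<open>P\<^sub>x u\<^sub>x - P\<^sub>y u\<^sub>y\<close> into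
    \<open>P\<^sub>x (u\<^sub>x - u\<^sub>y)\<close> and
    \<open>(P\<^sub>x - P\<^sub>y) u\<^sub>y\<close>.\<close>
  have step_diff: "step u x I - step u y I =
      (\<integral>J. u x J - u y J \<partial>K x I) + ((\<integral>J. u y J \<partial>K x I) - (\<integral>J. u y J \<partial>K y I))"
    if x: "x \<in> space A" "y \<in> space A" and I: "I \<in> space N" for x y I
    using integrable_K[OF x(1) I u_sec[OF x(1)] u_bnd[OF x(1)]] integrable_K[OF x(1) I u_sec[OF x(2)] u_bnd[OF x(2)]]
    by (simp add: step_def)
  define R' where "R' = R / (1 - \<eta>)"
  define Kl where "Kl = (\<rho> + 2 * p * R') / (1 - \<eta>)"
  have d_osc: "\<bar>(u x I - u y I) - (u x J - u y J)\<bar> \<le> (\<rho> * dist x y + 2 * p * R' * dist x y) / (1 - \<eta>)"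
    if x: "x \<in> space A" "y \<in> space A" and IJ: "I \<in> space N" "J \<in> space N" for x y I J
  proof (rule osc_le_of_contraction[OF _ _ IJ])
    fix I J assume "I \<in> space N" "J \<in> space N"
    then show "\<bar>(u x I - u y I) - (u x J - u y J)\<bar> \<le> 2 * R'"
      using u_osc[OF x(1), of I J] u_osc[OF x(2), of I J] unfolding R'_def by linarith
  next
    fix s I J assume s: "\<And>I J. I \<in> space N \<Longrightarrow> J \<in> space N \<Longrightarrow> \<bar>(u x I - u y I) - (u x J - u y J)\<bar> \<le> s"
      and IJ: "I \<in> space N" "J \<in> space N"
    \<comment> \<open>The function ignores its parameter \<open>x'\<close>, which freezes the
      difference \<open>u\<^sub>x - u\<^sub>y\<close> while the kernel of \<open>x\<close> acts. The
      change of kernel then enters once at \<open>I\<close> and once at \<open>J\<close>, hence the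
      2 in \<open>2 * p * R'\<close>.\<close>
    have "\<bar>step (\<lambda>x' J. u x J - u y J) x I - step (\<lambda>x' J. u x J - u y J) x J\<bar> \<le> \<eta> * s"
      by (rule step_osc[where k="\<lambda>x' J. u x J - u y J", OF x(1) _ s IJ])
        (use u_sec[OF x(1)] u_sec[OF x(2)] in measurable)
    moreover have "\<bar>(\<integral>J. u y J \<partial>K x I) - (\<integral>J. u y J \<partial>K y I)\<bar> \<le> p * R' * dist x y" if "I \<in> space N" for I
      unfolding R'_def by (rule step_drift[OF x u_sec[OF x(2)] u_osc[OF x(2)] that])
    from this[OF IJ(1)] this[OF IJ(2)]
    have "\<bar>(\<integral>J. u y J \<partial>K x I) - (\<integral>J. u y J \<partial>K y I)\<bar> \<le> p * R' * dist x y"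
      "\<bar>(\<integral>Ja. u y Ja \<partial>K x J) - (\<integral>J'. u y J' \<partial>K y J)\<bar> \<le> p * R' * dist x y" .
    ultimately show "\<bar>(u x I - u y I) - (u x J - u y J)\<bar> \<le> (\<rho> * dist x y + 2 * p * R' * dist x y) + \<eta> * s"
      using lip[OF x IJ] poisson[OF x(1) IJ(1)] poisson[OF x(1) IJ(2)] poisson[OF x(2) IJ(1)] poisson[OF x(2) IJ(2)]
        step_diff[OF x IJ(1)] step_diff[OF x IJ(2)] unfolding step_def by linarith
  qed
  \<comment> \<open>Both solutions vanish at \<open>I0\<close>, so the oscillation of their
    difference bounds its sup norm.\<close>
  have u0: "u x I0 = 0" for x by (simp add: u_def c_def)
  have u_lip: "\<bar>u x J - u y J\<bar> \<le> Kl * dist x y" if "x \<in> space A" "y \<in> space A" "J \<in> space N" for x y J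
    using d_osc[OF that I0] by (simp add: u0 Kl_def algebra_simps)
  show thesis
  proof (rule that[OF u_meas poisson u_bnd])
    fix x I assume x: "x \<in> space A" and I: "I \<in> space N"
    interpret prob_space "K x I" using prob_K x I by auto
    have "\<bar>step u x I\<bar> \<le> (\<integral>J. \<bar>u x J\<bar> \<partial>K x I)" unfolding step_def by (rule integral_abs_bound)
    also have "\<dots> \<le> (\<integral>J. R / (1 - \<eta>) \<partial>K x I)"
      using integrable_K[OF x I u_sec[OF x] u_bnd[OF x]] u_bnd[OF x] space_K[OF x I]
      by (intro integral_mono) auto
    finally show "\<bar>step u x I\<bar> \<le> R / (1 - \<eta>)" by (simp add: prob_space)
  next
    fix x y I assume x: "x \<in> space A" "y \<in> space A" and I: "I \<in> space N"
    interpret prob_space "K x I" using prob_K x I by auto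
    have "\<bar>\<integral>J. u x J - u y J \<partial>K x I\<bar> \<le> (\<integral>J. \<bar>u x J - u y J\<bar> \<partial>K x I)" by (rule integral_abs_bound)
    also have "\<dots> \<le> (\<integral>J. Kl * dist x y \<partial>K x I)"
      using integrable_K[OF x(1) I u_sec[OF x(1)] u_bnd[OF x(1)]] integrable_K[OF x(1) I u_sec[OF x(2)] u_bnd[OF x(2)]]
        u_lip[OF x] space_K[OF x(1) I]
      by (intro integral_mono) auto
    also have "\<dots> = Kl * dist x y" by (simp add: prob_space)
    finally have "\<bar>step u x I - step u y I\<bar> \<le> Kl * dist x y + p * R' * dist x y"
      using step_drift[OF x u_sec[OF x(2)] u_osc[OF x(2)] I] unfolding step_diff[OF x I] R'_def by linarith
    then show "\<bar>step u x I - step u y I\<bar> \<le> ((\<rho> + 2 * p * (R / (1 - \<eta>))) / (1 - \<eta>) + p * (R / (1 - \<eta>))) * dist x y"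
      by (simp add: Kl_def R'_def algebra_simps)
  qed
qed

end

section \<open>The Metropolis--Hastings kernel\<close>

text \<open>\<open>min 1 (exp s)\<close> is \<open>exp (min s 0)\<close>, and \<open>exp\<close> has
  slope at most 1 on the nonpositive axis.\<close>

lemma min_exp_lipschitz: "\<bar>min 1 (exp s) - min 1 (exp t)\<bar> \<le> \<bar>s - t :: real\<bar>"
proof -
  have *: "min 1 (exp t) - min 1 (exp s) \<le> t - s \<and> min 1 (exp s) \<le> min 1 (exp t)" if "s \<le> t" for s t :: real
  proof (cases "0 \<le> s")
    case True
    then show ?thesis using that by simp
  next
    case False
    define r where "r = min t 0"
    have r: "s \<le> r" "r \<le> 0" "r \<le> t" "min 1 (exp t) = exp r" "min 1 (exp s) = exp s"
      using False that by (auto simp: r_def min_def)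
    have "exp r - exp s = exp r * (1 - exp (s - r))"
      by (simp add: right_diff_distrib flip: exp_add)
    also have "\<dots> \<le> 1 * (1 - exp (s - r))" using r by (intro mult_right_mono) auto
    also have "\<dots> \<le> r - s" 
      using exp_ge_add_one_self[of "s - r"] by (simp add: algebra_simps)
    finally show ?thesis using r by auto
  qed
  show ?thesis using *[of s t] *[of t s] by (cases "s \<le> t") auto
qed

locale metropolis = prob_space \<nu> for \<nu> :: "'i measure" +
  fixes A :: "'x::metric_space measure" and q :: "'x \<Rightarrow> 'i \<Rightarrow> real" and w L :: real
  assumes q_meas[measurable]: "case_prod q \<in> borel_measurable (A \<Otimes>\<^sub>M \<nu>)"
    and q_bdd: "\<And>x. x \<in> space A \<Longrightarrow> \<exists>B. \<forall>I\<in>space \<nu>. \<bar>q x I\<bar> \<le> B"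
    and q_lip: "\<And>x y I. x \<in> space A \<Longrightarrow> y \<in> space A \<Longrightarrow> I \<in> space \<nu> \<Longrightarrow> \<bar>q x I - q y I\<bar> \<le> L * dist x y"
    and w: "0 < w" and L: "0 \<le> L"
begin

abbreviation "P \<equiv> mh_kernel \<nu> w q"
abbreviation "acc \<equiv> mh_accept w q"

lemma acc_bounds: "0 \<le> acc x I J" "acc x I J \<le> 1"
  by (simp_all add: mh_accept_def)

lemma abs_acc: "\<bar>acc x I J\<bar> \<le> 1"
  using acc_bounds[of x I J] by linarith

lemma acc_measurable[measurable (raw)]:
  assumes "X \<in> M \<rightarrow>\<^sub>M A" "f \<in> M \<rightarrow>\<^sub>M \<nu>" "g \<in> M \<rightarrow>\<^sub>M \<nu>"
  shows "(\<lambda>z. acc (X z) (f z) (g z)) \<in> borel_measurable M"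
proof -
  have "(\<lambda>z. q (X z) (f z)) \<in> borel_measurable M" "(\<lambda>z. q (X z) (g z)) \<in> borel_measurable M"
    using measurable_compose[OF measurable_Pair[OF assms(1,2)] q_meas]
      measurable_compose[OF measurable_Pair[OF assms(1,3)] q_meas] by auto
  then show ?thesis unfolding mh_accept_def by measurable
qed

text \<open>Two scores enter the exponent, each \<open>L\<close>-Lipschitz in the decision; hence
  the factor 2.\<close>

lemma acc_lip:
  assumes "x \<in> space A" "y \<in> space A" "I \<in> space \<nu>" "J \<in> space \<nu>"
  shows "\<bar>acc x I J - acc y I J\<bar> \<le> 2 * L / w * dist x y"
proof -
  have "\<bar>acc x I J - acc y I J\<bar> \<le> \<bar>(q x J - q x I) / w - (q y J - q y I) / w\<bar>"
    unfolding mh_accept_def by (rule min_exp_lipschitz)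
  also have "\<dots> = \<bar>(q x J - q y J) - (q x I - q y I)\<bar> / w"
    using w by (simp add: field_simps flip: diff_divide_distrib)
  also have "\<dots> \<le> (2 * L * dist x y) / w"
    using q_lip[OF assms(1,2,3)] q_lip[OF assms(1,2,4)] w by (intro divide_right_mono) linarith+
  finally show ?thesis by simp
qed

text \<open>The law of the next state once the proposal \<open>J\<close> is known. It separates the
  acceptance coin from the proposal, so that \<open>P x I\<close> is the bind of \<nu> with
  it.\<close>

definition inner_kernel :: "'x \<Rightarrow> 'i \<Rightarrow> 'i \<Rightarrow> 'i measure" where
  "inner_kernel x I J = measure_pmf (bernoulli_pmf (acc x I J))
      \<bind> (\<lambda>accepted. return \<nu> (if accepted then J else I))"

lemma return_kernel:
  assumes "I \<in> space \<nu>" "J \<in> space \<nu>"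
  shows "(\<lambda>c. return \<nu> (if c then J else I)) \<in> measure_pmf p \<rightarrow>\<^sub>M prob_algebra \<nu>"
  using assms by (auto simp: space_prob_algebra intro!: prob_space_return)

lemma
  assumes "I \<in> space \<nu>" "J \<in> space \<nu>"
  shows prob_inner_kernel: "prob_space (inner_kernel x I J)"
    and sets_inner_kernel: "sets (inner_kernel x I J) = sets \<nu>"
proof -
  have p: "measure_pmf (bernoulli_pmf (acc x I J)) \<in> space (prob_algebra (count_space UNIV))"
    by (simp add: space_prob_algebra measure_pmf.prob_space_axioms)
  have k: "(\<lambda>c. return \<nu> (if c then J else I)) \<in> count_space UNIV \<rightarrow>\<^sub>M prob_algebra \<nu>"
    using assms by (auto simp: space_prob_algebra intro!: prob_space_return)
  show "prob_space (inner_kernel x I J)" "sets (inner_kernel x I J) = sets \<nu>"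
    unfolding inner_kernel_def by (rule prob_space_bind'[OF p k], rule sets_bind'[OF p k])
qed

lemma emeasure_inner_kernel:
  assumes "I \<in> space \<nu>" "J \<in> space \<nu>" "B \<in> sets \<nu>"
  shows "emeasure (inner_kernel x I J) B
    = ennreal (acc x I J * indicator B J + (1 - acc x I J) * indicator B I)"
  unfolding inner_kernel_def
  using acc_bounds[of x I J] assms
  by (subst emeasure_bind[OF _ measurable_prob_algebraD[OF return_kernel[OF assms(1,2)]] assms(3)])
    (auto simp: mult.commute ennreal_mult'[symmetric] split: split_indicator simp flip: ennreal_plus)

lemma integral_inner_kernel:
  assumes I: "I \<in> space \<nu>" "J \<in> space \<nu>" and k[measurable]: "k \<in> borel_measurable \<nu>"
    and bnd: "\<And>J. J \<in> space \<nu> \<Longrightarrow> \<bar>k J\<bar> \<le> (B :: real)"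
  shows "(\<integral>y. k y \<partial>inner_kernel x I J) = acc x I J * k J + (1 - acc x I J) * k I"
proof -
  have "(\<integral>y. k y \<partial>inner_kernel x I J)
      = (\<integral>c. (\<integral>y. k y \<partial>return \<nu> (if c then J else I)) \<partial>measure_pmf (bernoulli_pmf (acc x I J)))"
    unfolding inner_kernel_def
    by (rule integral_bind[where K=\<nu> and B=B and B'=1])
      (use I bnd measurable_prob_algebraD[OF return_kernel[OF I]] prob_space_return[of _ \<nu>]
        in \<open>auto simp: prob_space.emeasure_space_1 measure_pmf.finite_measure_axioms\<close>)
  also have "\<dots> = acc x I J * k J + (1 - acc x I J) * k I"
    using acc_bounds[of x I J] I by (simp add: integral_return mult.commute)
  finally show ?thesis .
qed

lemma inner_kernel_measurable:
  "(\<lambda>z. inner_kernel (fst (fst z)) (snd (fst z)) (snd z)) \<in> (A \<Otimes>\<^sub>M \<nu>) \<Otimes>\<^sub>M \<nu> \<rightarrow>\<^sub>M subprob_algebra \<nu>"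
proof (rule measurable_subprob_algebra)
  fix B assume [measurable]: "B \<in> sets \<nu>"
  have "(\<lambda>z. ennreal (acc (fst (fst z)) (snd (fst z)) (snd z) * indicator B (snd z)
      + (1 - acc (fst (fst z)) (snd (fst z)) (snd z)) * indicator B (snd (fst z))))
    \<in> borel_measurable ((A \<Otimes>\<^sub>M \<nu>) \<Otimes>\<^sub>M \<nu>)"
    by measurable
  then show "(\<lambda>z. emeasure (inner_kernel (fst (fst z)) (snd (fst z)) (snd z)) B)
      \<in> borel_measurable ((A \<Otimes>\<^sub>M \<nu>) \<Otimes>\<^sub>M \<nu>)"
    by (rule measurable_cong[THEN iffD1, rotated])
      (auto simp: space_pair_measure emeasure_inner_kernel)
qed (auto simp: space_pair_measure sets_inner_kernel intro!: prob_space_imp_subprob_space prob_inner_kernel)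

lemma P_eq: "P x I = \<nu> \<bind> inner_kernel x I"
  unfolding mh_kernel_def inner_kernel_def ..

lemma inner_kernel_section:
  assumes "x \<in> space A" "I \<in> space \<nu>"
  shows "inner_kernel x I \<in> \<nu> \<rightarrow>\<^sub>M prob_algebra \<nu>"
proof (rule measurable_prob_algebraI)
  have "(\<lambda>J. ((x, I), J)) \<in> \<nu> \<rightarrow>\<^sub>M (A \<Otimes>\<^sub>M \<nu>) \<Otimes>\<^sub>M \<nu>"
    using assms by (intro measurable_Pair measurable_const) (auto simp: space_pair_measure)
  from measurable_compose[OF this inner_kernel_measurable]
  show "inner_kernel x I \<in> \<nu> \<rightarrow>\<^sub>M subprob_algebra \<nu>" by simp
qed (use assms prob_inner_kernel in auto)

lemma nu_in_prob_algebra: "\<nu> \<in> space (prob_algebra \<nu>)"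
  by (simp add: space_prob_algebra prob_space_axioms)

lemma
  assumes "x \<in> space A" "I \<in> space \<nu>"
  shows prob_P: "prob_space (P x I)" and sets_P: "sets (P x I) = sets \<nu>"
  unfolding P_eq
  by (rule prob_space_bind'[OF nu_in_prob_algebra inner_kernel_section[OF assms]],
      rule sets_bind'[OF nu_in_prob_algebra inner_kernel_section[OF assms]])

lemma kernel_P: "case_prod P \<in> A \<Otimes>\<^sub>M \<nu> \<rightarrow>\<^sub>M prob_algebra \<nu>"
proof (rule measurable_prob_algebraI)
  have "(\<lambda>z. \<nu> \<bind> (\<lambda>J. inner_kernel (fst z) (snd z) J)) \<in> A \<Otimes>\<^sub>M \<nu> \<rightarrow>\<^sub>M subprob_algebra \<nu>"
  proof (rule measurable_bind[where N=\<nu>])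
    show "(\<lambda>z. \<nu>) \<in> A \<Otimes>\<^sub>M \<nu> \<rightarrow>\<^sub>M subprob_algebra \<nu>"
      using prob_space_imp_subprob_space[OF prob_space_axioms] by (simp add: space_subprob_algebra)
  qed (use inner_kernel_measurable in \<open>simp add: case_prod_beta'\<close>)
  then show "case_prod P \<in> A \<Otimes>\<^sub>M \<nu> \<rightarrow>\<^sub>M subprob_algebra \<nu>"
    by (simp add: P_eq case_prod_beta')
qed (auto simp: space_pair_measure prob_P)

lemma acc_section:
  assumes "x \<in> space A" "I \<in> space \<nu>"
  shows "(\<lambda>J. acc x I J) \<in> borel_measurable \<nu>"
  using assms by measurable

lemma integrable_bounded:
  assumes "k \<in> borel_measurable \<nu>" "\<And>J. J \<in> space \<nu> \<Longrightarrow> \<bar>k J\<bar> \<le> (B :: real)"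
  shows "integrable \<nu> k"
  by (rule integrable_const_bound[of _ B]) (use assms in auto)

text \<open>Regrouping around \<open>k I\<close> hides the rejection probability and leaves only
  increments \<open>k J - k I\<close>. This is the form in which the Lipschitz bound on the kernel
  and detailed balance become visible.\<close>

lemma integral_P:
  assumes x: "x \<in> space A" and I: "I \<in> space \<nu>" and k[measurable]: "k \<in> borel_measurable \<nu>"
    and bnd: "\<And>J. J \<in> space \<nu> \<Longrightarrow> \<bar>k J\<bar> \<le> (B :: real)"
  shows "(\<integral>y. k y \<partial>P x I) = k I + (\<integral>J. acc x I J * (k J - k I) \<partial>\<nu>)"
proof -
  note acc_section[OF x I, measurable]
  have "(\<integral>y. k y \<partial>P x I) = (\<integral>J. (\<integral>y. k y \<partial>inner_kernel x I J) \<partial>\<nu>)"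
    unfolding P_eq
  proof (rule integral_bind[where K=\<nu> and B=B and B'=1])
    show "AE J in \<nu>. emeasure (inner_kernel x I J) (space (inner_kernel x I J)) \<le> ennreal 1"
      using prob_space.emeasure_space_1[OF prob_inner_kernel[OF I]] by (intro AE_I2) simp
  qed (use bnd measurable_prob_algebraD[OF inner_kernel_section[OF x I]] finite_measure_axioms in auto)
  also have "\<dots> = (\<integral>J. k I + acc x I J * (k J - k I) \<partial>\<nu>)"
    by (intro Bochner_Integration.integral_cong refl)
      (simp add: integral_inner_kernel[OF I _ k bnd] algebra_simps)
  also have "\<dots> = k I + (\<integral>J. acc x I J * (k J - k I) \<partial>\<nu>)"
  proof -
    have "integrable \<nu> (\<lambda>J. acc x I J * (k J - k I))"
    proof (rule integrable_bounded)
      show "\<bar>acc x I J * (k J - k I)\<bar> \<le> 1 * (2 * B)" if "J \<in> space \<nu>" for J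
        unfolding abs_mult using bnd[OF that] bnd[OF I] abs_acc
        by (intro mult_mono) auto
    qed measurable
    then show ?thesis by (simp add: prob_space)
  qed
  finally show ?thesis .
qed

text \<open>For the indicator of an event the increment has absolute value at most 1, so the
  difference of the two laws is at most the mean change of the acceptance probability. Accepted and
  rejected mass are not counted twice.\<close>

lemma tv_dist_P_lip:
  assumes x: "x \<in> space A" "y \<in> space A" and I: "I \<in> space \<nu>"
  shows "tv_dist (P x I) (P y I) \<le> 2 * L / w * dist x y"
proof (rule tv_dist_le)
  fix B assume "B \<in> sets (P x I)"
  then have B[measurable]: "B \<in> sets \<nu>" using sets_P x I by auto
  note [measurable] = acc_section[OF x(1) I] acc_section[OF x(2) I]
  interpret Px: prob_space "P x I" using prob_P x I by auto
  interpret Py: prob_space "P y I" using prob_P x I by auto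
  let ?k = "indicat_real B"
  have meas: "measure (P z I) B = ?k I + (\<integral>J. acc z I J * (?k J - ?k I) \<partial>\<nu>)" if "z \<in> space A" for z
  proof -
    have "measure (P z I) B = (\<integral>y. ?k y \<partial>P z I)"
      using B sets_P[OF that I] by (simp add: Int_absorb1 sets.sets_into_space)
    also have "\<dots> = ?k I + (\<integral>J. acc z I J * (?k J - ?k I) \<partial>\<nu>)"
      by (rule integral_P[OF that I, of _ 1]) (auto simp: indicator_def)
    finally show ?thesis .
  qed
  have int: "integrable \<nu> (\<lambda>J. acc z I J * (?k J - ?k I))" if "z \<in> space A" for z
  proof (rule integrable_bounded)
    show "\<bar>acc z I J * (?k J - ?k I)\<bar> \<le> 1" for J
      using abs_acc[of z I J] by (auto simp: indicator_def)
  qed (use acc_section[OF that I] in measurable)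
  have "measure (P x I) B - measure (P y I) B = (\<integral>J. (acc x I J - acc y I J) * (?k J - ?k I) \<partial>\<nu>)"
    unfolding meas[OF x(1)] meas[OF x(2)]
    using int[OF x(1)] int[OF x(2)] by (simp add: left_diff_distrib)
  also have "\<bar>\<dots>\<bar> \<le> (\<integral>J. \<bar>(acc x I J - acc y I J) * (?k J - ?k I)\<bar> \<partial>\<nu>)"
    by (rule integral_abs_bound)
  also have "\<dots> \<le> (\<integral>J. 2 * L / w * dist x y \<partial>\<nu>)"
  proof (rule integral_mono)
    show "\<bar>(acc x I J - acc y I J) * (?k J - ?k I)\<bar> \<le> 2 * L / w * dist x y" if "J \<in> space \<nu>" for J
    proof -
      have "\<bar>(acc x I J - acc y I J) * (?k J - ?k I)\<bar> \<le> \<bar>acc x I J - acc y I J\<bar>"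
        by (auto simp: indicator_def)
      with acc_lip[OF x I that] show ?thesis by linarith
    qed
    show "integrable \<nu> (\<lambda>J. \<bar>(acc x I J - acc y I J) * (?k J - ?k I)\<bar>)"
      using int[OF x(1)] int[OF x(2)] by (intro integrable_abs) (simp add: left_diff_distrib)
  qed simp
  finally show "\<bar>measure (P x I) B - measure (P y I) B\<bar> \<le> 2 * L / w * dist x y"
    by (simp add: prob_space)
qed

lemma q_section:
  assumes "x \<in> space A"
  shows "q x \<in> borel_measurable \<nu>"
  using measurable_compose[OF measurable_Pair1'[OF assms] q_meas] by simp

lemma integrable_gibbs:
  assumes x: "x \<in> space A" and k: "k \<in> borel_measurable \<nu>"
    and bnd: "\<And>J. J \<in> space \<nu> \<Longrightarrow> \<bar>k J\<bar> \<le> (B :: real)"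
  shows "integrable \<nu> (\<lambda>I. exp (q x I / w) * k I)"
proof -
  note [measurable] = k q_section[OF x]
  obtain Bq where Bq: "\<And>I. I \<in> space \<nu> \<Longrightarrow> \<bar>q x I\<bar> \<le> Bq" using q_bdd[OF x] by auto
  show ?thesis
  proof (rule integrable_bounded)
    show "\<bar>exp (q x I / w) * k I\<bar> \<le> exp (Bq / w) * B" if "I \<in> space \<nu>" for I
      unfolding abs_mult using bnd[OF that] Bq[OF that] w
      by (intro mult_mono) (auto intro!: divide_right_mono)
  qed measurable
qed

lemma partition_pos:
  assumes x: "x \<in> space A"
  shows "0 < (\<integral>I. exp (q x I / w) \<partial>\<nu>)"
proof -
  have int: "integrable \<nu> (\<lambda>I. exp (q x I / w))" using integrable_gibbs[OF x, of "\<lambda>_. 1" 1] by simp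
  obtain Bq where Bq: "\<And>I. I \<in> space \<nu> \<Longrightarrow> \<bar>q x I\<bar> \<le> Bq" using q_bdd[OF x] by auto
  have "exp (- Bq / w) \<le> exp (q x I / w)" if "I \<in> space \<nu>" for I
    using Bq[OF that] w divide_right_mono[of "- Bq" "q x I" w] by simp
  then have "(\<integral>I. exp (- Bq / w) \<partial>\<nu>) \<le> (\<integral>I. exp (q x I / w) \<partial>\<nu>)"
    using int by (intro integral_mono) auto
  then have "exp (- Bq / w) \<le> (\<integral>I. exp (q x I / w) \<partial>\<nu>)" by (simp add: prob_space)
  then show ?thesis using exp_gt_zero[of "- Bq / w"] by linarith
qed

text \<open>Detailed balance: \<open>exp (q x I / w) * acc x I J\<close> is symmetric in \<open>I\<close> and \<open>J\<close>.\<close>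

lemma gibbs_invariant:
  assumes x: "x \<in> space A" and k[measurable]: "k \<in> borel_measurable \<nu>"
    and bnd: "\<And>J. J \<in> space \<nu> \<Longrightarrow> \<bar>k J\<bar> \<le> (B :: real)"
  shows "(\<integral>I. exp (q x I / w) * (\<integral>J. k J \<partial>P x I) \<partial>\<nu>) = (\<integral>I. exp (q x I / w) * k I \<partial>\<nu>)"
proof -
  note [measurable] = q_section[OF x]
  obtain Bq where Bq: "\<And>I. I \<in> space \<nu> \<Longrightarrow> \<bar>q x I\<bar> \<le> Bq" using q_bdd[OF x] by auto
  define s where "s I J = exp (q x I / w) * acc x I J" for I J
  define H where "H I J = s I J * (k J - k I)" for I J
  have s_eq: "s I J = min (exp (q x I / w)) (exp (q x J / w))" for I J
    by (simp add: s_def mh_accept_def min_def diff_divide_distrib exp_diff)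
  have H_anti: "H J I = - H I J" for I J
    by (simp add: H_def s_eq min.commute algebra_simps)
  have H_bnd: "\<bar>H I J\<bar> \<le> exp (Bq / w) * (2 * B)" if "I \<in> space \<nu>" "J \<in> space \<nu>" for I J
  proof -
    have "\<bar>s I J\<bar> \<le> exp (Bq / w)"
      unfolding s_eq using Bq[OF that(1)] divide_right_mono[of "q x I" Bq w] w
      by (simp add: abs_of_pos min.coboundedI1)
    then show ?thesis
      unfolding H_def abs_mult using bnd[OF that(1)] bnd[OF that(2)] by (intro mult_mono) auto
  qed
  interpret pair: pair_prob_space \<nu> \<nu> ..
  have "integrable (\<nu> \<Otimes>\<^sub>M \<nu>) (case_prod H)"
  proof (rule pair.integrable_const_bound)
    show "AE z in \<nu> \<Otimes>\<^sub>M \<nu>. norm (case_prod H z) \<le> exp (Bq / w) * (2 * B)"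
      using H_bnd by (auto simp: space_pair_measure)
    show "case_prod H \<in> borel_measurable (\<nu> \<Otimes>\<^sub>M \<nu>)"
      unfolding H_def s_eq case_prod_beta' by measurable
  qed
  then have "(\<integral>J. \<integral>I. H I J \<partial>\<nu> \<partial>\<nu>) = (\<integral>I. \<integral>J. H I J \<partial>\<nu> \<partial>\<nu>)"
    and int_H: "integrable \<nu> (\<lambda>I. \<integral>J. H I J \<partial>\<nu>)"
    by (auto intro: pair.Fubini_integral pair.integrable_fst)
  \<comment> \<open>\<open>H\<close> is antisymmetric because \<open>s\<close> is symmetric; with
    Fubini, the double integral equals its own negative.\<close>
  moreover have "(\<integral>J. \<integral>I. H I J \<partial>\<nu> \<partial>\<nu>) = - (\<integral>I. \<integral>J. H I J \<partial>\<nu> \<partial>\<nu>)"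
    by (subst H_anti) simp
  ultimately have H0: "(\<integral>I. \<integral>J. H I J \<partial>\<nu> \<partial>\<nu>) = 0" by simp
  have "(\<integral>I. exp (q x I / w) * (\<integral>J. k J \<partial>P x I) \<partial>\<nu>)
      = (\<integral>I. exp (q x I / w) * k I + (\<integral>J. H I J \<partial>\<nu>) \<partial>\<nu>)"
  proof (intro Bochner_Integration.integral_cong refl)
    fix I assume I: "I \<in> space \<nu>"
    show "exp (q x I / w) * (\<integral>J. k J \<partial>P x I) = exp (q x I / w) * k I + (\<integral>J. H I J \<partial>\<nu>)"
    proof -
      have eq: "integral\<^sup>L (P x I) k = k I + (\<integral>J. acc x I J * (k J - k I) \<partial>\<nu>)"
        by (rule integral_P[OF x I k bnd])
      show ?thesis by (simp add: eq H_def s_def distrib_left mult.assoc)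
    qed
  qed
  also have "\<dots> = (\<integral>I. exp (q x I / w) * k I \<partial>\<nu>)"
    using H0 integrable_gibbs[OF x k bnd] int_H by simp
  finally show ?thesis .
qed

text \<open>Jensen's inequality for the Gibbs measure with density proportional to \<open>exp (q x I / w)\<close>,
  through \<open>exp d \<ge> exp t * (1 + d - t)\<close> at the mean \<open>t\<close> of \<open>d = (q y - q x) / w\<close>.\<close>

lemma smoothed_objective_diff_le:
  assumes x: "x \<in> space A" "y \<in> space A"
  shows "smoothed_objective \<nu> w f q x - smoothed_objective \<nu> w f q y
    \<le> (\<integral>I. exp (q x I / w) * ((f x + q x I) - (f y + q y I)) \<partial>\<nu>) / (\<integral>I. exp (q x I / w) \<partial>\<nu>)"
proof -
  note [measurable] = q_section[OF x(1)] q_section[OF x(2)]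
  define Zx where "Zx = (\<integral>I. exp (q x I / w) \<partial>\<nu>)"
  define Zy where "Zy = (\<integral>I. exp (q y I / w) \<partial>\<nu>)"
  have Z: "0 < Zx" "0 < Zy" unfolding Zx_def Zy_def using partition_pos x by auto
  define d where "d I = (q y I - q x I) / w" for I
  define t where "t = (\<integral>I. exp (q x I / w) * d I \<partial>\<nu>) / Zx"
  have d_bnd: "\<bar>d I\<bar> \<le> L * dist y x / w" if "I \<in> space \<nu>" for I
    using q_lip[OF x(2,1) that] w unfolding d_def by (simp add: divide_right_mono)
  have d_meas[measurable]: "d \<in> borel_measurable \<nu>" unfolding d_def by measurable
  have int_d: "integrable \<nu> (\<lambda>I. exp (q x I / w) * d I)"
    by (rule integrable_gibbs[OF x(1) d_meas d_bnd])
  have int_1: "integrable \<nu> (\<lambda>I. exp (q x I / w))" "integrable \<nu> (\<lambda>I. exp (q y I / w))"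
    using integrable_gibbs[OF x(1), of "\<lambda>_. 1" 1] integrable_gibbs[OF x(2), of "\<lambda>_. 1" 1] by simp_all
  have eq: "exp t * (exp (q x I / w) * d I) + (exp t * (1 - t)) * exp (q x I / w)
      = exp (q x I / w) * (exp t * (1 + (d I - t)))" for I by (simp add: algebra_simps)
  have "exp (q x I / w) * (exp t * (1 + (d I - t))) \<le> exp (q y I / w)" for I
  proof -
    have "exp t * (1 + (d I - t)) \<le> exp t * exp (d I - t)" by (intro mult_left_mono exp_ge_add_one_self) auto
    also have "\<dots> = exp (d I)" by (simp flip: exp_add)
    finally have "exp (q x I / w) * (exp t * (1 + (d I - t))) \<le> exp (q x I / w) * exp (d I)" by simp
    also have "\<dots> = exp (q y I / w)" by (simp add: d_def diff_divide_distrib flip: exp_add)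
    finally show ?thesis .
  qed
  then have "(\<integral>I. exp t * (exp (q x I / w) * d I) + (exp t * (1 - t)) * exp (q x I / w) \<partial>\<nu>) \<le> Zy"
    unfolding Zy_def eq[symmetric] using int_d int_1 by (intro integral_mono) auto
  \<comment> \<open>As \<open>t\<close> is the Gibbs mean of \<open>d\<close>, the first-order term
    integrates to 0 and only \<open>exp t * Zx\<close> is left.\<close>
  moreover have "(\<integral>I. exp t * (exp (q x I / w) * d I) + (exp t * (1 - t)) * exp (q x I / w) \<partial>\<nu>) = exp t * Zx"
  proof -
    have "(\<integral>I. exp t * (exp (q x I / w) * d I) + (exp t * (1 - t)) * exp (q x I / w) \<partial>\<nu>)
        = exp t * (\<integral>I. exp (q x I / w) * d I \<partial>\<nu>) + (exp t * (1 - t)) * Zx"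
      using int_d int_1 by (simp add: Zx_def)
    also have "(\<integral>I. exp (q x I / w) * d I \<partial>\<nu>) = t * Zx" using Z by (simp add: t_def)
    finally show ?thesis by (simp add: algebra_simps)
  qed
  ultimately have "ln (exp t * Zx) \<le> ln Zy" using Z by simp
  then have t_le: "t + ln Zx \<le> ln Zy" using Z by (simp add: ln_mult)
  have "(\<integral>I. exp (q x I / w) * ((f x + q x I) - (f y + q y I)) \<partial>\<nu>)
      = (\<integral>I. (f x - f y) * exp (q x I / w) - w * (exp (q x I / w) * d I) \<partial>\<nu>)"
    using w by (intro Bochner_Integration.integral_cong) (auto simp: d_def field_simps)
  also have "\<dots> = (f x - f y) * Zx - w * (t * Zx)"
    using int_d int_1 Z by (simp add: t_def Zx_def[symmetric])
  finally have "(\<integral>I. exp (q x I / w) * ((f x + q x I) - (f y + q y I)) \<partial>\<nu>) / Zx = (f x - f y) - w * t"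
    using Z by (simp add: field_simps)
  moreover have "w * (t + ln Zx) \<le> w * ln Zy" using t_le w by simp
  ultimately show ?thesis
    unfolding smoothed_objective_def Zx_def[symmetric] Zy_def[symmetric] by (simp add: algebra_simps)
qed

end

section \<open>Conditioning on the past\<close>

text \<open>The hypothesis \<open>cond\<close> compares the law of \<open>(X, J)\<close> with the
  mixture of the kernels on rectangles only. These form an intersection-stable generator, so the two
  laws coincide and functions of both variables may be integrated with \<open>X\<close>
  frozen.\<close>

lemma integral_next_state:
  fixes H :: "'x \<Rightarrow> 'i \<Rightarrow> real"
  assumes M: "prob_space M"
    and X[measurable]: "X \<in> M \<rightarrow>\<^sub>M A" and I[measurable]: "I \<in> M \<rightarrow>\<^sub>M N" and J[measurable]: "J \<in> M \<rightarrow>\<^sub>M N"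
    and K: "case_prod K \<in> A \<Otimes>\<^sub>M N \<rightarrow>\<^sub>M prob_algebra N"
    and cond: "\<And>a B. a \<in> sets A \<Longrightarrow> B \<in> sets N \<Longrightarrow>
      (\<integral>\<omega>. indicat_real a (X \<omega>) * indicat_real B (J \<omega>) \<partial>M)
      = (\<integral>\<omega>. indicat_real a (X \<omega>) * measure (K (X \<omega>) (I \<omega>)) B \<partial>M)"
    and H[measurable]: "case_prod H \<in> borel_measurable (A \<Otimes>\<^sub>M N)"
    and H_bnd: "\<And>x j. x \<in> space A \<Longrightarrow> j \<in> space N \<Longrightarrow> \<bar>H x j\<bar> \<le> B"
  shows "(\<integral>\<omega>. H (X \<omega>) (J \<omega>) \<partial>M) = (\<integral>\<omega>. (\<integral>j. H (X \<omega>) j \<partial>K (X \<omega>) (I \<omega>)) \<partial>M)"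
proof -
  interpret prob_space M by fact
  define k where "k \<omega> = K (X \<omega>) (I \<omega>)" for \<omega>
  have "(\<lambda>\<omega>. case_prod K (X \<omega>, I \<omega>)) \<in> M \<rightarrow>\<^sub>M prob_algebra N"
    using K by (intro measurable_compose[OF _ K]) measurable
  then have k_prob: "k \<in> M \<rightarrow>\<^sub>M prob_algebra N" by (simp add: k_def[abs_def])
  have k[measurable]: "k \<in> M \<rightarrow>\<^sub>M subprob_algebra N" by (rule measurable_prob_algebraD[OF k_prob])
  have k_sets: "sets (k \<omega>) = sets N" and k_space: "space (k \<omega>) = space N" and prob_k: "prob_space (k \<omega>)"
    if "\<omega> \<in> space M" for \<omega>
    using measurable_space[OF k_prob that] by (auto simp: space_prob_algebra dest: sets_eq_imp_space_eq)
  have X_sp: "X \<omega> \<in> space A" if "\<omega> \<in> space M" for \<omega>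
    using that by (rule measurable_space[OF X])
  define \<mu> where "\<mu> = distr M (A \<Otimes>\<^sub>M N) (\<lambda>\<omega>. (X \<omega>, J \<omega>))"
  \<comment> \<open>The candidate conditional law of the pair: first component frozen at
    \<open>X \<omega>\<close>, second drawn from the kernel.\<close>
  define R where "R \<omega> = distr (k \<omega>) (A \<Otimes>\<^sub>M N) (\<lambda>j. (X \<omega>, j))" for \<omega>
  have R[measurable]: "R \<in> M \<rightarrow>\<^sub>M subprob_algebra (A \<Otimes>\<^sub>M N)"
  proof -
    note measurable_distr2[measurable]
    show ?thesis unfolding R_def by measurable
  qed
  have pair_k: "(\<lambda>j. (X \<omega>, j)) \<in> k \<omega> \<rightarrow>\<^sub>M A \<Otimes>\<^sub>M N" if "\<omega> \<in> space M" for \<omega>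
    using measurable_Pair1'[OF X_sp[OF that]] k_sets[OF that] by (simp cong: measurable_cong_sets)
  have R_prob: "prob_space (R \<omega>)" if "\<omega> \<in> space M" for \<omega>
    unfolding R_def by (rule prob_space.prob_space_distr[OF prob_k[OF that] pair_k[OF that]])
  have "\<mu> = M \<bind> R"
  proof (rule measure_eqI_generator_eq[OF Int_stable_pair_measure_generator[of A N]])
    show "{a \<times> b |a b. a \<in> sets A \<and> b \<in> sets N} \<subseteq> Pow (space A \<times> space N)"
      by (rule pair_measure_closed)
    show "sets \<mu> = sigma_sets (space A \<times> space N) {a \<times> b |a b. a \<in> sets A \<and> b \<in> sets N}"
      by (simp add: \<mu>_def sets_pair_measure)
    show "sets (M \<bind> R) = sigma_sets (space A \<times> space N) {a \<times> b |a b. a \<in> sets A \<and> b \<in> sets N}"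
      using sets_bind[of M R "A \<Otimes>\<^sub>M N"] not_empty by (simp add: R_def sets_pair_measure)
    show "range (\<lambda>_::nat. space A \<times> space N) \<subseteq> {a \<times> b |a b. a \<in> sets A \<and> b \<in> sets N}" by auto
    show "(\<Union>i::nat. space A \<times> space N) = space A \<times> space N" by simp
    have "prob_space \<mu>" unfolding \<mu>_def by (intro prob_space_distr) measurable
    then show "emeasure \<mu> (space A \<times> space N) \<noteq> \<infinity>" for i :: nat
      using prob_space.emeasure_space_1[of \<mu>] by (simp add: \<mu>_def space_pair_measure)
  next
    fix Y assume "Y \<in> {a \<times> b |a b. a \<in> sets A \<and> b \<in> sets N}"
    then obtain a b where Y: "Y = a \<times> b" and a[measurable]: "a \<in> sets A" and b[measurable]: "b \<in> sets N" by auto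
    have m[measurable]: "(\<lambda>\<omega>. measure (k \<omega>) b) \<in> borel_measurable M" by measurable
    have "emeasure \<mu> Y = (\<integral>\<^sup>+\<omega>. indicator Y (X \<omega>, J \<omega>) \<partial>M)"
      unfolding \<mu>_def Y by (subst nn_integral_indicator[symmetric], simp, subst nn_integral_distr) auto
    also have "\<dots> = (\<integral>\<^sup>+\<omega>. ennreal (indicat_real a (X \<omega>) * indicat_real b (J \<omega>)) \<partial>M)"
      unfolding Y by (intro nn_integral_cong) (auto simp: indicator_def)
    also have "\<dots> = ennreal (\<integral>\<omega>. indicat_real a (X \<omega>) * indicat_real b (J \<omega>) \<partial>M)"
      by (intro nn_integral_eq_integral integrable_const_bound[of _ 1]) (auto simp: indicator_def)
    also have "\<dots> = ennreal (\<integral>\<omega>. indicat_real a (X \<omega>) * measure (k \<omega>) b \<partial>M)"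
      unfolding k_def using cond[OF a b] by simp
    also have "\<dots> = (\<integral>\<^sup>+\<omega>. ennreal (indicat_real a (X \<omega>) * measure (k \<omega>) b) \<partial>M)"
      by (intro nn_integral_eq_integral[symmetric] integrable_const_bound[of _ 1])
        (auto simp: indicator_def intro!: AE_I2 prob_space.prob_le_1 prob_k)
    also have "\<dots> = (\<integral>\<^sup>+\<omega>. emeasure (R \<omega>) Y \<partial>M)"
    proof (intro nn_integral_cong)
      fix \<omega> assume \<omega>: "\<omega> \<in> space M"
      interpret k: prob_space "k \<omega>" by (rule prob_k[OF \<omega>])
      have "emeasure (R \<omega>) Y = emeasure (k \<omega>) ((\<lambda>j. (X \<omega>, j)) -` Y \<inter> space N)"
        unfolding R_def Y using pair_k[OF \<omega>] k_space[OF \<omega>] by (subst emeasure_distr) auto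
      also have "(\<lambda>j. (X \<omega>, j)) -` Y \<inter> space N = (if X \<omega> \<in> a then b else {})"
        unfolding Y using sets.sets_into_space[OF b] by auto
      finally show "ennreal (indicat_real a (X \<omega>) * measure (k \<omega>) b) = emeasure (R \<omega>) Y"
        by (simp add: k.emeasure_eq_measure)
    qed
    also have "\<dots> = emeasure (M \<bind> R) Y"
      by (rule emeasure_bind[OF not_empty R, symmetric]) (simp add: Y)
    finally show "emeasure \<mu> Y = emeasure (M \<bind> R) Y" .
  qed
  moreover have "(\<integral>z. case_prod H z \<partial>(M \<bind> R)) = (\<integral>\<omega>. (\<integral>z. case_prod H z \<partial>R \<omega>) \<partial>M)"
  proof (rule integral_bind[OF H _ R finite_measure_axioms, of B 1])
    show "AE \<omega> in M. emeasure (R \<omega>) (space (R \<omega>)) \<le> ennreal 1"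
      using prob_space.emeasure_space_1[OF R_prob] by (intro AE_I2) simp
    show "\<bar>case_prod H z\<bar> \<le> B" if "z \<in> space (A \<Otimes>\<^sub>M N)" for z
      using that H_bnd by (auto simp: space_pair_measure)
  qed
  moreover have "(\<integral>z. case_prod H z \<partial>\<mu>) = (\<integral>\<omega>. H (X \<omega>) (J \<omega>) \<partial>M)"
    unfolding \<mu>_def by (subst integral_distr) auto
  moreover have "(\<integral>\<omega>. (\<integral>z. case_prod H z \<partial>R \<omega>) \<partial>M) = (\<integral>\<omega>. (\<integral>j. H (X \<omega>) j \<partial>K (X \<omega>) (I \<omega>)) \<partial>M)"
  proof (intro Bochner_Integration.integral_cong refl)
    fix \<omega> assume "\<omega> \<in> space M"
    then show "(\<integral>z. case_prod H z \<partial>R \<omega>) = (\<integral>j. H (X \<omega>) j \<partial>K (X \<omega>) (I \<omega>))"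
      unfolding R_def k_def[symmetric] by (subst integral_distr[OF pair_k H]) auto
  qed
  ultimately show ?thesis by simp
qed

lemma past_algebra_cong: "sets N = sets N' \<Longrightarrow> past_algebra M N X I n = past_algebra M N' X I n"
  unfolding past_algebra_def by (simp only: sets_pair_measure_cong[OF refl, of N N'])

lemma past_algebra_subalgebra:
  assumes X: "\<And>t. X t \<in> M \<rightarrow>\<^sub>M borel" and I: "\<And>t. I t \<in> M \<rightarrow>\<^sub>M N"
  shows "subalgebra M (past_algebra M N X I n)"
proof -
  have "(\<lambda>\<omega>. (X t \<omega>, I t \<omega>)) \<in> M \<rightarrow>\<^sub>M borel \<Otimes>\<^sub>M N" for t using X[of t] I[of t] by measurable
  from measurable_sets[OF this]
  have "sigma_sets (space M) {(\<lambda>\<omega>. (X t \<omega>, I t \<omega>)) -` A \<inter> space M | t A. t \<le> n \<and> A \<in> sets (borel \<Otimes>\<^sub>M N)} \<subseteq> sets M"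
    by (intro sets.sigma_sets_subset) auto
  moreover have "{(\<lambda>\<omega>. (X t \<omega>, I t \<omega>)) -` A \<inter> space M | t A. t \<le> n \<and> A \<in> sets (borel \<Otimes>\<^sub>M N)} \<subseteq> Pow (space M)"
    by auto
  ultimately show ?thesis
    unfolding subalgebra_def past_algebra_def by (simp add: sets_measure_of space_measure_of)
qed

lemma past_algebra_measurable:
  assumes X: "\<And>t. X t \<in> M \<rightarrow>\<^sub>M borel" and I: "\<And>t. I t \<in> M \<rightarrow>\<^sub>M N"
  shows "X n \<in> past_algebra M N X I n \<rightarrow>\<^sub>M borel"
proof (rule measurableI)
  fix a :: "'b set" assume a: "a \<in> sets borel"
  have "X n -` a \<inter> space M = (\<lambda>\<omega>. (X n \<omega>, I n \<omega>)) -` (a \<times> space N) \<inter> space M"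
    using measurable_space[OF I[of n]] by auto
  moreover have "a \<times> space N \<in> sets (borel \<Otimes>\<^sub>M N)" using a by simp
  ultimately have "X n -` a \<inter> space M \<in> {(\<lambda>\<omega>. (X t \<omega>, I t \<omega>)) -` A \<inter> space M | t A. t \<le> n \<and> A \<in> sets (borel \<Otimes>\<^sub>M N)}"
    by blast
  moreover have "space (past_algebra M N X I n) = space M"
    unfolding past_algebra_def by (subst space_measure_of) auto
  ultimately show "X n -` a \<inter> space (past_algebra M N X I n) \<in> sets (past_algebra M N X I n)"
    unfolding past_algebra_def by (subst sets_measure_of) auto
qed auto

section \<open>Weighted sums of the recursion\<close>

text \<open>Summation by parts: the first term and the increments of \<open>c\<close> contribute at
  most \<open>T * c n\<close> together, and the last boundary term contributes at most as much
  again. The induction carries that boundary term along.\<close>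

lemma sum_telescope_incr:
  fixes c t :: "nat \<Rightarrow> real"
  assumes mono: "\<And>k. 1 \<le> k \<Longrightarrow> c k \<le> c (Suc k)" and c: "0 \<le> c 1" and t: "\<And>k. \<bar>t k\<bar> \<le> T" and n: "1 \<le> n"
  shows "(\<Sum>k=1..n. c k * (t k - t (Suc k))) \<le> 2 * T * c n"
proof -
  have "(\<Sum>k=1..n. c k * (t k - t (Suc k))) + c n * t (Suc n) \<le> T * c n \<and> 0 \<le> c n"
    using n
  proof (induction n rule: nat_induct_at_least)
    case base
    have "c 1 * t 1 \<le> c 1 * T" using t[of 1] c by (intro mult_left_mono) auto
    then show ?case using c by (simp add: algebra_simps)
  next
    case (Suc n)
    have "(c (Suc n) - c n) * t (Suc n) \<le> (c (Suc n) - c n) * T"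
      using t[of "Suc n"] mono[OF Suc.hyps] by (intro mult_left_mono) auto
    then show ?case using Suc mono[OF Suc.hyps] by (simp add: algebra_simps)
  qed
  moreover have "- (c n * t (Suc n)) \<le> c n * T" if "0 \<le> c n"
    using t[of "Suc n"] that mult_left_mono[of "- t (Suc n)" T "c n"] by auto
  ultimately show ?thesis by (auto simp: algebra_simps)
qed

text \<open>Summation by parts for decreasing weights: the two boundary terms \<open>c 1\<close> and
  \<open>c n\<close> and the variation \<open>c 1 - c n\<close> add up to
  \<open>2 * c 1\<close>.\<close>

lemma sum_telescope_decr:
  fixes c t :: "nat \<Rightarrow> real"
  assumes mono: "\<And>k. 1 \<le> k \<Longrightarrow> c (Suc k) \<le> c k" and c: "\<And>k. 1 \<le> k \<Longrightarrow> 0 \<le> c k" and t: "\<And>k. \<bar>t k\<bar> \<le> T" and n: "1 \<le> n"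
  shows "(\<Sum>k=1..n. c k * (t k - t (Suc k))) \<le> 2 * T * c 1"
proof -
  have "(\<Sum>k=1..n. c k * (t k - t (Suc k))) + c n * t (Suc n) \<le> T * (2 * c 1 - c n)"
    using n
  proof (induction n rule: nat_induct_at_least)
    case base
    have "c 1 * t 1 \<le> c 1 * T" using t[of 1] c[of 1] by (intro mult_left_mono) auto
    then show ?case by (simp add: algebra_simps)
  next
    case (Suc n)
    have "(c n - c (Suc n)) * (- t (Suc n)) \<le> (c n - c (Suc n)) * T"
      using t[of "Suc n"] mono[OF Suc.hyps] by (intro mult_left_mono) auto
    then show ?case using Suc by (simp add: algebra_simps)
  qed
  moreover have "- (c n * t (Suc n)) \<le> c n * T"
    using t[of "Suc n"] c[OF n] mult_left_mono[of "- t (Suc n)" T "c n"] by auto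
  ultimately show ?thesis by (auto simp: algebra_simps)
qed

lemma sum_inverse_le_ln:
  assumes "1 \<le> n"
  shows "(\<Sum>k=1..n. 1 / real k) \<le> 1 + ln (real n)"
  using assms
proof (induction n rule: nat_induct_at_least)
  case (Suc n)
  have "ln (real n / real (Suc n)) \<le> real n / real (Suc n) - 1"
    using Suc.hyps by (intro ln_le_minus_one) auto
  then have "1 / real (Suc n) \<le> ln (real (Suc n)) - ln (real n)"
    using Suc.hyps by (simp add: ln_div field_simps)
  with Suc.IH show ?case by simp
qed simp

text \<open>The distance differences carry the coefficient
  \<open>c k / (2 * \<alpha> (Suc k))\<close>, which decreases for the weights
  \<open>\<alpha> k\<close> and increases for the weights \<open>k\<close>; hence two telescoping
  bounds. For the drift term the first choice sums to order \<open>ln n\<close> against a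
  normalization of order \<open>sqrt n\<close>, the second to order \<open>n * sqrt n\<close>
  against \<open>n\<^sup>2 / 2\<close>, so only the first keeps a logarithm.\<close>

lemma step_size_rates:
  fixes a d t :: "nat \<Rightarrow> real"
  assumes \<alpha>0: "0 < \<alpha>0" and Mc: "0 \<le> Mc" and n: "1 \<le> n"
    and \<alpha>: "\<alpha> = (\<lambda>n. \<alpha>0 / sqrt (real n))"
    and d: "\<And>k. \<bar>d k\<bar> \<le> D2" and t: "\<And>k. \<bar>t k\<bar> \<le> T"
    and rec: "\<And>k. a k \<le> (d k - d (Suc k)) / (2 * \<alpha> (Suc k)) + (t (Suc k) - t k) + Mc * \<alpha> (Suc k)"
  shows "(\<Sum>k=1..n. \<alpha> k * a k) / (\<Sum>k=1..n. \<alpha> k)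
      \<le> (2 * D2 / \<alpha>0 + 2 * T + Mc * \<alpha>0 * (1 + ln (real n))) / sqrt (real n)"
    and "(\<Sum>k=1..n. real k * a k) / (\<Sum>k=1..n. real k)
      \<le> (2 * D2 / \<alpha>0 + 4 * T + 2 * Mc * \<alpha>0) / sqrt (real n)"
proof -
  have D2: "0 \<le> D2" using d[of 0] by linarith
  have T: "0 \<le> T" using t[of 0] by linarith
  have t': "\<bar>- t k\<bar> \<le> T" for k using t[of k] by simp
  have pos: "0 < \<alpha> k" if "1 \<le> k" for k using \<alpha>0 that by (simp add: \<alpha>)
  have split: "(\<Sum>k=1..n. c k * a k) \<le> (\<Sum>k=1..n. c k / (2 * \<alpha> (Suc k)) * (d k - d (Suc k)))
      + (\<Sum>k=1..n. c k * ((- t k) - (- t (Suc k)))) + Mc * (\<Sum>k=1..n. c k * \<alpha> (Suc k))"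
    if "\<And>k. 1 \<le> k \<Longrightarrow> 0 \<le> c k" for c :: "nat \<Rightarrow> real"
  proof -
    have "(\<Sum>k=1..n. c k * a k) \<le> (\<Sum>k=1..n. c k * ((d k - d (Suc k)) / (2 * \<alpha> (Suc k)) + (t (Suc k) - t k) + Mc * \<alpha> (Suc k)))"
      using rec that by (intro sum_mono mult_left_mono) auto
    also have "\<dots> = (\<Sum>k=1..n. c k / (2 * \<alpha> (Suc k)) * (d k - d (Suc k)))
      + (\<Sum>k=1..n. c k * ((- t k) - (- t (Suc k)))) + Mc * (\<Sum>k=1..n. c k * \<alpha> (Suc k))"
      by (simp add: sum.distrib[symmetric] sum_distrib_left algebra_simps)
    finally show ?thesis .
  qed
  have sq: "0 < sqrt (real n)" "sqrt (real n) * sqrt (real n) = real n" using n by auto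
  \<comment> \<open>The iterate of weight \<open>\<alpha> k\<close> is moved with step
    \<open>\<alpha> (Suc k)\<close>, so the coefficient is not constant; it decreases from
    \<open>sqrt 2 / 2\<close> towards \<open>1 / 2\<close>.\<close>
  have "(\<Sum>k=1..n. \<alpha> k / (2 * \<alpha> (Suc k)) * (d k - d (Suc k))) \<le> 2 * D2 * (\<alpha> 1 / (2 * \<alpha> (Suc 1)))"
  proof (rule sum_telescope_decr[OF _ _ d n])
    have r: "\<alpha> k / (2 * \<alpha> (Suc k)) = sqrt (1 + 1 / real k) / 2" if "1 \<le> k" for k
      using that \<alpha>0 by (simp add: \<alpha> real_sqrt_divide[symmetric] field_simps)
    show "\<alpha> (Suc k) / (2 * \<alpha> (Suc (Suc k))) \<le> \<alpha> k / (2 * \<alpha> (Suc k))" if "1 \<le> k" for k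
      using that by (simp add: r frac_le)
    show "0 \<le> \<alpha> k / (2 * \<alpha> (Suc k))" if "1 \<le> k" for k using pos[OF that] pos[of "Suc k"] by simp
  qed
  also have "\<dots> = D2 * sqrt 2" using \<alpha>0 by (simp add: \<alpha>)
  also have "\<dots> \<le> D2 * 2" using D2 by (intro mult_left_mono real_le_lsqrt) auto
  finally have 1: "(\<Sum>k=1..n. \<alpha> k / (2 * \<alpha> (Suc k)) * (d k - d (Suc k))) \<le> 2 * D2" by simp
  have \<alpha>_dec: "\<alpha> (Suc k) \<le> \<alpha> k" if "1 \<le> k" for k
    using that \<alpha>0 by (simp add: \<alpha> frac_le)
  have "(\<Sum>k=1..n. \<alpha> k * ((- t k) - (- t (Suc k)))) \<le> 2 * T * \<alpha> 1"
    by (rule sum_telescope_decr[where t="\<lambda>k. - t k" and c=\<alpha>, OF \<alpha>_dec _ t' n]) (use pos in \<open>auto intro: less_imp_le\<close>)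
  then have 2: "(\<Sum>k=1..n. \<alpha> k * ((- t k) - (- t (Suc k)))) \<le> 2 * T * \<alpha>0" by (simp add: \<alpha>)
  have "(\<Sum>k=1..n. \<alpha> k * \<alpha> (Suc k)) \<le> (\<Sum>k=1..n. \<alpha>0\<^sup>2 * (1 / real k))"
  proof (rule sum_mono)
    fix k assume "k \<in> {1..n}"
    then have k: "1 \<le> k" by simp
    have "\<alpha> k * \<alpha> (Suc k) \<le> \<alpha> k * \<alpha> k" using \<alpha>_dec[OF k] pos[OF k] by (intro mult_left_mono) auto
    also have "\<dots> = \<alpha>0\<^sup>2 * (1 / real k)" using k by (simp add: \<alpha> power2_eq_square)
    finally show "\<alpha> k * \<alpha> (Suc k) \<le> \<alpha>0\<^sup>2 * (1 / real k)" .
  qed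
  also have "\<dots> \<le> \<alpha>0\<^sup>2 * (1 + ln (real n))"
    unfolding sum_distrib_left[symmetric] by (intro mult_left_mono sum_inverse_le_ln n) auto
  finally have 3: "Mc * (\<Sum>k=1..n. \<alpha> k * \<alpha> (Suc k)) \<le> Mc * (\<alpha>0\<^sup>2 * (1 + ln (real n)))"
    using Mc by (rule mult_left_mono)
  \<comment> \<open>Each of the \<open>n\<close> step sizes is at least the last one.\<close>
  have "(\<Sum>k=1..n. \<alpha>0 / sqrt (real n)) \<le> (\<Sum>k=1..n. \<alpha> k)"
    unfolding \<alpha> using \<alpha>0 by (intro sum_mono divide_left_mono) auto
  moreover have "(\<Sum>k=1..n. \<alpha>0 / sqrt (real n)) = \<alpha>0 * (real n / sqrt (real n))" by simp
  ultimately have S: "\<alpha>0 * sqrt (real n) \<le> (\<Sum>k=1..n. \<alpha> k)"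
    by (simp only: real_div_sqrt of_nat_0_le_iff)
  define B where "B = 2 * D2 + 2 * T * \<alpha>0 + Mc * (\<alpha>0\<^sup>2 * (1 + ln (real n)))"
  have "0 \<le> B" unfolding B_def using D2 T \<alpha>0 Mc n by (intro add_nonneg_nonneg mult_nonneg_nonneg) auto
  have "(\<Sum>k=1..n. \<alpha> k * a k) \<le> B"
    using split[of \<alpha>] pos 1 2 3 unfolding B_def by (fastforce intro: less_imp_le)
  then have "(\<Sum>k=1..n. \<alpha> k * a k) / (\<Sum>k=1..n. \<alpha> k) \<le> B / (\<alpha>0 * sqrt (real n))"
    using S \<open>0 \<le> B\<close> \<alpha>0 sq by (intro frac_le) auto
  also have "\<dots> = (2 * D2 / \<alpha>0 + 2 * T + Mc * \<alpha>0 * (1 + ln (real n))) / sqrt (real n)"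
    using \<alpha>0 sq(1) by (simp add: B_def field_simps power2_eq_square)
  finally show "(\<Sum>k=1..n. \<alpha> k * a k) / (\<Sum>k=1..n. \<alpha> k)
      \<le> (2 * D2 / \<alpha>0 + 2 * T + Mc * \<alpha>0 * (1 + ln (real n))) / sqrt (real n)" .
  have "(\<Sum>k=1..n. real k / (2 * \<alpha> (Suc k)) * (d k - d (Suc k))) \<le> 2 * D2 * (real n / (2 * \<alpha> (Suc n)))"
  proof (rule sum_telescope_incr[OF _ _ d n])
    have r: "real k / (2 * \<alpha> (Suc k)) = real k * sqrt (1 + real k) / (2 * \<alpha>0)" for k
      using \<alpha>0 by (simp add: \<alpha>)
    show "real k / (2 * \<alpha> (Suc k)) \<le> real (Suc k) / (2 * \<alpha> (Suc (Suc k)))" for k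
      unfolding r using \<alpha>0 by (intro divide_right_mono mult_mono) auto
    show "0 \<le> real 1 / (2 * \<alpha> (Suc 1))" using pos[of "Suc 1"] by simp
  qed
  also have "\<dots> = D2 * real n * sqrt (real (Suc n)) / \<alpha>0" by (simp add: \<alpha>)
  finally have 1: "(\<Sum>k=1..n. real k / (2 * \<alpha> (Suc k)) * (d k - d (Suc k))) \<le> D2 * real n * sqrt (real (Suc n)) / \<alpha>0" .
  have 2: "(\<Sum>k=1..n. real k * ((- t k) - (- t (Suc k)))) \<le> 2 * T * real n"
    by (rule sum_telescope_incr[where t="\<lambda>k. - t k", OF _ _ t' n]) auto
  have "(\<Sum>k=1..n. real k * \<alpha> (Suc k)) \<le> (\<Sum>k=1..n. \<alpha>0 * sqrt (real n))"
  proof (rule sum_mono)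
    fix k assume k: "k \<in> {1..n}"
    have "real k * \<alpha> (Suc k) \<le> real k * \<alpha> k" using k \<alpha>_dec by (intro mult_left_mono) auto
    also have "\<dots> = \<alpha>0 * sqrt (real k)" 
    proof -
      have "real k * \<alpha> k = \<alpha>0 * (real k / sqrt (real k))" by (simp add: \<alpha>)
      then show ?thesis by (simp only: real_div_sqrt of_nat_0_le_iff)
    qed
    also have "\<dots> \<le> \<alpha>0 * sqrt (real n)" using k \<alpha>0 by (intro mult_left_mono) auto
    finally show "real k * \<alpha> (Suc k) \<le> \<alpha>0 * sqrt (real n)" .
  qed
  then have 3: "Mc * (\<Sum>k=1..n. real k * \<alpha> (Suc k)) \<le> Mc * (real n * (\<alpha>0 * sqrt (real n)))"
    using Mc by (intro mult_left_mono) auto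
  have S: "(\<Sum>k=1..n. real k) = real n * real (Suc n) / 2"
    using double_gauss_sum_from_Suc_0[of n, where 'a=real] by (simp add: algebra_simps)
  have "(\<Sum>k=1..n. real k * a k) \<le> D2 * real n * sqrt (real (Suc n)) / \<alpha>0 + 2 * T * real n + Mc * (real n * (\<alpha>0 * sqrt (real n)))"
    using split[of real] 1 2 3 by simp
  then have "(\<Sum>k=1..n. real k * a k) / (\<Sum>k=1..n. real k)
      \<le> (D2 * real n * sqrt (real (Suc n)) / \<alpha>0 + 2 * T * real n + Mc * (real n * (\<alpha>0 * sqrt (real n)))) / (real n * real (Suc n) / 2)"
    unfolding S by (intro divide_right_mono) auto
  also have "\<dots> = 2 * D2 / \<alpha>0 * (sqrt (real (Suc n)) / real (Suc n)) + 4 * T * (1 / real (Suc n)) + 2 * Mc * \<alpha>0 * (sqrt (real n) / real (Suc n))"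
  proof -
    have "(D2 * m * r / \<alpha>0 + 2 * T * m + Mc * (m * (\<alpha>0 * v))) / (m * s / 2)
        = 2 * D2 / \<alpha>0 * (r / s) + 4 * T * (1 / s) + 2 * Mc * \<alpha>0 * (v / s)"
      if "m \<noteq> 0" "s \<noteq> 0" for m s r v :: real
      using that \<alpha>0 by (simp add: field_simps)
    then show ?thesis using n by auto
  qed
  also have "\<dots> \<le> 2 * D2 / \<alpha>0 * (1 / sqrt (real n)) + 4 * T * (1 / sqrt (real n)) + 2 * Mc * \<alpha>0 * (1 / sqrt (real n))"
  proof (intro add_mono mult_left_mono)
    have "sqrt (real (Suc n)) / real (Suc n) = 1 / sqrt (real (Suc n))" by (rule sqrt_divide_self_eq[THEN trans]) (auto simp: inverse_eq_divide)
    then show "sqrt (real (Suc n)) / real (Suc n) \<le> 1 / sqrt (real n)" using n by (simp add: frac_le)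
    have "sqrt (real n) \<le> real (Suc n)" by (rule real_le_lsqrt) (auto simp: power2_eq_square algebra_simps)
    then show "1 / real (Suc n) \<le> 1 / sqrt (real n)" using sq by (intro frac_le) auto
    show "sqrt (real n) / real (Suc n) \<le> 1 / sqrt (real n)" using sq by (simp add: field_simps)
  qed (use D2 T Mc \<alpha>0 in auto)
  also have "\<dots> = (2 * D2 / \<alpha>0 + 4 * T + 2 * Mc * \<alpha>0) / sqrt (real n)" by (simp add: add_divide_distrib)
  finally show "(\<Sum>k=1..n. real k * a k) / (\<Sum>k=1..n. real k)
      \<le> (2 * D2 / \<alpha>0 + 4 * T + 2 * Mc * \<alpha>0) / sqrt (real n)" .
qed

section \<open>The projected subgradient method\<close>

text \<open>McShane's formula \<open>h x I = inf\<^sub>y (h y I + L * dist x y)\<close>, restricted to a countable dense set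
  of points \<open>y\<close>.\<close>

lemma measurable_of_lipschitz_sections:
  fixes X :: "'x::{metric_space, second_countable_topology} set" and h :: "'x \<Rightarrow> 'i \<Rightarrow> real"
  assumes X: "X \<noteq> {}" and L: "0 \<le> L"
    and sec: "\<And>x. x \<in> X \<Longrightarrow> h x \<in> borel_measurable N"
    and lip: "\<And>x y I. x \<in> X \<Longrightarrow> y \<in> X \<Longrightarrow> I \<in> space N \<Longrightarrow> \<bar>h x I - h y I\<bar> \<le> L * dist x y"
  shows "case_prod h \<in> borel_measurable (restrict_space borel X \<Otimes>\<^sub>M N)"
proof -
  obtain T where T: "countable T" "T \<subseteq> X" "X \<subseteq> closure T" by (rule separable)
  have T_ne: "T \<noteq> {}" using T X by auto
  define G where "G y z = h y (snd z) + L * dist (fst z) y" for y z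
  have le: "h (fst z) (snd z) \<le> G y z" if "z \<in> space (restrict_space borel X \<Otimes>\<^sub>M N)" "y \<in> T" for y z
    using lip[of "fst z" y "snd z"] that T(2) by (auto simp: G_def space_pair_measure space_restrict_space abs_le_iff)
  have G_meas: "G y \<in> borel_measurable (restrict_space borel X \<Otimes>\<^sub>M N)" if "y \<in> T" for y
  proof -
    have [measurable]: "h y \<in> borel_measurable N" using sec that T(2) by auto
    have [measurable]: "(\<lambda>x. dist x y) \<in> borel_measurable (restrict_space borel X)"
      by (intro borel_measurable_continuous_on_restrict continuous_intros)
    show ?thesis unfolding G_def by measurable
  qed
  have "(\<lambda>z. INF y\<in>T. G y z) \<in> borel_measurable (restrict_space borel X \<Otimes>\<^sub>M N)"
  proof (rule borel_measurable_cINF[OF T(1) G_meas])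
    show "bdd_below ((\<lambda>y. G y z) ` T)" if "z \<in> space (restrict_space borel X \<Otimes>\<^sub>M N)" for z
      by (rule bdd_belowI2[of T "h (fst z) (snd z)"]) (rule le[OF that])
  qed
  moreover have "(INF y\<in>T. G y z) = case_prod h z" if z: "z \<in> space (restrict_space borel X \<Otimes>\<^sub>M N)" for z
  proof (rule antisym)
    have x: "fst z \<in> X" and I: "snd z \<in> space N" using z by (auto simp: space_pair_measure space_restrict_space)
    show "(INF y\<in>T. G y z) \<le> case_prod h z"
    proof (rule field_le_epsilon)
      fix e :: real assume e: "0 < e"
      \<comment> \<open>One \<open>L\<close> pays for moving \<open>h\<close> from \<open>y\<close>
        to the point, one for the penalty in \<open>G\<close>; the added 1 covers
        \<open>L = 0\<close>.\<close>
      then have "0 < e / (2 * L + 1)" using L by simp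
      then obtain y where y: "y \<in> T" "dist y (fst z) < e / (2 * L + 1)"
        using T(3) x closure_approachable by blast
      have "(INF y\<in>T. G y z) \<le> G y z"
        by (rule cINF_lower[OF bdd_belowI2[of T "case_prod h z"] y(1)]) (use le[OF z] in \<open>auto simp: case_prod_beta\<close>)
      also have "\<dots> \<le> case_prod h z + 2 * L * dist y (fst z)"
        using lip[OF _ x I, of y] y(1) T(2) by (auto simp: G_def case_prod_beta dist_commute abs_le_iff)
      also have "2 * L * dist y (fst z) \<le> (2 * L + 1) * dist y (fst z)" by (intro mult_right_mono) auto
      also have "\<dots> \<le> e" using y(2) L by (simp add: field_simps)
      finally show "(INF y\<in>T. G y z) \<le> case_prod h z + e" by simp
    qed
    show "case_prod h z \<le> (INF y\<in>T. G y z)"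
      by (rule cINF_greatest[OF T_ne]) (use le[OF z] in \<open>auto simp: case_prod_beta\<close>)
  qed
  ultimately show ?thesis by (simp cong: measurable_cong)
qed

text \<open>\<open>R\<close> is the size of the Poisson solution for a function of oscillation
  \<open>2 * LQ * D\<close>, and the bracket in the first claim is the Lipschitz constant of its
  \<open>step\<close>, multiplied by \<open>L\<close> because an iterate moves at most
  \<open>L\<close> per unit of step size. The term \<open>L\<^sup>2 / 2\<close> comes from the
  squared step. Since \<open>1 / (1 - \<eta>) \<le> C\<close>, everything reduces to powers of
  \<open>C\<close>; 12 is 8 + 4, from the two parts of the bracket.\<close>

lemma drift_constant_bound:
  fixes LQ L D w \<eta> :: real
  assumes LQ: "0 \<le> LQ" "LQ \<le> L" and D: "0 \<le> D" and w: "0 < w" and \<eta>: "0 \<le> \<eta>" "\<eta> < 1"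
    and C: "C = (1 + \<eta>) / (1 - \<eta>)"
  defines "R \<equiv> 2 * LQ * D / (1 - \<eta>)" and "p \<equiv> 2 * LQ / w"
  shows "L\<^sup>2 / 2 + ((2 * LQ + 2 * p * R) / (1 - \<eta>) + p * R) * L \<le> 12 * L\<^sup>2 * (1 + L * D) * (C + C\<^sup>2 / w)"
    and "R \<le> 2 * L * D * (C + C\<^sup>2 / w)" and "1 \<le> C + C\<^sup>2 / w"
proof -
  define s where "s = 1 / (1 - \<eta>)"
  have C1: "1 \<le> C" and s: "0 \<le> s" "s \<le> C" using \<eta> by (auto simp: C s_def field_simps)
  have L: "0 \<le> L" using LQ by simp
  have "0 \<le> C\<^sup>2 / w" using w by simp
  then show Q: "1 \<le> C + C\<^sup>2 / w" using C1 by linarith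
  have CC: "C \<le> C\<^sup>2" using C1 self_le_power[of C 2] by simp
  have R_le: "R \<le> 2 * L * D * C"
  proof -
    have "R = 2 * LQ * D * s" by (simp add: R_def s_def)
    also have "\<dots> \<le> 2 * L * D * C" using LQ D s L by (intro mult_mono) auto
    finally show ?thesis .
  qed
  also have "\<dots> \<le> 2 * L * D * (C + C\<^sup>2 / w)" using L D \<open>0 \<le> C\<^sup>2 / w\<close> by (intro mult_left_mono) auto
  finally show "R \<le> 2 * L * D * (C + C\<^sup>2 / w)" .
  have R0: "0 \<le> R" and p0: "0 \<le> p" using LQ D w \<eta> by (auto simp: R_def p_def)
  have p_le: "p \<le> 2 * L / w" unfolding p_def using LQ w by (intro divide_right_mono) auto
  have pR: "p * R \<le> 4 * L\<^sup>2 * D * C / w"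
  proof -
    have "p * R \<le> (2 * L / w) * (2 * L * D * C)" using p_le R_le R0 L w by (intro mult_mono) auto
    then show ?thesis by (simp add: power2_eq_square)
  qed
  have pR0: "0 \<le> p * R" using p0 R0 by simp
  have "(2 * LQ + 2 * p * R) / (1 - \<eta>) = (2 * LQ + 2 * (p * R)) * s" by (simp add: s_def)
  also have "\<dots> \<le> (2 * L + 2 * (4 * L\<^sup>2 * D * C / w)) * C"
    using pR pR0 LQ s by (intro mult_mono add_mono) auto
  also have "\<dots> = 2 * L * C + 8 * L\<^sup>2 * D * (C\<^sup>2 / w)" by (simp add: algebra_simps power2_eq_square)
  finally have 1: "(2 * LQ + 2 * p * R) / (1 - \<eta>) \<le> 2 * L * C + 8 * L\<^sup>2 * D * (C\<^sup>2 / w)" .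
  have "4 * L\<^sup>2 * D * C / w \<le> 4 * L\<^sup>2 * D * C\<^sup>2 / w"
    using CC D w by (intro divide_right_mono mult_left_mono) auto
  then have 2: "p * R \<le> 4 * L\<^sup>2 * D * (C\<^sup>2 / w)" using pR by simp
  have "((2 * LQ + 2 * p * R) / (1 - \<eta>) + p * R) * L
      \<le> (2 * L * C + 8 * L\<^sup>2 * D * (C\<^sup>2 / w) + 4 * L\<^sup>2 * D * (C\<^sup>2 / w)) * L"
    by (rule mult_right_mono[OF add_mono[OF 1 2] L])
  also have "\<dots> = 2 * (L\<^sup>2 * C) + 12 * (L\<^sup>2 * (L * D) * (C\<^sup>2 / w))" by (simp add: algebra_simps power2_eq_square)
  finally have 3: "((2 * LQ + 2 * p * R) / (1 - \<eta>) + p * R) * L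
      \<le> 2 * (L\<^sup>2 * C) + 12 * (L\<^sup>2 * (L * D) * (C\<^sup>2 / w))" .
  have "L\<^sup>2 / 2 \<le> L\<^sup>2 * C" using mult_left_mono[OF C1, of "L\<^sup>2"] zero_le_power2[of L] by linarith
  moreover have "0 \<le> L\<^sup>2 * C" "0 \<le> L\<^sup>2 * (C\<^sup>2 / w)" "0 \<le> L\<^sup>2 * (L * D) * C"
    using C1 L D w by auto
  ultimately show "L\<^sup>2 / 2 + ((2 * LQ + 2 * p * R) / (1 - \<eta>) + p * R) * L \<le> 12 * L\<^sup>2 * (1 + L * D) * (C + C\<^sup>2 / w)"
    using 3 by (simp add: algebra_simps)
qed

text \<open>The projection is nonexpansive and fixes the points of \<open>X\<close>; taking
  \<open>x\<close> as the fixed point bounds the move, taking \<open>y\<close> bounds the new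
  distance.\<close>

lemma norm_projected_step_le:
  fixes x y z :: "'a::euclidean_space"
  assumes X: "convex X" "closed X" "x \<in> X" "y \<in> X" and \<alpha>: "0 \<le> \<alpha>" and z: "norm z \<le> L"
  shows "norm (closest_point X (x - \<alpha> *\<^sub>R z) - x) \<le> \<alpha> * L"
    and "(norm (closest_point X (x - \<alpha> *\<^sub>R z) - y))\<^sup>2 \<le> (norm (x - y))\<^sup>2 - 2 * \<alpha> * (z \<bullet> (x - y)) + \<alpha>\<^sup>2 * L\<^sup>2"
proof -
  have X_ne: "X \<noteq> {}" using X by auto
  have lip: "norm (closest_point X (x - \<alpha> *\<^sub>R z) - v) \<le> norm (x - \<alpha> *\<^sub>R z - v)" if "v \<in> X" for v
    using closest_point_lipschitz[OF X(1,2) X_ne, of "x - \<alpha> *\<^sub>R z" v] closest_point_self[OF that]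
    by (simp add: dist_norm)
  have "norm (x - \<alpha> *\<^sub>R z - x) = \<alpha> * norm z" using \<alpha> by simp
  also have "\<dots> \<le> \<alpha> * L" using \<alpha> z by (rule mult_left_mono[rotated])
  finally show "norm (closest_point X (x - \<alpha> *\<^sub>R z) - x) \<le> \<alpha> * L" using lip[OF X(3)] by linarith
  have "(norm (closest_point X (x - \<alpha> *\<^sub>R z) - y))\<^sup>2 \<le> (norm (x - \<alpha> *\<^sub>R z - y))\<^sup>2"
    using lip[OF X(4)] by (intro power_mono) auto
  also have "\<dots> = (norm (x - y))\<^sup>2 - 2 * \<alpha> * (z \<bullet> (x - y)) + \<alpha>\<^sup>2 * (norm z)\<^sup>2"
    unfolding power2_norm_eq_inner by (simp add: algebra_simps inner_commute power2_eq_square)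
  also have "\<dots> \<le> (norm (x - y))\<^sup>2 - 2 * \<alpha> * (z \<bullet> (x - y)) + \<alpha>\<^sup>2 * L\<^sup>2"
    using z by (intro add_left_mono mult_left_mono power_mono) auto
  finally show "(norm (closest_point X (x - \<alpha> *\<^sub>R z) - y))\<^sup>2 \<le> (norm (x - y))\<^sup>2 - 2 * \<alpha> * (z \<bullet> (x - y)) + \<alpha>\<^sup>2 * L\<^sup>2" .
qed

text \<open>The linear program is abstracted away: \<open>Z\<close> enters through the subgradient
  inequality for \<open>f + q(., I)\<close>, a norm bound and joint measurability.\<close>

locale mh_subgradient_method = metropolis \<nu> "restrict_space borel X" q w LQ + M: prob_space M
  for \<nu> :: "'i measure" and X :: "'x::euclidean_space set" and q w LQ and M :: "'o measure" +
  fixes f :: "'x \<Rightarrow> real" and Z :: "'x \<Rightarrow> 'i \<Rightarrow> 'x" and D Lf \<eta> :: real and \<alpha> :: "nat \<Rightarrow> real"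
    and x0 :: 'x and xs :: "nat \<Rightarrow> 'o \<Rightarrow> 'x" and Is :: "nat \<Rightarrow> 'o \<Rightarrow> 'i"
  assumes X_ne: "X \<noteq> {}" and X_convex: "convex X" and X_compact: "compact X"
    and X_diam: "\<And>x y. x \<in> X \<Longrightarrow> y \<in> X \<Longrightarrow> dist x y \<le> D"
    and Lf: "0 \<le> Lf" and f_lip: "\<And>x y. x \<in> X \<Longrightarrow> y \<in> X \<Longrightarrow> \<bar>f x - f y\<bar> \<le> Lf * dist x y"
    and Z_subgrad: "\<And>x y I. x \<in> X \<Longrightarrow> y \<in> X \<Longrightarrow> I \<in> space \<nu> \<Longrightarrow> f x + q x I + Z x I \<bullet> (y - x) \<le> f y + q y I"
    and Z_norm: "\<And>x I. x \<in> X \<Longrightarrow> I \<in> space \<nu> \<Longrightarrow> norm (Z x I) \<le> Lf + LQ"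
    and Z_meas: "case_prod Z \<in> borel_measurable (restrict_space borel X \<Otimes>\<^sub>M \<nu>)"
    and \<eta>: "0 \<le> \<eta>" "\<eta> < 1"
    and mix: "\<And>x I J. x \<in> X \<Longrightarrow> I \<in> space \<nu> \<Longrightarrow> J \<in> space \<nu> \<Longrightarrow>
      tv_dist (mh_kernel \<nu> w q x I) (mh_kernel \<nu> w q x J) \<le> \<eta>"
    and \<alpha>_pos: "\<And>n. 0 < \<alpha> (Suc n)"
    and x0: "x0 \<in> X" and xs_0: "\<And>\<omega>. \<omega> \<in> space M \<Longrightarrow> xs 0 \<omega> = x0"
    and xs_Suc: "\<And>n \<omega>. \<omega> \<in> space M \<Longrightarrow>
      xs (Suc n) \<omega> = closest_point X (xs n \<omega> - \<alpha> (Suc n) *\<^sub>R Z (xs n \<omega>) (Is (Suc n) \<omega>))"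
    and Is_meas: "\<And>n. Is n \<in> M \<rightarrow>\<^sub>M \<nu>"
    and Is_cond: "\<And>n B. B \<in> sets \<nu> \<Longrightarrow> AE \<omega> in M.
      real_cond_exp M (past_algebra M \<nu> xs Is n) (\<lambda>\<omega>'. indicator B (Is (Suc n) \<omega>')) \<omega>
      = measure (mh_kernel \<nu> w q (xs n \<omega>) (Is n \<omega>)) B"
begin

abbreviation "A \<equiv> restrict_space borel X"
abbreviation "F \<equiv> smoothed_objective \<nu> w f q"
abbreviation "L \<equiv> Lf + LQ"

lemma space_A[simp]: "space A = X"
  by (simp add: space_restrict_space)

sublocale mixing_kernels A \<nu> P \<eta> "2 * LQ / w"
  using kernel_P mix tv_dist_P_lip \<eta> L w not_empty by unfold_locales auto

lemma X_closed: "closed X"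
  using X_compact by (rule compact_imp_closed)

lemma D_nonneg: "0 \<le> D"
  using X_diam[of x0 x0] x0 by simp

lemma xs_in_X: "\<omega> \<in> space M \<Longrightarrow> xs n \<omega> \<in> X"
  by (cases n) (simp_all add: xs_0 x0 xs_Suc closest_point_in_set[OF X_closed X_ne])

lemma Is_space: "\<omega> \<in> space M \<Longrightarrow> Is n \<omega> \<in> space \<nu>"
  by (rule measurable_space[OF Is_meas])

lemma xs_meas: "xs n \<in> M \<rightarrow>\<^sub>M A"
proof (induction n)
  case 0
  have "(\<lambda>_. x0) \<in> M \<rightarrow>\<^sub>M A" using x0 by simp
  then show ?case by (rule measurable_cong[THEN iffD1, rotated]) (simp add: xs_0)
next
  case (Suc n)
  have cp: "closest_point X \<in> borel \<rightarrow>\<^sub>M borel"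
    by (intro borel_measurable_continuous_onI continuous_on_closest_point X_convex X_closed X_ne)
  have [measurable]: "(\<lambda>\<omega>. Z (xs n \<omega>) (Is (Suc n) \<omega>)) \<in> M \<rightarrow>\<^sub>M borel"
    using measurable_compose[OF measurable_Pair[OF Suc Is_meas[of "Suc n"]] Z_meas] by simp
  have [measurable]: "xs n \<in> M \<rightarrow>\<^sub>M borel" using Suc by (rule measurable_restrict_space2_iff[THEN iffD1, THEN conjunct1])
  have "(\<lambda>\<omega>. closest_point X (xs n \<omega> - \<alpha> (Suc n) *\<^sub>R Z (xs n \<omega>) (Is (Suc n) \<omega>))) \<in> M \<rightarrow>\<^sub>M borel"
    by (rule measurable_compose[OF _ cp]) measurable
  then have "xs (Suc n) \<in> M \<rightarrow>\<^sub>M borel"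
    by (rule measurable_cong[THEN iffD1, rotated]) (simp add: xs_Suc)
  then show ?case by (intro measurable_restrict_space2) (auto intro: xs_in_X)
qed

lemma xs_borel: "xs n \<in> M \<rightarrow>\<^sub>M borel"
  using xs_meas by (rule measurable_restrict_space2_iff[THEN iffD1, THEN conjunct1])

lemma pair_meas:
  assumes "case_prod H \<in> borel_measurable (A \<Otimes>\<^sub>M \<nu>)"
  shows "(\<lambda>\<omega>. H (xs n \<omega>) (Is m \<omega>)) \<in> borel_measurable M"
  using measurable_compose[OF measurable_Pair[OF xs_meas Is_meas] assms] by simp

text \<open>The indicator of an event for \<open>xs n\<close> is measurable in the past and can be
  moved through the conditional expectation. This turns the hypothesis on the conditional law into
  the identity on rectangles that \<open>integral_next_state\<close> expects.\<close>

lemma integral_next: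
  assumes H: "case_prod H \<in> borel_measurable (A \<Otimes>\<^sub>M \<nu>)"
    and bnd: "\<And>x I. x \<in> X \<Longrightarrow> I \<in> space \<nu> \<Longrightarrow> \<bar>H x I\<bar> \<le> B"
  shows "(\<integral>\<omega>. H (xs n \<omega>) (Is (Suc n) \<omega>) \<partial>M) = (\<integral>\<omega>. step H (xs n \<omega>) (Is n \<omega>) \<partial>M)"
  unfolding step_def
proof (rule integral_next_state[OF M.prob_space_axioms xs_meas Is_meas Is_meas kernel_P _ H])
  fix a B assume a: "a \<in> sets A" and B[measurable]: "B \<in> sets \<nu>"
  let ?G = "past_algebra M \<nu> xs Is n"
  interpret G: finite_measure_subalgebra M ?G
    by unfold_locales (rule past_algebra_subalgebra[OF xs_borel Is_meas])
  have [measurable]: "Is (Suc n) \<in> M \<rightarrow>\<^sub>M \<nu>" by (rule Is_meas)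
  have "xs n \<in> ?G \<rightarrow>\<^sub>M A"
    using past_algebra_measurable[OF xs_borel Is_meas] xs_in_X G.subalg
    by (intro measurable_restrict_space2) (auto simp: subalgebra_def)
  with a have ia: "(\<lambda>\<omega>. indicat_real a (xs n \<omega>)) \<in> borel_measurable ?G" by measurable
  have ia_M[measurable]: "(\<lambda>\<omega>. indicat_real a (xs n \<omega>)) \<in> borel_measurable M" using a xs_meas[of n] by measurable
  have iB: "(\<lambda>\<omega>. indicat_real B (Is (Suc n) \<omega>)) \<in> borel_measurable M" by measurable
  have "integrable M (\<lambda>\<omega>. indicat_real a (xs n \<omega>) * indicat_real B (Is (Suc n) \<omega>))"
    by (rule M.integrable_const_bound[of _ 1 , OF _ borel_measurable_times[OF ia_M iB]]) (auto simp: indicator_def)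
  from G.real_cond_exp_intg(2)[OF this ia iB]
  have "(\<integral>\<omega>. indicat_real a (xs n \<omega>) * indicat_real B (Is (Suc n) \<omega>) \<partial>M)
      = (\<integral>\<omega>. indicat_real a (xs n \<omega>) * real_cond_exp M ?G (\<lambda>\<omega>'. indicat_real B (Is (Suc n) \<omega>')) \<omega> \<partial>M)"
    by simp
  also have "\<dots> = (\<integral>\<omega>. indicat_real a (xs n \<omega>) * measure (P (xs n \<omega>) (Is n \<omega>)) B \<partial>M)"
  proof (rule integral_cong_AE)
    have "(\<lambda>\<omega>. case_prod P (xs n \<omega>, Is n \<omega>)) \<in> M \<rightarrow>\<^sub>M prob_algebra \<nu>"
      by (rule measurable_compose[OF measurable_Pair[OF xs_meas Is_meas] kernel_P])
    from measurable_prob_algebraD[OF this]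
    have [measurable]: "(\<lambda>\<omega>. P (xs n \<omega>) (Is n \<omega>)) \<in> M \<rightarrow>\<^sub>M subprob_algebra \<nu>" by simp
    show "(\<lambda>\<omega>. indicat_real a (xs n \<omega>) * measure (P (xs n \<omega>) (Is n \<omega>)) B) \<in> borel_measurable M" by measurable
    show "AE \<omega> in M. indicat_real a (xs n \<omega>) * real_cond_exp M ?G (\<lambda>\<omega>'. indicat_real B (Is (Suc n) \<omega>')) \<omega>
        = indicat_real a (xs n \<omega>) * measure (P (xs n \<omega>) (Is n \<omega>)) B"
      using Is_cond[OF B, of n] by eventually_elim simp
  qed measurable
  finally show "(\<integral>\<omega>. indicat_real a (xs n \<omega>) * indicat_real B (Is (Suc n) \<omega>) \<partial>M)
      = (\<integral>\<omega>. indicat_real a (xs n \<omega>) * measure (P (xs n \<omega>) (Is n \<omega>)) B \<partial>M)" .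
qed (use bnd in auto)

section \<open>Regularity and convexity of the smoothed objective\<close>

lemma F_diff_le:
  assumes x: "x \<in> X" and y: "y \<in> X"
  shows "F x - F y \<le> (\<integral>I. exp (q x I / w) * ((f x + q x I) - (f y + q y I)) \<partial>\<nu>) / (\<integral>I. exp (q x I / w) \<partial>\<nu>)"
  using smoothed_objective_diff_le[of x y f] x y by simp

lemma psi_bound:
  assumes "x \<in> X" "y \<in> X" "I \<in> space \<nu>"
  shows "\<bar>(f x + q x I) - (f y + q y I)\<bar> \<le> L * dist x y"
  using f_lip[OF assms(1,2)] q_lip[of x y I] assms by (simp add: distrib_right abs_le_iff)

lemma psi_meas:
  assumes "x \<in> X" "y \<in> X"
  shows "(\<lambda>I. (f x + q x I) - (f y + q y I)) \<in> borel_measurable \<nu>"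
  using q_section[of x] q_section[of y] assms by simp

lemma psi_gibbs_integrable:
  assumes "x \<in> X" "x' \<in> X" "y \<in> X"
  shows "integrable \<nu> (\<lambda>I. exp (q x I / w) * ((f x' + q x' I) - (f y + q y I)))"
  by (rule integrable_gibbs[OF _ psi_meas[OF assms(2,3)] psi_bound[OF assms(2,3)]]) (use assms in auto)

lemma F_lip:
  assumes "x \<in> X" "y \<in> X"
  shows "\<bar>F x - F y\<bar> \<le> L * dist x y"
proof -
  have *: "F x - F y \<le> L * dist x y" if x: "x \<in> X" and y: "y \<in> X" for x y
  proof -
    have Zx: "0 < (\<integral>I. exp (q x I / w) \<partial>\<nu>)" using partition_pos[of x] x by simp
    have "(\<integral>I. exp (q x I / w) * ((f x + q x I) - (f y + q y I)) \<partial>\<nu>)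
        \<le> (\<integral>I. exp (q x I / w) * (L * dist x y) \<partial>\<nu>)"
      using psi_bound[OF x y] psi_gibbs_integrable[OF x x y] integrable_gibbs[of x "\<lambda>_. 1" 1] x
      by (intro integral_mono) (auto simp: abs_le_iff)
    then have "(\<integral>I. exp (q x I / w) * ((f x + q x I) - (f y + q y I)) \<partial>\<nu>) / (\<integral>I. exp (q x I / w) \<partial>\<nu>) \<le> L * dist x y"
      using Zx by (simp add: divide_le_eq mult.commute)
    with F_diff_le[OF x y] show ?thesis by linarith
  qed
  from *[OF assms] *[OF assms(2,1)] show ?thesis by (simp add: dist_commute abs_le_iff)
qed

lemma F_measurable: "F \<in> borel_measurable A"
proof (intro borel_measurable_continuous_on_restrict lipschitz_on_continuous_on[of L])
  show "L-lipschitz_on X F"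
    using F_lip Lf local.L by (auto simp: lipschitz_on_def dist_real_def)
qed

lemma F_bounded: "\<exists>B. \<forall>x\<in>X. \<bar>F x\<bar> \<le> B"
proof (rule exI[of _ "\<bar>F x0\<bar> + L * D"], rule ballI)
  fix x assume x: "x \<in> X"
  have "L * dist x x0 \<le> L * D" using X_diam[OF x x0] Lf local.L by (intro mult_left_mono) auto
  with F_lip[OF x x0] show "\<bar>F x\<bar> \<le> \<bar>F x0\<bar> + L * D" by (simp add: abs_le_iff; linarith)
qed

lemma F_integrable:
  assumes "g \<in> M \<rightarrow>\<^sub>M A"
  shows "integrable M (\<lambda>\<omega>. F (g \<omega>))"
proof -
  obtain B where "\<forall>x\<in>X. \<bar>F x\<bar> \<le> B" using F_bounded by auto
  then show ?thesis
    using measurable_space[OF assms] measurable_compose[OF assms F_measurable]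
    by (intro M.integrable_const_bound[of _ B]) auto
qed

text \<open>At the intermediate point \<open>z\<close>, both differences \<open>F z - F x\<close>
  and \<open>F z - F y\<close> are bounded by means under one and the same Gibbs measure, that of
  \<open>z\<close>. There the subgradient \<open>Z z I\<close> makes the convex combination
  nonpositive state by state, since the combination of \<open>x - z\<close> and \<open>y - z\<close>
  is 0.\<close>

lemma F_convex: "convex_on X F"
proof (rule convex_onI[OF _ X_convex])
  fix t :: real and x y assume t: "0 < t" "t < 1" and x: "x \<in> X" and y: "y \<in> X"
  define z where "z = (1 - t) *\<^sub>R x + t *\<^sub>R y"
  have z: "z \<in> X" unfolding z_def using convexD_alt[OF X_convex x y] t by simp
  define e where "e I = exp (q z I / w)" for I
  define \<phi> where "\<phi> v I = (f z + q z I) - (f v + q v I)" for v I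
  have Zz: "0 < (\<integral>I. e I \<partial>\<nu>)" unfolding e_def using partition_pos[of z] z by simp
  have int: "integrable \<nu> (\<lambda>I. e I * \<phi> v I)" if "v \<in> X" for v
    unfolding e_def \<phi>_def by (rule psi_gibbs_integrable[OF z z that])
  have le: "F z - F v \<le> (\<integral>I. e I * \<phi> v I \<partial>\<nu>) / (\<integral>I. e I \<partial>\<nu>)" if "v \<in> X" for v
    unfolding e_def \<phi>_def by (rule F_diff_le[OF z that])
  have "(1 - t) * (F z - F x) + t * (F z - F y)
      \<le> (1 - t) * ((\<integral>I. e I * \<phi> x I \<partial>\<nu>) / (\<integral>I. e I \<partial>\<nu>)) + t * ((\<integral>I. e I * \<phi> y I \<partial>\<nu>) / (\<integral>I. e I \<partial>\<nu>))"
    using le[OF x] le[OF y] t by (intro add_mono mult_left_mono) auto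
  also have "\<dots> = (\<integral>I. (1 - t) * (e I * \<phi> x I) + t * (e I * \<phi> y I) \<partial>\<nu>) / (\<integral>I. e I \<partial>\<nu>)"
    using int[OF x] int[OF y] by (simp add: add_divide_distrib)
  also have "\<dots> \<le> 0"
  proof (rule divide_nonpos_pos[OF _ Zz])
    have "(1 - t) * (e I * \<phi> x I) + t * (e I * \<phi> y I) \<le> 0" if I: "I \<in> space \<nu>" for I
    proof -
      have "(1 - t) * \<phi> x I + t * \<phi> y I \<le> (1 - t) * (- (Z z I \<bullet> (x - z))) + t * (- (Z z I \<bullet> (y - z)))"
        unfolding \<phi>_def using Z_subgrad[OF z x I] Z_subgrad[OF z y I] t
        by (intro add_mono mult_left_mono) auto
      also have "\<dots> = - (Z z I \<bullet> ((1 - t) *\<^sub>R (x - z) + t *\<^sub>R (y - z)))"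
        by (simp add: inner_add_right)
      also have "(1 - t) *\<^sub>R (x - z) + t *\<^sub>R (y - z) = 0" by (simp add: z_def algebra_simps)
      finally have "e I * ((1 - t) * \<phi> x I + t * \<phi> y I) \<le> 0"
        by (intro mult_nonneg_nonpos) (auto simp: e_def)
      then show ?thesis by (simp add: algebra_simps)
    qed
    then have "(\<integral>I. (1 - t) * (e I * \<phi> x I) + t * (e I * \<phi> y I) \<partial>\<nu>) \<le> (\<integral>I. 0 \<partial>\<nu>)"
      using int[OF x] int[OF y] by (intro integral_mono) auto
    then show "(\<integral>I. (1 - t) * (e I * \<phi> x I) + t * (e I * \<phi> y I) \<partial>\<nu>) \<le> 0" by simp
  qed
  finally show "F ((1 - t) *\<^sub>R x + t *\<^sub>R y) \<le> (1 - t) * F x + t * F y"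
    unfolding z_def[symmetric] by (simp add: algebra_simps)
qed

text \<open>The noise is \<open>\<psi>\<^sub>x - m x\<close> with \<open>\<psi>\<^sub>x = (f x + q x) - (f y + q y)\<close>: unlike \<open>Z\<^sub>x \<bullet> (x - y)\<close>, which
  dominates it, \<open>\<psi>\<^sub>x\<close> is Lipschitz in \<open>x\<close>.\<close>

lemma recursion_bound:
  assumes y: "y \<in> X" and C: "C = (1 + \<eta>) / (1 - \<eta>)"
  obtains d t where "\<And>k. \<bar>d k\<bar> \<le> D\<^sup>2" and "\<And>k. \<bar>t k\<bar> \<le> 2 * L * D * (C + C\<^sup>2 / w)"
    and "\<And>k. (\<integral>\<omega>. F (xs k \<omega>) \<partial>M) - F y \<le> (d k - d (Suc k)) / (2 * \<alpha> (Suc k)) + (t (Suc k) - t k)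
      + 12 * L\<^sup>2 * (1 + L * D) * (C + C\<^sup>2 / w) * \<alpha> (Suc k)"
proof -
  define p where "p = 2 * LQ / w"
  define R where "R = 2 * LQ * D / (1 - \<eta>)"
  define Kl where "Kl = (2 * LQ + 2 * p * R) / (1 - \<eta>) + p * R"
  have L0: "0 \<le> L" "0 \<le> LQ" "LQ \<le> L" using Lf local.L by auto
  note const = drift_constant_bound[OF L0(2,3) D_nonneg w \<eta> C, folded p_def R_def]
  define \<psi> where "\<psi> x I = (f x + q x I) - (f y + q y I)" for x I
  have f_meas: "f \<in> borel_measurable A"
    by (intro borel_measurable_continuous_on_restrict lipschitz_on_continuous_on[of Lf])
      (use f_lip Lf in \<open>auto simp: lipschitz_on_def dist_real_def\<close>)
  have \<psi>_meas: "case_prod \<psi> \<in> borel_measurable (A \<Otimes>\<^sub>M \<nu>)"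
  proof -
    note [measurable] = f_meas q_section[of y, unfolded space_A, OF y]
    have [measurable]: "(\<lambda>z. q (fst z) (snd z)) \<in> borel_measurable (A \<Otimes>\<^sub>M \<nu>)"
      using q_meas by (simp add: case_prod_beta')
    show ?thesis unfolding \<psi>_def case_prod_beta' by measurable
  qed
  \<comment> \<open>The terms in \<open>f\<close> do not depend on the state and cancel, so only
    \<open>LQ\<close> enters; the same happens in \<open>lip\<close>.\<close>
  have osc: "\<bar>\<psi> x I - \<psi> x J\<bar> \<le> 2 * LQ * D" if "x \<in> space A" "I \<in> space \<nu>" "J \<in> space \<nu>" for x I J
  proof -
    have "LQ * dist x y \<le> LQ * D" using X_diam[of x y] y that L0 by (intro mult_left_mono) auto
    then show ?thesis using q_lip[of x y I] q_lip[of x y J] that y unfolding \<psi>_def space_A by (auto simp: abs_le_iff)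
  qed
  have lip: "\<bar>(\<psi> x I - \<psi> x' I) - (\<psi> x J - \<psi> x' J)\<bar> \<le> 2 * LQ * dist x x'"
    if "x \<in> space A" "x' \<in> space A" "I \<in> space \<nu>" "J \<in> space \<nu>" for x x' I J
    using q_lip[of x x' I] q_lip[of x x' J] that unfolding \<psi>_def by (auto simp: abs_le_iff)
  obtain u m where u_meas: "case_prod u \<in> borel_measurable (A \<Otimes>\<^sub>M \<nu>)"
    and poisson: "\<And>x I. x \<in> space A \<Longrightarrow> I \<in> space \<nu> \<Longrightarrow> u x I - step u x I = \<psi> x I - m x"
    and u_bnd: "\<And>x I. x \<in> space A \<Longrightarrow> I \<in> space \<nu> \<Longrightarrow> \<bar>u x I\<bar> \<le> R"
    and v_bnd: "\<And>x I. x \<in> space A \<Longrightarrow> I \<in> space \<nu> \<Longrightarrow> \<bar>step u x I\<bar> \<le> R"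
    and v_lip: "\<And>x x' I. x \<in> space A \<Longrightarrow> x' \<in> space A \<Longrightarrow> I \<in> space \<nu> \<Longrightarrow> \<bar>step u x I - step u x' I\<bar> \<le> Kl * dist x x'"
    unfolding R_def Kl_def p_def
  proof (rule poisson_solution[where \<psi>=\<psi> and R="2 * LQ * D" and \<rho>="2 * LQ", OF \<psi>_meas], goal_cases)
    case (1 x I J)
    then show ?case by (intro osc)
  next
    case (2 x x' I J)
    then show ?case by (intro lip)
  next
    case (3 u m)
    show ?case by (rule 3(1)[OF 3(2-)])
  qed
  note v_meas = step_measurable[OF u_meas]
  \<comment> \<open>Integrating the Poisson equation against the Gibbs weights removes
    \<open>u - step u\<close> by invariance and identifies \<open>m x\<close> as the Gibbs mean of
    \<open>\<psi> x\<close>.\<close>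
  have m_eq: "F x - F y \<le> m x" if x: "x \<in> X" for x
  proof -
    define e where "e I = exp (q x I / w)" for I
    have Zx: "0 < (\<integral>I. e I \<partial>\<nu>)" unfolding e_def using partition_pos[of x] x by simp
    have x': "x \<in> space A" using x by simp
    have int: "integrable \<nu> (\<lambda>I. e I * u x I)" "integrable \<nu> (\<lambda>I. e I * step u x I)" "integrable \<nu> (\<lambda>I. e I)"
      unfolding e_def
      using integrable_gibbs[OF x' section_measurable[OF u_meas x'] u_bnd[OF x']]
        integrable_gibbs[OF x' section_measurable[OF v_meas x'] v_bnd[OF x']] integrable_gibbs[OF x', of "\<lambda>_. 1" 1]
      by simp_all
    have inv: "(\<integral>I. e I * step u x I \<partial>\<nu>) = (\<integral>I. e I * u x I \<partial>\<nu>)"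
      unfolding e_def step_def by (rule gibbs_invariant[OF x' section_measurable[OF u_meas x'] u_bnd[OF x']])
    have "(\<integral>I. e I * \<psi> x I \<partial>\<nu>) = (\<integral>I. m x * e I + (e I * u x I - e I * step u x I) \<partial>\<nu>)"
    proof (intro Bochner_Integration.integral_cong refl)
      fix I assume "I \<in> space \<nu>"
      then have "\<psi> x I = m x + (u x I - step u x I)" using poisson[OF x'] by simp
      then show "e I * \<psi> x I = m x * e I + (e I * u x I - e I * step u x I)"
        by (simp only:) (simp add: algebra_simps)
    qed
    also have "\<dots> = m x * (\<integral>I. e I \<partial>\<nu>)" using int inv by simp
    finally have "(\<integral>I. e I * \<psi> x I \<partial>\<nu>) / (\<integral>I. e I \<partial>\<nu>) = m x" using Zx by simp
    then show ?thesis using F_diff_le[OF x y] unfolding e_def \<psi>_def by simp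
  qed
  define d where "d k = (\<integral>\<omega>. (norm (xs k \<omega> - y))\<^sup>2 \<partial>M)" for k
  define t where "t k = (\<integral>\<omega>. step u (xs k \<omega>) (Is k \<omega>) \<partial>M)" for k
  have dist_bnd: "(norm (xs k \<omega> - y))\<^sup>2 \<le> D\<^sup>2" if "\<omega> \<in> space M" for k \<omega>
    using X_diam[OF xs_in_X[OF that] y] by (intro power_mono) (auto simp: dist_norm)
  have int_d: "integrable M (\<lambda>\<omega>. (norm (xs k \<omega> - y))\<^sup>2)" for k
    by (rule M.integrable_const_bound[of _ "D\<^sup>2"]) (use dist_bnd xs_borel[of k] in auto)
  have int_v: "integrable M (\<lambda>\<omega>. step u (xs k \<omega>) (Is l \<omega>))" for k l
    by (rule M.integrable_const_bound[where B=R, OF _ pair_meas[OF v_meas]])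
      (use v_bnd xs_in_X Is_space in auto)
  have int_u: "integrable M (\<lambda>\<omega>. u (xs k \<omega>) (Is l \<omega>))" for k l
    by (rule M.integrable_const_bound[where B=R, OF _ pair_meas[OF u_meas]])
      (use u_bnd xs_in_X Is_space in auto)
  have d_bnd: "\<bar>d k\<bar> \<le> D\<^sup>2" for k
  proof -
    have "d k \<le> (\<integral>\<omega>. D\<^sup>2 \<partial>M)" unfolding d_def using dist_bnd int_d by (intro integral_mono) auto
    moreover have "0 \<le> d k" unfolding d_def by (intro integral_nonneg_AE) auto
    ultimately show ?thesis by (simp add: M.prob_space)
  qed
  have t_bnd: "\<bar>t k\<bar> \<le> 2 * L * D * (C + C\<^sup>2 / w)" for k
  proof -
    have "\<bar>t k\<bar> \<le> (\<integral>\<omega>. \<bar>step u (xs k \<omega>) (Is k \<omega>)\<bar> \<partial>M)" unfolding t_def by (rule integral_abs_bound)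
    also have "\<dots> \<le> (\<integral>\<omega>. R \<partial>M)"
      using v_bnd xs_in_X Is_space int_v by (intro integral_mono integrable_abs) auto
    finally show ?thesis using const(2) by (simp add: M.prob_space)
  qed
  have rec: "(\<integral>\<omega>. F (xs k \<omega>) \<partial>M) - F y \<le> (d k - d (Suc k)) / (2 * \<alpha> (Suc k)) + (t (Suc k) - t k)
      + 12 * L\<^sup>2 * (1 + L * D) * (C + C\<^sup>2 / w) * \<alpha> (Suc k)" for k
  proof -
    define a where "a = \<alpha> (Suc k)"
    have a: "0 < a" unfolding a_def by (rule \<alpha>_pos)
    define B where "B = (L\<^sup>2 / 2 + Kl * L) * a"
    have Kl: "0 \<le> Kl"
      unfolding Kl_def p_def R_def using L0 w \<eta> D_nonneg by (intro add_nonneg_nonneg divide_nonneg_nonneg mult_nonneg_nonneg) auto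
    \<comment> \<open>The Poisson equation is used at the old iterate and the new state. Replacing
      \<open>step u\<close> at the old iterate by its value at the new one costs the drift
      \<open>Kl * L * a\<close> and creates the term whose expectation is
      \<open>t (Suc k)\<close>.\<close>
    have pointwise: "F (xs k \<omega>) - F y \<le> ((norm (xs k \<omega> - y))\<^sup>2 - (norm (xs (Suc k) \<omega> - y))\<^sup>2) / (2 * a)
        + (step u (xs (Suc k) \<omega>) (Is (Suc k) \<omega>) - u (xs k \<omega>) (Is (Suc k) \<omega>)) + B" if \<omega>: "\<omega> \<in> space M" for \<omega>
    proof -
      define x where "x = xs k \<omega>"
      define x' where "x' = xs (Suc k) \<omega>"
      define I where "I = Is (Suc k) \<omega>"
      have x: "x \<in> X" "x' \<in> X" and I: "I \<in> space \<nu>"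
        unfolding x_def x'_def I_def using xs_in_X Is_space \<omega> by auto
      have x'_eq: "x' = closest_point X (x - a *\<^sub>R Z x I)"
        unfolding x'_def x_def I_def a_def by (rule xs_Suc[OF \<omega>])
      note proj = norm_projected_step_le[OF X_convex X_closed x(1) y less_imp_le[OF a] Z_norm[OF x(1) I], folded x'_eq]
      have "\<psi> x I \<le> Z x I \<bullet> (x - y)"
        using Z_subgrad[OF x(1) y I] by (simp add: \<psi>_def inner_diff_right)
      also have "\<dots> \<le> ((norm (x - y))\<^sup>2 - (norm (x' - y))\<^sup>2) / (2 * a) + L\<^sup>2 / 2 * a"
        using proj(2) a by (simp add: field_simps power2_eq_square)
      finally have 1: "\<psi> x I \<le> ((norm (x - y))\<^sup>2 - (norm (x' - y))\<^sup>2) / (2 * a) + L\<^sup>2 / 2 * a" .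
      have "step u x I - step u x' I \<le> Kl * dist x x'" using v_lip[of x x' I] x I by (simp add: abs_le_iff)
      also have "\<dots> \<le> Kl * (a * L)"
        using proj(1) Kl by (intro mult_left_mono) (auto simp: dist_norm norm_minus_commute)
      finally have 2: "step u x I \<le> step u x' I + Kl * L * a" by (simp add: algebra_simps)
      have "F x - F y \<le> \<psi> x I - u x I + step u x I"
        using m_eq[OF x(1)] poisson[of x I] x I by simp
      then show ?thesis
        using 1 2 unfolding B_def x_def[symmetric] x'_def[symmetric] I_def[symmetric] by (simp add: algebra_simps)
    qed
    have F_eq: "(\<integral>\<omega>. F (xs k \<omega>) - F y \<partial>M) = (\<integral>\<omega>. F (xs k \<omega>) \<partial>M) - F y"
      using F_integrable[OF xs_meas] by (simp add: M.prob_space)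
    have "(\<integral>\<omega>. F (xs k \<omega>) - F y \<partial>M) \<le> (\<integral>\<omega>. ((norm (xs k \<omega> - y))\<^sup>2 - (norm (xs (Suc k) \<omega> - y))\<^sup>2) / (2 * a)
        + (step u (xs (Suc k) \<omega>) (Is (Suc k) \<omega>) - u (xs k \<omega>) (Is (Suc k) \<omega>)) + B \<partial>M)"
      using pointwise F_integrable[OF xs_meas] int_d int_u int_v by (intro integral_mono) auto
    also have "\<dots> = (d k - d (Suc k)) / (2 * a) + (t (Suc k) - (\<integral>\<omega>. u (xs k \<omega>) (Is (Suc k) \<omega>) \<partial>M)) + B"
      unfolding d_def t_def using int_d int_u int_v by (simp add: M.prob_space)
    \<comment> \<open>Conditioning on the past applies the kernel of \<open>xs k\<close> to
      \<open>u\<close> at \<open>Is k\<close>, which closes the telescope.\<close>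
    also have "(\<integral>\<omega>. u (xs k \<omega>) (Is (Suc k) \<omega>) \<partial>M) = t k"
      unfolding t_def by (rule integral_next[OF u_meas, of R]) (use u_bnd in simp)
    finally have "(\<integral>\<omega>. F (xs k \<omega>) \<partial>M) - F y \<le> (d k - d (Suc k)) / (2 * a) + (t (Suc k) - t k) + B"
      unfolding F_eq .
    moreover have "B \<le> 12 * L\<^sup>2 * (1 + L * D) * (C + C\<^sup>2 / w) * a"
      unfolding B_def using const(1) a by (intro mult_right_mono) (auto simp: Kl_def)
    ultimately show ?thesis unfolding a_def by linarith
  qed
  show thesis by (rule that[OF d_bnd t_bnd rec])
qed

section \<open>Averaged iterates and the two rates\<close>

lemma
  assumes c: "\<And>k. 1 \<le> k \<Longrightarrow> 0 < c k" and n: "1 \<le> n"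
  shows weighted_average_meas: "(\<lambda>\<omega>. weighted_average c (\<lambda>k. xs k \<omega>) n) \<in> M \<rightarrow>\<^sub>M A"
    and F_weighted_average_le: "y \<in> X \<Longrightarrow> (\<integral>\<omega>. F (weighted_average c (\<lambda>k. xs k \<omega>) n) \<partial>M) - F y
      \<le> (\<Sum>k=1..n. c k * ((\<integral>\<omega>. F (xs k \<omega>) \<partial>M) - F y)) / (\<Sum>k=1..n. c k)"
proof -
  define S where "S = (\<Sum>k=1..n. c k)"
  have S: "0 < S" unfolding S_def using c n by (intro sum_pos) auto
  have S1: "(\<Sum>k=1..n. c k / S) = 1" using S by (simp add: S_def flip: sum_divide_distrib)
  have wa: "weighted_average c (\<lambda>k. xs k \<omega>) n = (\<Sum>k=1..n. (c k / S) *\<^sub>R xs k \<omega>)" for \<omega>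
    unfolding weighted_average_def S_def[symmetric] by (simp add: scaleR_sum_right divide_inverse mult.commute)
  have in_X: "weighted_average c (\<lambda>k. xs k \<omega>) n \<in> X" if "\<omega> \<in> space M" for \<omega>
    unfolding wa using S1 c S xs_in_X[OF that] by (intro convex_sum X_convex) (auto intro!: divide_nonneg_nonneg less_imp_le)
  note [measurable] = xs_borel
  show meas: "(\<lambda>\<omega>. weighted_average c (\<lambda>k. xs k \<omega>) n) \<in> M \<rightarrow>\<^sub>M A"
    by (intro measurable_restrict_space2) (use in_X in auto, unfold wa, measurable)
  assume "y \<in> X"
  \<comment> \<open>Convexity of \<open>F\<close> is applied pointwise under the
    expectation.\<close>
  have "(\<integral>\<omega>. F (weighted_average c (\<lambda>k. xs k \<omega>) n) \<partial>M) \<le> (\<integral>\<omega>. (\<Sum>k=1..n. c k / S * F (xs k \<omega>)) \<partial>M)"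
  proof (rule integral_mono[OF F_integrable[OF meas]])
    show "integrable M (\<lambda>\<omega>. \<Sum>k=1..n. c k / S * F (xs k \<omega>))"
      using F_integrable[OF xs_meas] by (intro Bochner_Integration.integrable_sum integrable_mult_right) auto
    show "F (weighted_average c (\<lambda>k. xs k \<omega>) n) \<le> (\<Sum>k=1..n. c k / S * F (xs k \<omega>))" if "\<omega> \<in> space M" for \<omega>
      unfolding wa using S1 c S n xs_in_X[OF that]
      by (intro convex_on_sum[OF _ _ F_convex]) (auto intro!: divide_nonneg_nonneg less_imp_le)
  qed
  also have "\<dots> = (\<Sum>k=1..n. c k / S * (\<integral>\<omega>. F (xs k \<omega>) \<partial>M))"
    using F_integrable[OF xs_meas] by (subst Bochner_Integration.integral_sum) auto
  also have "\<dots> - F y = (\<Sum>k=1..n. c k / S * (\<integral>\<omega>. F (xs k \<omega>) \<partial>M)) - (\<Sum>k=1..n. c k / S) * F y"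
    using S1 by simp
  also have "\<dots> = (\<Sum>k=1..n. c k / S * ((\<integral>\<omega>. F (xs k \<omega>) \<partial>M) - F y))"
    by (simp add: sum_distrib_right sum_subtractf right_diff_distrib)
  also have "\<dots> = (\<Sum>k=1..n. c k * ((\<integral>\<omega>. F (xs k \<omega>) \<partial>M) - F y)) / S"
    by (simp add: sum_divide_distrib)
  finally show "(\<integral>\<omega>. F (weighted_average c (\<lambda>k. xs k \<omega>) n) \<partial>M) - F y
      \<le> (\<Sum>k=1..n. c k * ((\<integral>\<omega>. F (xs k \<omega>) \<partial>M) - F y)) / (\<Sum>k=1..n. c k)"
    unfolding S_def by simp
qed

text \<open>A bound \<open>r\<close> uniform in the comparison point passes to the infimum. The
  absolute value is harmless because \<open>g\<close> takes values in \<open>X\<close>, so the gap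
  is nonnegative.\<close>

lemma suboptimality_gap:
  assumes g: "g \<in> M \<rightarrow>\<^sub>M A" and le: "\<And>y. y \<in> X \<Longrightarrow> (\<integral>\<omega>. F (g \<omega>) \<partial>M) - F y \<le> r"
  shows "\<bar>(\<integral>\<omega>. F (g \<omega>) \<partial>M) - (INF x\<in>X. F x)\<bar> \<le> r"
proof -
  obtain B where B: "\<forall>x\<in>X. \<bar>F x\<bar> \<le> B" using F_bounded by auto
  have bdd: "bdd_below (F ` X)" by (rule bdd_belowI2[of _ "- B"]) (use B in \<open>force simp: abs_le_iff\<close>)
  have "(\<integral>\<omega>. (INF x\<in>X. F x) \<partial>M) \<le> (\<integral>\<omega>. F (g \<omega>) \<partial>M)"
    using F_integrable[OF g] measurable_space[OF g]
    by (intro integral_mono) (auto intro!: cINF_lower[OF bdd])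
  then have "(INF x\<in>X. F x) \<le> (\<integral>\<omega>. F (g \<omega>) \<partial>M)" by (simp add: M.prob_space)
  moreover have "(\<integral>\<omega>. F (g \<omega>) \<partial>M) - r \<le> (INF x\<in>X. F x)"
    by (rule cINF_greatest[OF X_ne]) (use le in force)
  ultimately show ?thesis by linarith
qed

lemma
  assumes \<alpha>0: "0 < \<alpha>0" and \<alpha>: "\<alpha> = (\<lambda>n. \<alpha>0 / sqrt (real n))" and C: "C = (1 + \<eta>) / (1 - \<eta>)"
  shows step_size_average_rate: "2 \<le> n \<Longrightarrow>
      \<bar>(\<integral>\<omega>. F (weighted_average \<alpha> (\<lambda>k. xs k \<omega>) n) \<partial>M) - (INF x\<in>X. F x)\<bar>
      \<le> rate_const D Lf LQ \<alpha>0 * ((C + C\<^sup>2 / w) * (ln (real n) / sqrt (real n)))"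
    and linear_average_rate: "1 \<le> n \<Longrightarrow>
      \<bar>(\<integral>\<omega>. F (weighted_average real (\<lambda>k. xs k \<omega>) n) \<partial>M) - (INF x\<in>X. F x)\<bar>
      \<le> rate_const D Lf LQ \<alpha>0 * ((C + C\<^sup>2 / w) * (1 / sqrt (real n)))"
proof -
  define Q where "Q = C + C\<^sup>2 / w"
  have L0: "0 \<le> L" "0 \<le> LQ" "LQ \<le> L" using Lf local.L by auto
  have Q: "1 \<le> Q" unfolding Q_def using drift_constant_bound(3)[OF L0(2,3) D_nonneg w \<eta> C] .
  define a b c where "a = D\<^sup>2 / \<alpha>0" and "b = L * D" and "c = L\<^sup>2 * (1 + L * D) * \<alpha>0"
  have abc: "0 \<le> a" "0 \<le> b" "0 \<le> c"
    unfolding a_def b_def c_def using L0 D_nonneg \<alpha>0 by auto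
  \<comment> \<open>The distance term \<open>D\<^sup>2 / \<alpha>0\<close> carries no mixing
    constant; \<open>1 \<le> Q\<close> brings it under the common factor.\<close>
  have aQ: "a \<le> a * Q" using mult_left_mono[OF Q abc(1)] by simp
  have bcQ: "0 \<le> a * Q" "0 \<le> b * Q" "0 \<le> c * Q" using abc Q by auto
  have rate: "rate_const D Lf LQ \<alpha>0 = 1000 * (a + b + c)"
    unfolding rate_const_def Let_def a_def b_def c_def ..
  have eq: "2 * D\<^sup>2 / \<alpha>0 = 2 * a" "12 * L\<^sup>2 * (1 + L * D) * Q * \<alpha>0 = 12 * (c * Q)" "2 * L * D * Q = 2 * (b * Q)"
    unfolding a_def b_def c_def by (simp_all add: algebra_simps)
  have Mc: "0 \<le> 12 * L\<^sup>2 * (1 + L * D) * Q" using L0 D_nonneg Q by auto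
  have \<alpha>': "0 < \<alpha> k" if "1 \<le> k" for k using that \<alpha>0 by (simp add: \<alpha>)
  {
    assume n: "2 \<le> n"
    \<comment> \<open>This absorbs the terms without logarithm into the logarithmic rate, and it is
      where \<open>n = 1\<close> fails. The resulting coefficients of \<open>a * Q\<close>,
      \<open>b * Q\<close> and \<open>c * Q\<close> are at most 30, well below 1000.\<close>
    have ln_n: "2 / 3 \<le> ln (real n)"
    proof -
      have "ln 2 \<le> ln (real n)" using n by simp
      then show ?thesis using ln2_ge_two_thirds by linarith
    qed
    show "\<bar>(\<integral>\<omega>. F (weighted_average \<alpha> (\<lambda>k. xs k \<omega>) n) \<partial>M) - (INF x\<in>X. F x)\<bar>
      \<le> rate_const D Lf LQ \<alpha>0 * ((C + C\<^sup>2 / w) * (ln (real n) / sqrt (real n)))"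
    proof (rule suboptimality_gap[OF weighted_average_meas])
      fix y assume y: "y \<in> X"
      obtain d t where dt: "\<And>k. \<bar>d k\<bar> \<le> D\<^sup>2" "\<And>k. \<bar>t k\<bar> \<le> 2 * L * D * Q"
        "\<And>k. (\<integral>\<omega>. F (xs k \<omega>) \<partial>M) - F y \<le> (d k - d (Suc k)) / (2 * \<alpha> (Suc k)) + (t (Suc k) - t k)
          + 12 * L\<^sup>2 * (1 + L * D) * Q * \<alpha> (Suc k)"
        unfolding Q_def
      proof (rule recursion_bound[OF y C], goal_cases)
        case (1 d t)
        show ?case by (rule 1(1)[OF 1(2-)])
      qed
      have n1: "1 \<le> n" using n by simp
      note F_weighted_average_le[OF \<alpha>' n1 y]
      also note step_size_rates(1)[OF \<alpha>0 Mc n1 \<alpha> dt]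
      also have "(2 * D\<^sup>2 / \<alpha>0 + 2 * (2 * L * D * Q) + 12 * L\<^sup>2 * (1 + L * D) * Q * \<alpha>0 * (1 + ln (real n))) / sqrt (real n)
          \<le> (1000 * (a + b + c) * (Q * ln (real n))) / sqrt (real n)"
      proof (rule divide_right_mono)
        have 1: "a * Q * (2 / 3) \<le> a * Q * ln (real n)" "b * Q * (2 / 3) \<le> b * Q * ln (real n)" "c * Q * (2 / 3) \<le> c * Q * ln (real n)"
          by (rule mult_left_mono[OF ln_n bcQ(1)] mult_left_mono[OF ln_n bcQ(2)] mult_left_mono[OF ln_n bcQ(3)])+
        then have "2 * a + 2 * (2 * (b * Q)) + 12 * (c * Q) + 12 * (c * Q * ln (real n))
            \<le> 1000 * (a * Q * ln (real n)) + 1000 * (b * Q * ln (real n)) + 1000 * (c * Q * ln (real n))"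
          using aQ bcQ by linarith
        then show "2 * D\<^sup>2 / \<alpha>0 + 2 * (2 * L * D * Q) + 12 * L\<^sup>2 * (1 + L * D) * Q * \<alpha>0 * (1 + ln (real n))
            \<le> 1000 * (a + b + c) * (Q * ln (real n))"
          unfolding eq by (simp add: algebra_simps)
      qed simp
      finally show "(\<integral>\<omega>. F (weighted_average \<alpha> (\<lambda>k. xs k \<omega>) n) \<partial>M) - F y
          \<le> rate_const D Lf LQ \<alpha>0 * ((C + C\<^sup>2 / w) * (ln (real n) / sqrt (real n)))"
        unfolding rate Q_def by simp
    qed (use \<alpha>' n in auto)
  next
    assume n: "1 \<le> n"
    show "\<bar>(\<integral>\<omega>. F (weighted_average real (\<lambda>k. xs k \<omega>) n) \<partial>M) - (INF x\<in>X. F x)\<bar>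
      \<le> rate_const D Lf LQ \<alpha>0 * ((C + C\<^sup>2 / w) * (1 / sqrt (real n)))"
    proof (rule suboptimality_gap[OF weighted_average_meas])
      fix y assume y: "y \<in> X"
      obtain d t where dt: "\<And>k. \<bar>d k\<bar> \<le> D\<^sup>2" "\<And>k. \<bar>t k\<bar> \<le> 2 * L * D * Q"
        "\<And>k. (\<integral>\<omega>. F (xs k \<omega>) \<partial>M) - F y \<le> (d k - d (Suc k)) / (2 * \<alpha> (Suc k)) + (t (Suc k) - t k)
          + 12 * L\<^sup>2 * (1 + L * D) * Q * \<alpha> (Suc k)"
        unfolding Q_def
      proof (rule recursion_bound[OF y C], goal_cases)
        case (1 d t)
        show ?case by (rule 1(1)[OF 1(2-)])
      qed
      have pos: "0 < real k" if "1 \<le> k" for k :: nat using that by simp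
      note F_weighted_average_le[where c=real, OF pos n y]
      also note step_size_rates(2)[OF \<alpha>0 Mc n \<alpha> dt]
      also have "(2 * D\<^sup>2 / \<alpha>0 + 4 * (2 * L * D * Q) + 2 * (12 * L\<^sup>2 * (1 + L * D) * Q) * \<alpha>0) / sqrt (real n)
          \<le> (1000 * (a + b + c) * Q) / sqrt (real n)"
      proof (rule divide_right_mono)
        have "2 * a + 4 * (2 * (b * Q)) + 2 * (12 * (c * Q)) \<le> 1000 * (a * Q) + 1000 * (b * Q) + 1000 * (c * Q)"
          using aQ bcQ by linarith
        then show "2 * D\<^sup>2 / \<alpha>0 + 4 * (2 * L * D * Q) + 2 * (12 * L\<^sup>2 * (1 + L * D) * Q) * \<alpha>0 \<le> 1000 * (a + b + c) * Q"
          using eq by (simp add: algebra_simps)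
      qed simp
      finally show "(\<integral>\<omega>. F (weighted_average real (\<lambda>k. xs k \<omega>) n) \<partial>M) - F y
          \<le> rate_const D Lf LQ \<alpha>0 * ((C + C\<^sup>2 / w) * (1 / sqrt (real n)))"
        unfolding rate Q_def by simp
    qed (use n in auto)
  }
qed

end

section \<open>From the recourse problem to the abstract method\<close>

lemma norm_subgradient_le:
  assumes N: "open N" "x \<in> N" and f: "Lf-lipschitz_on N f" and g: "g \<in> subdifferential N f x"
  shows "norm g \<le> Lf"
proof (cases "g = 0")
  case True
  then show ?thesis using lipschitz_on_nonneg[OF f] by simp
next
  case False
  obtain e where e: "0 < e" "cball x e \<subseteq> N" using N by (auto simp: open_contains_cball)
  \<comment> \<open>The test point lies at distance \<open>e\<close> from \<open>x\<close> in the
    direction of \<open>g\<close> itself, where the linear minorant grows fastest.\<close>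
  define s where "s = e / norm g"
  have s: "0 < s" using e False by (simp add: s_def)
  have y: "x + s *\<^sub>R g \<in> N" using e False by (intro subsetD[OF e(2)]) (simp add: s_def dist_norm)
  have "f x + g \<bullet> (s *\<^sub>R g) \<le> f (x + s *\<^sub>R g)"
    using g y unfolding subdifferential_def by force
  moreover have "f (x + s *\<^sub>R g) - f x \<le> Lf * (s * norm g)"
    using lipschitz_onD[OF f y N(2)] s by (simp add: dist_norm dist_real_def abs_le_iff)
  ultimately have "s * (norm g * norm g) \<le> s * (Lf * norm g)"
    by (simp add: mult_ac flip: power2_norm_eq_inner power2_eq_square)
  then show ?thesis using s False by simp
qed

theorem theorem4:
  fixes X N :: "(real ^ 'n::finite) set" and D Lf LQ LP w \<eta> \<alpha>0 C :: real
    and f :: "real ^ 'n \<Rightarrow> real" and g :: "real ^ 'n \<Rightarrow> real ^ 'n"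
    and G :: "real ^ 'y::finite ^ 'c::finite" and E :: "real ^ 'n ^ 'c" and U :: "real ^ 'k::finite ^ 'c"
    and b :: "real ^ 'y" and h :: "real ^ 'c"
    and \<Xi> :: "(real ^ 'k) set" and S :: "'i::topological_space set" and \<xi> :: "'i \<Rightarrow> real ^ 'k"
    and \<nu> :: "'i measure" and q :: "real ^ 'n \<Rightarrow> 'i \<Rightarrow> real"
    and \<pi> :: "real ^ 'n \<Rightarrow> 'i \<Rightarrow> real ^ 'c" and Z :: "real ^ 'n \<Rightarrow> 'i \<Rightarrow> real ^ 'n"
    and F :: "real ^ 'n \<Rightarrow> real" and P :: "real ^ 'n \<Rightarrow> 'i \<Rightarrow> 'i measure"
    and \<alpha> :: "nat \<Rightarrow> real" and M :: "'o measure" and x0 :: "real ^ 'n"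
    and xs :: "nat \<Rightarrow> 'o \<Rightarrow> real ^ 'n" and Is :: "nat \<Rightarrow> 'o \<Rightarrow> 'i"
  \<comment> \<open>feasible set and first-stage cost\<close>
  assumes "X \<noteq> {}" and "compact X" and "convex X"
    and "\<forall>x\<in>X. \<forall>x'\<in>X. norm1 (x - x') \<le> D"
    and "open N" and "X \<subseteq> N" and "convex_on N f" and "Lf-lipschitz_on N f"
  \<comment> \<open>recourse problem\<close>
    and "\<forall>x\<in>X. \<forall>\<zeta>\<in>\<Xi>. recourse_finite G E U b h x \<zeta>"
  \<comment> \<open>state space, scores, smoothed objective\<close>
    and "\<xi> \<in> restrict_space borel S \<rightarrow>\<^sub>M borel" and "\<forall>I\<in>S. \<xi> I \<in> \<Xi>"
    and q: "q = (\<lambda>x I. recourse_cost G E U b h x (\<xi> I))"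
    and "\<forall>x\<in>X. (SUP I\<in>S. ereal (q x I)) = (SUP \<zeta>\<in>\<Xi>. ereal (recourse_cost G E U b h x \<zeta>))"
    and "\<forall>x\<in>X. bounded (q x ` S)"
    and "\<forall>x\<in>X. q x \<in> borel_measurable (restrict_space borel S)"
    and "prob_space \<nu>" and "sets \<nu> = sets (restrict_space borel S)"
    and "\<forall>V. open V \<and> V \<inter> S \<noteq> {} \<longrightarrow> 0 < measure \<nu> (V \<inter> S)"
    and "0 < w" and F: "F = smoothed_objective \<nu> w f q"
  \<comment> \<open>dual selection and stochastic subgradients\<close>
    and "\<forall>x\<in>X. \<forall>I\<in>S. is_arg_min (\<lambda>p. norm1 (transpose E *v p))
           (dual_maximizer G E U b h x (\<xi> I)) (\<pi> x I)"
    and "case_prod \<pi> \<in> borel_measurable (restrict_space borel X \<Otimes>\<^sub>M restrict_space borel S)"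
    and "0 < LQ" and "\<forall>I\<in>S. LQ-lipschitz_on X (\<lambda>x. q x I)"
    and "\<forall>x\<in>X. \<forall>I\<in>S. norm (transpose E *v \<pi> x I) \<le> LQ"
    and "\<forall>x\<in>X. g x \<in> subdifferential N f x" and "g \<in> borel_measurable (restrict_space borel X)"
    and Z: "Z = (\<lambda>x I. g x - transpose E *v \<pi> x I)"
  \<comment> \<open>Markov kernel and its conditions\<close>
    and P: "P = mh_kernel \<nu> w q"
    and "\<forall>x\<in>X. \<forall>y\<in>X. (SUP I\<in>S. tv_dist (P x I) (P y I)) \<le> LP * norm (x - y)"
    and "0 \<le> \<eta>" and "\<eta> < 1"
    and "\<forall>x\<in>X. (SUP (I, J)\<in>S \<times> S. tv_dist (P x I) (P x J)) \<le> \<eta>"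
    and C: "C = (1 + \<eta>) / (1 - \<eta>)"
  \<comment> \<open>the method\<close>
    and "0 < \<alpha>0" and \<alpha>: "\<alpha> = (\<lambda>n. \<alpha>0 / sqrt (real n))"
    and "prob_space M" and "\<forall>n. Is n \<in> M \<rightarrow>\<^sub>M restrict_space borel S"
    and "x0 \<in> X" and "\<forall>\<omega>\<in>space M. xs 0 \<omega> = x0"
    and "distr M (restrict_space borel S) (Is 0) = \<nu>"
    and "\<forall>n. \<forall>B\<in>sets (restrict_space borel S). AE \<omega> in M.
           real_cond_exp M (past_algebra M (restrict_space borel S) xs Is n)
             (\<lambda>\<omega>'. indicator B (Is (Suc n) \<omega>')) \<omega>
           = measure (P (xs n \<omega>) (Is n \<omega>)) B"
    and "\<forall>n. \<forall>\<omega>\<in>space M. xs (Suc n) \<omega> =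
           closest_point X (xs n \<omega> - \<alpha> (Suc n) *\<^sub>R Z (xs n \<omega>) (Is (Suc n) \<omega>))"
  shows "(\<forall>x\<in>X. \<forall>y\<in>X. (SUP I\<in>S. tv_dist (P x I) (P y I)) \<le> 2 * LQ / w * norm (x - y)) \<and>
    (\<forall>n\<ge>2. \<bar>(\<integral>\<omega>. F (weighted_average \<alpha> (\<lambda>k. xs k \<omega>) n) \<partial>M) - (INF x\<in>X. F x)\<bar>
       \<le> rate_const D Lf LQ \<alpha>0 * ((C + C\<^sup>2 / w) * (ln (real n) / sqrt (real n)))) \<and>
    (\<forall>n\<ge>1. \<bar>(\<integral>\<omega>. F (weighted_average real (\<lambda>k. xs k \<omega>) n) \<partial>M) - (INF x\<in>X. F x)\<bar>
       \<le> rate_const D Lf LQ \<alpha>0 * ((C + C\<^sup>2 / w) * (1 / sqrt (real n))))"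
proof -
  interpret \<nu>: prob_space \<nu> by fact
  have sets_\<nu>: "sets \<nu> = sets (restrict_space borel S)" by fact
  have sp: "space \<nu> = S" using sets_eq_imp_space_eq[OF sets_\<nu>] by (simp add: space_restrict_space)
  have S_ne: "S \<noteq> {}" using \<nu>.not_empty sp by simp
  note [measurable_cong] = sets_\<nu>
  have Lf: "0 \<le> Lf" using \<open>Lf-lipschitz_on N f\<close> by (rule lipschitz_on_nonneg)
  have q_lip: "\<bar>q x I - q y I\<bar> \<le> LQ * dist x y" if "x \<in> X" "y \<in> X" "I \<in> space \<nu>" for x y I
    using lipschitz_onD[of LQ X "\<lambda>x. q x I" x y] \<open>\<forall>I\<in>S. LQ-lipschitz_on X (\<lambda>x. q x I)\<close> that
    by (auto simp: sp dist_real_def)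
  have q_sec: "q x \<in> borel_measurable \<nu>" if "x \<in> X" for x
    using \<open>\<forall>x\<in>X. q x \<in> borel_measurable (restrict_space borel S)\<close> that
    by (auto cong: measurable_cong_sets)
  \<comment> \<open>The hypotheses give measurability of the scores for each fixed decision only;
    the Lipschitz bound in the decision makes it joint.\<close>
  have q_meas: "case_prod q \<in> borel_measurable (restrict_space borel X \<Otimes>\<^sub>M \<nu>)"
    by (rule measurable_of_lipschitz_sections[OF \<open>X \<noteq> {}\<close> _ q_sec q_lip]) (use \<open>0 < LQ\<close> in auto)
  have metro: "metropolis \<nu> (restrict_space borel X) q w LQ"
  proof (intro metropolis.intro metropolis_axioms.intro \<nu>.prob_space_axioms q_meas)
    fix x assume "x \<in> space (restrict_space borel X)"
    then have "bounded (q x ` S)" using \<open>\<forall>x\<in>X. bounded (q x ` S)\<close> by (simp add: space_restrict_space)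
    then show "\<exists>B. \<forall>I\<in>space \<nu>. \<bar>q x I\<bar> \<le> B" unfolding bounded_iff sp by auto
  qed (use q_lip \<open>0 < w\<close> \<open>0 < LQ\<close> in \<open>auto simp: space_restrict_space\<close>)
  interpret mp: metropolis \<nu> "restrict_space borel X" q w LQ by (rule metro)
  have prob_P: "prob_space (P x I)" if "x \<in> X" "I \<in> S" for x I
    unfolding P using mp.prob_P[of x I] that by (simp add: space_restrict_space sp)
  have mix: "tv_dist (mh_kernel \<nu> w q x I) (mh_kernel \<nu> w q x J) \<le> \<eta>" if "x \<in> X" "I \<in> space \<nu>" "J \<in> space \<nu>" for x I J
  proof -
    \<comment> \<open>A real supremum controls its members only if the set is bounded above; here
      total variation between probability measures is at most 1.\<close>
    have "(case (I, J) of (I, J) \<Rightarrow> tv_dist (P x I) (P x J)) \<le> (SUP (I, J)\<in>S \<times> S. tv_dist (P x I) (P x J))"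
      using that by (intro cSUP_upper bdd_aboveI2[of _ _ 1]) (auto simp: sp intro!: tv_dist_le_1 prob_P)
    also have "\<dots> \<le> \<eta>"
      using \<open>\<forall>x\<in>X. (SUP (I, J)\<in>S \<times> S. tv_dist (P x I) (P x J)) \<le> \<eta>\<close> that(1) by blast
    finally show ?thesis by (simp add: P)
  qed
  have g_norm: "norm (g x) \<le> Lf" if "x \<in> X" for x
    using norm_subgradient_le[OF \<open>open N\<close> _ \<open>Lf-lipschitz_on N f\<close>] that \<open>X \<subseteq> N\<close>
      \<open>\<forall>x\<in>X. g x \<in> subdifferential N f x\<close> by blast
  \<comment> \<open>The subgradient of \<open>f\<close> and the dual subgradient of the recourse
    cost at the same state add up.\<close>
  have Z_subgrad: "f x + q x I + Z x I \<bullet> (y - x) \<le> f y + q y I" if x: "x \<in> X" and y: "y \<in> X" and I: "I \<in> space \<nu>" for x y I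
  proof -
    have "f x + g x \<bullet> (y - x) \<le> f y"
      using \<open>\<forall>x\<in>X. g x \<in> subdifferential N f x\<close> x y \<open>X \<subseteq> N\<close> unfolding subdifferential_def by blast
    moreover have "q x I - (transpose E *v \<pi> x I) \<bullet> (y - x) \<le> q y I"
      unfolding q
    proof (rule recourse_cost_dual_subgradient)
      show "recourse_finite G E U b h x (\<xi> I)" "recourse_finite G E U b h y (\<xi> I)"
        using \<open>\<forall>x\<in>X. \<forall>\<zeta>\<in>\<Xi>. recourse_finite G E U b h x \<zeta>\<close> \<open>\<forall>I\<in>S. \<xi> I \<in> \<Xi>\<close> x y I sp by auto
      show "dual_maximizer G E U b h x (\<xi> I) (\<pi> x I)"
        using \<open>\<forall>x\<in>X. \<forall>I\<in>S. is_arg_min (\<lambda>p. norm1 (transpose E *v p)) (dual_maximizer G E U b h x (\<xi> I)) (\<pi> x I)\<close>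
          x I sp unfolding is_arg_min_def by blast
    qed
    ultimately show ?thesis unfolding Z inner_diff_left by linarith
  qed
  have Z_norm: "norm (Z x I) \<le> Lf + LQ" if "x \<in> X" "I \<in> space \<nu>" for x I
  proof -
    have "norm (transpose E *v \<pi> x I) \<le> LQ"
      using \<open>\<forall>x\<in>X. \<forall>I\<in>S. norm (transpose E *v \<pi> x I) \<le> LQ\<close> that sp by blast
    with g_norm[OF that(1)] norm_triangle_ineq4[of "g x" "transpose E *v \<pi> x I"]
    show ?thesis unfolding Z by linarith
  qed
  have Z_meas: "case_prod Z \<in> borel_measurable (restrict_space borel X \<Otimes>\<^sub>M \<nu>)"
  proof -
    note [measurable] = \<open>g \<in> borel_measurable (restrict_space borel X)\<close>
    have "case_prod \<pi> \<in> borel_measurable (restrict_space borel X \<Otimes>\<^sub>M \<nu>)"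
      using \<open>case_prod \<pi> \<in> borel_measurable (restrict_space borel X \<Otimes>\<^sub>M restrict_space borel S)\<close>
      by (simp cong: measurable_cong_sets sets_pair_measure_cong add: sets_\<nu>)
    moreover have "(\<lambda>p. transpose E *v p) \<in> borel_measurable borel"
      by (intro borel_measurable_continuous_onI matrix_vector_mult_linear_continuous_on)
    ultimately have E: "(\<lambda>z. transpose E *v case_prod \<pi> z) \<in> borel_measurable (restrict_space borel X \<Otimes>\<^sub>M \<nu>)"
      by (rule measurable_compose)
    have "(\<lambda>z. g (fst z)) \<in> borel_measurable (restrict_space borel X \<Otimes>\<^sub>M \<nu>)" by measurable
    from borel_measurable_diff[OF this E] show ?thesis unfolding Z by (simp add: case_prod_beta')
  qed
  \<comment> \<open>\<nu> and the trace of the Borel sets on \<open>S\<close> have the same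
    measurable sets, hence generate the same past.\<close>
  have Is_cond: "AE \<omega> in M. real_cond_exp M (past_algebra M \<nu> xs Is n) (\<lambda>\<omega>'. indicator B (Is (Suc n) \<omega>')) \<omega>
      = measure (mh_kernel \<nu> w q (xs n \<omega>) (Is n \<omega>)) B" if "B \<in> sets \<nu>" for n B
    unfolding past_algebra_cong[OF sets_\<nu>] P[symmetric]
    by (rule \<open>\<forall>n. \<forall>B\<in>sets (restrict_space borel S). AE \<omega> in M.
           real_cond_exp M (past_algebra M (restrict_space borel S) xs Is n)
             (\<lambda>\<omega>'. indicator B (Is (Suc n) \<omega>')) \<omega>
           = measure (P (xs n \<omega>) (Is n \<omega>)) B\<close>[rule_format, OF that[unfolded sets_\<nu>]])
  have meth: "mh_subgradient_method \<nu> X q w LQ M f Z D Lf \<eta> \<alpha> x0 xs Is"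
  proof (intro mh_subgradient_method.intro mh_subgradient_method_axioms.intro metro \<open>prob_space M\<close>)
    show "dist x y \<le> D" if "x \<in> X" "y \<in> X" for x y
    proof -
      have "norm1 (x - y) \<le> D" using \<open>\<forall>x\<in>X. \<forall>x'\<in>X. norm1 (x - x') \<le> D\<close> that by blast
      then show ?thesis using norm_le_l1_cart[of "x - y"] unfolding norm1_def dist_norm by linarith
    qed
    show "\<bar>f x - f y\<bar> \<le> Lf * dist x y" if "x \<in> X" "y \<in> X" for x y
      using lipschitz_onD[OF \<open>Lf-lipschitz_on N f\<close>, of x y] that \<open>X \<subseteq> N\<close> by (auto simp: dist_real_def)
    show "0 < \<alpha> (Suc n)" for n using \<open>0 < \<alpha>0\<close> by (simp add: \<alpha>)
    show "Is n \<in> M \<rightarrow>\<^sub>M \<nu>" for n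
      using \<open>\<forall>n. Is n \<in> M \<rightarrow>\<^sub>M restrict_space borel S\<close> by (simp cong: measurable_cong_sets add: sets_\<nu>)
    show "xs 0 \<omega> = x0" if "\<omega> \<in> space M" for \<omega>
      using that \<open>\<forall>\<omega>\<in>space M. xs 0 \<omega> = x0\<close> by blast
    show "xs (Suc n) \<omega> = closest_point X (xs n \<omega> - \<alpha> (Suc n) *\<^sub>R Z (xs n \<omega>) (Is (Suc n) \<omega>))"
      if "\<omega> \<in> space M" for n \<omega>
      using that \<open>\<forall>n. \<forall>\<omega>\<in>space M. xs (Suc n) \<omega> =
           closest_point X (xs n \<omega> - \<alpha> (Suc n) *\<^sub>R Z (xs n \<omega>) (Is (Suc n) \<omega>))\<close> by blast
  qed (fact | rule Lf mix Z_subgrad Z_norm Z_meas Is_cond; assumption)+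
  interpret sub: mh_subgradient_method \<nu> X q w LQ M f Z D Lf \<eta> \<alpha> x0 xs Is by (rule meth)
  show ?thesis
  proof (intro conjI ballI allI impI)
    fix x y assume "x \<in> X" "y \<in> X"
    then show "(SUP I\<in>S. tv_dist (P x I) (P y I)) \<le> 2 * LQ / w * norm (x - y)"
      using mp.tv_dist_P_lip[of x y] S_ne
      by (intro cSUP_least) (auto simp: P sp dist_norm space_restrict_space)
  next
    fix n :: nat assume "2 \<le> n"
    then show "\<bar>(\<integral>\<omega>. F (weighted_average \<alpha> (\<lambda>k. xs k \<omega>) n) \<partial>M) - (INF x\<in>X. F x)\<bar>
       \<le> rate_const D Lf LQ \<alpha>0 * ((C + C\<^sup>2 / w) * (ln (real n) / sqrt (real n)))"
      unfolding F by (rule sub.step_size_average_rate[OF \<open>0 < \<alpha>0\<close> \<alpha> C])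
  next
    fix n :: nat assume "1 \<le> n"
    then show "\<bar>(\<integral>\<omega>. F (weighted_average real (\<lambda>k. xs k \<omega>) n) \<partial>M) - (INF x\<in>X. F x)\<bar>
       \<le> rate_const D Lf LQ \<alpha>0 * ((C + C\<^sup>2 / w) * (1 / sqrt (real n)))"
      unfolding F by (rule sub.linear_average_rate[OF \<open>0 < \<alpha>0\<close> \<alpha> C])
  qed
qed

end
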